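(* Suppose that all of the following hold. (1) (Restricted cocoercivity) There is $\beta>0$ such that $\langle\mathbb F(x)-\mathbb F(x^* ),x-x^*\rangle\ge\beta\|\mathbb F(x)-\mathbb F(x^* )\|^2$ for all $x\in\mathbb R^n$ and all $x^*\in\mathrm{SOL}(\mathcal X,\mathbb F,G)$. (2) (Bounded step sizes) For some $\gamma>0$ and every $i\in\mathcal I$, $0<\alpha_i\le\big(\gamma+\max_{j\in\{1,\dots,n_i\}}\sum_{k=1}^m|[A_i^\top]_{jk}|\big)^{-1}$, $0<\nu_i\le(\gamma+2d_i)^{-1}$, $0<\sigma_i\le\big(\gamma+2d_i+\max_{j\in\{1,\dots,m\}}\sum_{k=1}^{n_i}|[A_i]_{jk}|\big)^{-1}$; moreover $\|\Phi^{-1}\|<2\theta$ for some $\theta$ with $0<\theta\le\min\{\tfrac1{2d^*},\beta\}$. (3) (Increasing batch size) For some $c,k_0,a>0$, $S_k\ge c(k+k_0)^{a+1}$ for all $k\ge1$. (4) (Variance reduction) There exist $p\ge2$, $\sigma_1\ge0$ and a measurable locally bounded function $\sigma:\mathrm{SOL}(\mathcal X,\mathbb F,G)\to\mathbb R$ such that, for all $x\in\mathbb R^n$ and $x^*\in\mathrm{SOL}(\mathcal X,\mathbb F,G)$, $$\mathbb E\big[\|F^{1}(x,\xi)-\mathbb F(x)\|^p\big]^{1/p}\le\sigma(x^* )+\sigma_1\|x-x^*\|.$$ Let $(x^k,z^k,\lambda^k)_{k\ge0}$ be generated from $x_i^0\in\Omega_i$, $z_i^0\in\mathbb R^m$, $\lambda_i^0\in\mathbb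 R^m_{\ge0}$ by, for all $i\in\mathcal I$ and $k\ge0$, $$x_i^{k+1}=\mathrm{prox}_{\alpha_ig_i}\big[x_i^k-\alpha_i(\hat F_i^k+A_i^\top\lambda_i^k)\big],\qquad z_i^{k+1}=z_i^k-\nu_i\sum_{j}w_{i,j}(\lambda_i^k-\lambda_j^k),$$ $$\lambda_i^{k+1}=\mathrm{proj}_{\mathbb R^m_{\ge0}}\Big[\lambda_i^k+\sigma_i\big(A_i(2x_i^{k+1}-x_i^k)-b_i\big)+\sigma_i\sum_jw_{i,j}\big(2(z_i^{k+1}-z_j^{k+1})-(z_i^k-z_j^k)\big)-\sigma_i\sum_jw_{i,j}(\lambda_i^k-\lambda_j^k)\Big],$$ where $\hat F_i^k=\frac1{S_k}\sum_{t=1}^{S_k}\nabla_{x_i}f_i(x^k,\xi_i^{k,(t)})$. Then $(x^k)_{k\in\mathbb N}$ converges almost surely to a v-SGNE of the game.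
   Context: Game. $\mathcal I=\{1,\dots,N\}$ is a set of agents; agent $i$ chooses $x_i\in\Omega_i\subseteq\mathbb R^{n_i}$; $n=\sum_in_i$, $x=\mathrm{col}(x_1,\dots,x_N)$, $x_{-i}=\mathrm{col}((x_j)_{j\ne i})$, $\Omega=\prod_i\Omega_i$. $\xi$ is an $\mathbb R^d$-valued random variable on a probability space $(\Xi,\mathcal F,\mathbb P)$. Agent $i$ has cost $\mathbb J_i(x_i,x_{-i})=\mathbb E[f_i(x_i,x_{-i},\xi)]+g_i(x_i)$ with $f_i:\mathbb R^n\times\mathbb R^d\to\mathbb R$ measurable and the expectation well defined. Given $A_i\in\mathbb R^{m\times n_i}$, $A=[A_1,\dots,A_N]$, $b\in\mathbb R^m$, agent $i$ minimizes $\mathbb J_i(x_i,x_{-i})$ over $x_i\in\Omega_i$ subject to $A_ix_i\le b-\sum_{j\ne i}A_jx_j$. The collective feasible set is $\mathcal X=\{y\in\Omega: Ay\le b\}$. The vector $b$ is split as $b=\sum_{i}b_i$, with $b_i\in\mathbb R^m$ known to agent $i$. Standing assumptions. (a) $g_i:\mathbb R^{n_i}\to\mathbb R\cup\{+\infty\}$ is lower semicontinuous and convex, and $\mathrm{dom}(g_i)=\Omega_i$ is nonempty, compact and convex. (b) For each $x_{-i}$, $x_i\mapsto\mathbb E[f_i(x_i,x_{-i},\xi)]$ is convex and continuously differentiable. (c) $\mathcal X$ satisfies Slater's constraint qualification. (d) For each value of $\xi$ and each $x_{-i}$, $f_i(\cdot,x_{-i},\xi)$ is convex, Lipschitz continuous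 and continuously differentiable; $f_i(x_i,x_{-i},\cdot)$ is measurable, and for each $x_{-i}$ the Lipschitz constant $\ell_i(x_{-i},\xi)$ is integrable in $\xi$. (e) The pseudogradient $\mathbb F(x)=\mathrm{col}\big((\mathbb E[\nabla_{x_i}f_i(x_i,x_{-i},\xi)])_{i\in\mathcal I}\big)$ is Lipschitz continuous (the constant is not needed by the algorithm). Solution concept. With $g(x)=\sum_ig_i(x_i)$ and $G(x)=\mathrm{col}(\partial g_1(x_1),\dots,\partial g_N(x_N))$, $\mathrm{SOL}(\mathcal X,\mathbb F,G)$ is the set of $x^*\in\mathcal X$ such that $\langle\mathbb F(x^* ),x-x^*\rangle+g(x)-g(x^* )\ge0$ for all $x\in\mathcal X$. A v-SGNE (variational stochastic generalized Nash equilibrium) of the game is an element of this set. Graph. $W=(w_{i,j})\in\mathbb R^{N\times N}$ is the (nonnegative) weighted adjacency matrix of an undirected connected graph on $\mathcal I$; sums over $j$ run over neighbours of $i$ in it. $d_i=\sum_jw_{i,j}$, $d^*=\max_id_i$, $L=\mathrm{diag}(d_1,\dots,d_N)-W$, $\mathbf L=L\otimes I_m$. Preconditioner. $\mathbf A=\mathrm{diag}\{A_1,\dots,A_N\}\in\mathbb R^{Nm\times n}$ (block diagonal), and $$\Phi=\begin{bmatrix}\alpha^{-1}&0&-\mathbf A^\top\\0&\nu^{-1}&-\mathbf L\\-\mathbf A&-\mathbf L&\sigma^{-1}\end{bmatrix},$$ where $\alpha^{-1}=\mathrm{diag}\{\alpha_1^{-1}I_{n_1},\dots,\alpha_N^{-1}I_{n_N}\}$,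 $\nu^{-1}=\mathrm{diag}\{\nu_i^{-1}I_m\}$, $\sigma^{-1}=\mathrm{diag}\{\sigma_i^{-1}I_m\}$. Sampling. At iteration $k$, $S_k\ge1$ samples are used; $\xi^{k,(t)}=(\xi_1^{k,(t)},\dots,\xi_N^{k,(t)})$, $t=1,\dots,S_k$, $k\ge0$, are i.i.d., each $\xi_i^{k,(t)}$ having the distribution of $\xi$, and independent of the initial data. For $\xi=(\xi_1,\dots,\xi_N)$ distributed as one such sample, $F^{1}(x,\xi)=\mathrm{col}(\nabla_{x_1}f_1(x,\xi_1),\dots,\nabla_{x_N}f_N(x,\xi_N))$ is the single-sample estimator. $\mathcal F_k$ is the $\sigma$-algebra generated by the initial data and all samples used in iterations $0,\dots,k-1$. The error $\epsilon_k=\mathrm{col}(\hat F_1^k,\dots,\hat F_N^k)-\mathbb F(x^k)$ satisfies $\mathbb E[\epsilon_k\mid\mathcal F_k]=0$ a.s. for all $k\ge0$. Notation. $\mathrm{prox}_{h}(v)=\mathrm{argmin}_u\{h(u)+\frac12\|u-v\|^2\}$. *)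

theory Defs
  imports "HOL-Probability.Probability"
begin

text \<open>
  Agents are the elements of a finite type \<open>'i\<close>. To allow a different strategy dimension for each
  agent, the coordinates of the stacked vector \<open>x = col(x\<^sub>1, \<dots>, x\<^sub>N)\<close> are the elements of a finite
  type \<open>'n\<close>, and \<open>own :: 'n \<Rightarrow> 'i\<close> maps a coordinate to the agent it belongs to, so that agent \<open>i\<close>
  has dimension \<open>card (own -` {i})\<close>. The space of the vectors \<open>x\<^sub>i\<close> is represented by the coordinate
  subspace \<open>block_space own i\<close> of \<open>real ^ 'n\<close>, and \<open>x\<^sub>i\<close> by \<open>block own i x\<close>.
\<close>

definition block_space :: "('n::finite \<Rightarrow> 'i) \<Rightarrow> 'i \<Rightarrow> (real ^ 'n) set" where
  "block_space own i = {u. \<forall>j. own j \<noteq> i \<longrightarrow> u $ j = 0}"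

definition block :: "('n::finite \<Rightarrow> 'i) \<Rightarrow> 'i \<Rightarrow> real ^ 'n \<Rightarrow> real ^ 'n" where
  "block own i x = (\<chi> j. if own j = i then x $ j else 0)"

definition col :: "('n::finite \<Rightarrow> 'i) \<Rightarrow> ('i \<Rightarrow> real ^ 'n) \<Rightarrow> real ^ 'n" where
  "col own v = (\<chi> j. v (own j) $ j)"

text \<open>The profile \<open>(u\<^sub>i, x\<^sub>-\<^sub>i)\<close>.\<close>

definition replace_block :: "('n::finite \<Rightarrow> 'i) \<Rightarrow> 'i \<Rightarrow> real ^ 'n \<Rightarrow> real ^ 'n \<Rightarrow> real ^ 'n" where
  "replace_block own i x u = (\<chi> j. if own j = i then u $ j else x $ j)"

definition block_columns ::
    "('n::finite \<Rightarrow> 'i) \<Rightarrow> real ^ 'n ^ 'm \<Rightarrow> 'i \<Rightarrow> real ^ 'n ^ 'm" where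
  "block_columns own A i = (\<chi> r j. if own j = i then A $ r $ j else 0)"

definition continuously_differentiable :: "(real ^ 'n \<Rightarrow> real) \<Rightarrow> bool" where
  "continuously_differentiable h \<longleftrightarrow>
     (\<exists>h'. (\<forall>u. GDERIV h u :> h' u) \<and> continuous_on UNIV h')"

text \<open>
  The partial gradient with respect to \<open>x\<^sub>i\<close>. The function that is differentiated depends on the
  coordinates of agent \<open>i\<close> only, so the gradient lies in \<open>block_space own i\<close>; joint
  differentiability of \<open>\<phi>\<close> is not required.
\<close>

definition partial_gradient ::
    "('n::finite \<Rightarrow> 'i) \<Rightarrow> 'i \<Rightarrow> (real ^ 'n \<Rightarrow> real) \<Rightarrow> real ^ 'n \<Rightarrow> real ^ 'n" where
  "partial_gradient own i \<phi> x = (THE D. GDERIV (\<lambda>u. \<phi> (replace_block own i x u)) x :> D)"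

definition pseudogradient ::
    "('n::finite \<Rightarrow> 'i) \<Rightarrow> 'p measure \<Rightarrow> ('p \<Rightarrow> real ^ 'd) \<Rightarrow>
     ('i \<Rightarrow> real ^ 'n \<Rightarrow> real ^ 'd \<Rightarrow> real) \<Rightarrow> real ^ 'n \<Rightarrow> real ^ 'n" where
  "pseudogradient own P \<xi> f x =
     col own (\<lambda>i. \<integral>w. partial_gradient own i (\<lambda>y. f i y (\<xi> w)) x \<partial>P)"

definition sample_pseudogradient ::
    "('n::finite \<Rightarrow> 'i::finite) \<Rightarrow> ('i \<Rightarrow> real ^ 'n \<Rightarrow> real ^ 'd \<Rightarrow> real) \<Rightarrow>
     real ^ 'n \<Rightarrow> real ^ 'd ^ 'i \<Rightarrow> real ^ 'n" where
  "sample_pseudogradient own f x s = col own (\<lambda>i. partial_gradient own i (\<lambda>y. f i y (s $ i)) x)"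

definition batch_gradient ::
    "('n::finite \<Rightarrow> 'i::finite) \<Rightarrow> ('i \<Rightarrow> real ^ 'n \<Rightarrow> real ^ 'd \<Rightarrow> real) \<Rightarrow>
     nat \<Rightarrow> (nat \<Rightarrow> real ^ 'd ^ 'i) \<Rightarrow> real ^ 'n \<Rightarrow> 'i \<Rightarrow> real ^ 'n" where
  "batch_gradient own f S s x i =
     (1 / real S) *\<^sub>R (\<Sum>t = 1..S. partial_gradient own i (\<lambda>y. f i y (s t $ i)) x)"

definition lsc_on :: "'a::topological_space set \<Rightarrow> ('a \<Rightarrow> ereal) \<Rightarrow> bool" where
  "lsc_on V h \<longleftrightarrow> (\<forall>u\<in>V. h u \<le> Liminf (at u within V) h)"

definition ereal_convex_on :: "'a::real_vector set \<Rightarrow> ('a \<Rightarrow> ereal) \<Rightarrow> bool" where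
  "ereal_convex_on V h \<longleftrightarrow>
     (\<forall>u\<in>V. \<forall>v\<in>V. \<forall>t::real. 0 < t \<and> t < 1 \<longrightarrow>
        h ((1 - t) *\<^sub>R u + t *\<^sub>R v) \<le> ereal (1 - t) * h u + ereal t * h v)"

text \<open>The proximal operator of a function defined on the subspace \<open>V\<close>.\<close>

definition prox :: "'a::real_normed_vector set \<Rightarrow> ('a \<Rightarrow> ereal) \<Rightarrow> 'a \<Rightarrow> 'a" where
  "prox V h v = arg_min (\<lambda>u. h u + ereal (1 / 2 * (norm (u - v))\<^sup>2)) (\<lambda>u. u \<in> V)"

definition strategy_set ::
    "('n::finite \<Rightarrow> 'i) \<Rightarrow> ('i \<Rightarrow> (real ^ 'n) set) \<Rightarrow> (real ^ 'n) set" where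
  "strategy_set own \<Omega> = {y. \<forall>i. block own i y \<in> \<Omega> i}"

definition feasible_set ::
    "('n::finite \<Rightarrow> 'i) \<Rightarrow> ('i \<Rightarrow> (real ^ 'n) set) \<Rightarrow> real ^ 'n ^ 'm \<Rightarrow> real ^ 'm \<Rightarrow> (real ^ 'n) set"
  where
  "feasible_set own \<Omega> A b = {y \<in> strategy_set own \<Omega>. A *v y \<le> b}"

definition slater ::
    "('n::finite \<Rightarrow> 'i) \<Rightarrow> ('i \<Rightarrow> (real ^ 'n) set) \<Rightarrow> real ^ 'n ^ 'm \<Rightarrow> real ^ 'm \<Rightarrow> bool" where
  "slater own \<Omega> A b \<longleftrightarrow> (\<exists>y \<in> strategy_set own \<Omega>. \<forall>r. (A *v y) $ r < b $ r)"

definition total_nonsmooth_cost ::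
    "('n::finite \<Rightarrow> 'i::finite) \<Rightarrow> ('i \<Rightarrow> real ^ 'n \<Rightarrow> ereal) \<Rightarrow> real ^ 'n \<Rightarrow> ereal" where
  "total_nonsmooth_cost own g x = (\<Sum>i\<in>UNIV. g i (block own i x))"

text \<open>
  The solutions of the mixed variational inequality with feasible set \<open>K\<close>, map \<open>F\<close> and convex
  function \<open>G\<close>. The variational equilibria of the game are, by definition, the elements of this set
  for the collective feasible set, the pseudogradient and \<open>total_nonsmooth_cost own g\<close>; the latter
  is finite on the feasible set, so the extended-real difference is unproblematic.
\<close>

definition vi_solutions ::
    "(real ^ 'n) set \<Rightarrow> (real ^ 'n \<Rightarrow> real ^ 'n) \<Rightarrow> (real ^ 'n \<Rightarrow> ereal) \<Rightarrow> (real ^ 'n) set" where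
  "vi_solutions K F G =
     {xs \<in> K. \<forall>x\<in>K. 0 \<le> ereal (F xs \<bullet> (x - xs)) + G x - G xs}"

definition v_SGNE ::
    "('n::finite \<Rightarrow> 'i::finite) \<Rightarrow> 'p measure \<Rightarrow> ('p \<Rightarrow> real ^ 'd) \<Rightarrow>
     ('i \<Rightarrow> real ^ 'n \<Rightarrow> real ^ 'd \<Rightarrow> real) \<Rightarrow> ('i \<Rightarrow> real ^ 'n \<Rightarrow> ereal) \<Rightarrow>
     ('i \<Rightarrow> (real ^ 'n) set) \<Rightarrow> real ^ 'n ^ 'm \<Rightarrow> real ^ 'm \<Rightarrow> (real ^ 'n) set" where
  "v_SGNE own P \<xi> f g \<Omega> A b =
     vi_solutions (feasible_set own \<Omega> A b) (pseudogradient own P \<xi> f) (total_nonsmooth_cost own g)"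

definition weighted_connected_graph :: "real ^ 'i ^ 'i::finite \<Rightarrow> bool" where
  "weighted_connected_graph W \<longleftrightarrow>
     (\<forall>i j. 0 \<le> W $ i $ j) \<and> transpose W = W \<and>
     (\<forall>i j. (i, j) \<in> {(k, l). W $ k $ l > 0}\<^sup>*)"

definition wdegree :: "real ^ 'i ^ 'i::finite \<Rightarrow> 'i \<Rightarrow> real" where
  "wdegree W i = (\<Sum>j\<in>UNIV. W $ i $ j)"

definition max_wdegree :: "real ^ 'i ^ 'i::finite \<Rightarrow> real" where
  "max_wdegree W = Max (range (wdegree W))"

definition laplacian :: "real ^ 'i ^ 'i::finite \<Rightarrow> real ^ 'i ^ 'i" where
  "laplacian W = (\<chi> i j. (if i = j then wdegree W i else 0) - W $ i $ j)"

text \<open>The Kronecker product of \<open>laplacian W\<close> with the identity matrix.\<close>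

definition stacked_laplacian ::
    "real ^ 'i ^ 'i::finite \<Rightarrow> real ^ ('i \<times> 'm::finite) ^ ('i \<times> 'm)" where
  "stacked_laplacian W = (\<chi> p q. laplacian W $ fst p $ fst q * mat 1 $ snd p $ snd q)"

definition block_diagonal ::
    "('n::finite \<Rightarrow> 'i::finite) \<Rightarrow> real ^ 'n ^ 'm::finite \<Rightarrow> real ^ 'n ^ ('i \<times> 'm)" where
  "block_diagonal own A = (\<chi> p j. block_columns own A (fst p) $ snd p $ j)"

definition preconditioner ::
    "('n::finite \<Rightarrow> 'i::finite) \<Rightarrow> real ^ 'n ^ 'm::finite \<Rightarrow> real ^ 'i ^ 'i \<Rightarrow>
     ('i \<Rightarrow> real) \<Rightarrow> ('i \<Rightarrow> real) \<Rightarrow> ('i \<Rightarrow> real) \<Rightarrow>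
     real ^ ('n + 'i \<times> 'm + 'i \<times> 'm) ^ ('n + 'i \<times> 'm + 'i \<times> 'm)" where
  "preconditioner own A W \<alpha> \<nu> \<sigma> = (\<chi> r c. case r of
       Inl j \<Rightarrow> (case c of
           Inl j' \<Rightarrow> (if j = j' then inverse (\<alpha> (own j)) else 0)
         | Inr (Inl q') \<Rightarrow> 0
         | Inr (Inr q') \<Rightarrow> - (transpose (block_diagonal own A) $ j $ q'))
     | Inr (Inl q) \<Rightarrow> (case c of
           Inl j' \<Rightarrow> 0
         | Inr (Inl q') \<Rightarrow> (if q = q' then inverse (\<nu> (fst q)) else 0)
         | Inr (Inr q') \<Rightarrow> - (stacked_laplacian W $ q $ q'))
     | Inr (Inr q) \<Rightarrow> (case c of
           Inl j' \<Rightarrow> - (block_diagonal own A $ q $ j')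
         | Inr (Inl q') \<Rightarrow> - (stacked_laplacian W $ q $ q')
         | Inr (Inr q') \<Rightarrow> (if q = q' then inverse (\<sigma> (fst q)) else 0)))"

text \<open>The spectral norm.\<close>

definition matrix_norm :: "real ^ 'k ^ 'l \<Rightarrow> real" where
  "matrix_norm B = onorm (\<lambda>v. B *v v)"

definition locally_bounded_on :: "'a::metric_space set \<Rightarrow> ('a \<Rightarrow> real) \<Rightarrow> bool" where
  "locally_bounded_on V h \<longleftrightarrow> (\<forall>u\<in>V. \<exists>r>0. bounded (h ` (V \<inter> ball u r)))"

text \<open>
  The \<open>\<sigma>\<close>-algebra generated by the initial data and the samples of the iterations before the
  \<open>k\<close>-th one; iteration \<open>l\<close> uses the samples \<open>X l t\<close> with \<open>1 \<le> t \<le> S l\<close>.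
\<close>

definition history ::
    "'w measure \<Rightarrow> ('w \<Rightarrow> 'a::topological_space) \<Rightarrow> (nat \<Rightarrow> nat) \<Rightarrow>
     (nat \<Rightarrow> nat \<Rightarrow> 'w \<Rightarrow> 'b::topological_space) \<Rightarrow> nat \<Rightarrow> 'w measure" where
  "history M init S X k = sigma (space M)
     ({init -` B \<inter> space M | B. B \<in> sets borel} \<union>
      {X l t -` B \<inter> space M | l t B. l < k \<and> t \<in> {1..S l} \<and> B \<in> sets borel})"

end

theory Submission
  imports Defs
begin

text \<open>
  The iteration is a forward-backward splitting in the metric of the preconditioner \<open>\<Phi>\<close>. For a state
  \<open>w = (x, z, \<lambda>)\<close> let \<open>C w = (F x, 0, L \<lambda> + col(b\<^sub>i))\<close> (\<open>forward_map\<close>), and let \<open>B\<close> (\<open>kkt_operator\<close>) be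
  the part of the optimality system that is treated implicitly: the subdifferential of \<open>g\<close>,
  the normal cone of the nonnegative orthant, and the skew coupling of the three components by the
  constraint matrices and the Laplacian. One step of the algorithm with gradient error \<open>\<epsilon>\<^sub>k\<close> says
  \<open>\<Phi> (w\<^sub>k - w\<^sub>k\<^sub>+\<^sub>1) - C w\<^sub>k - (\<epsilon>\<^sub>k, 0, 0) \<in> B w\<^sub>k\<^sub>+\<^sub>1\<close> (\<open>step_in_kkt_operator\<close>). At a zero of \<open>B + C\<close> all
  agents hold the same multiplier, because the graph is connected, and the \<open>x\<close>-components of the zeros
  are exactly the variational equilibria (\<open>zero_imp_vi\<close>, \<open>vi_imp_zero\<close>). An equilibrium exists by
  Brouwer's theorem, and the Slater point provides its multiplier.

  The step sizes make \<open>\<Phi>\<close> strictly diagonally dominant, hence positive definite. The map \<open>C\<close> is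
  cocoercive with constant \<open>\<theta>\<close> at the zeros: the pseudogradient by assumption, the Laplacian because
  its norm is at most \<open>2 d\<^sup>*\<close>. Monotonicity of \<open>B\<close> then gives, for every zero \<open>w\<^sup>*\<close>,
  \<open>\<parallel>w\<^sub>k\<^sub>+\<^sub>1 - w\<^sup>*\<parallel>\<^sup>2 \<le> \<parallel>w\<^sub>k - w\<^sup>*\<parallel>\<^sup>2 - (1 - \<parallel>\<Phi>\<^sup>-\<^sup>1\<parallel> / 2\<theta>) \<parallel>w\<^sub>k\<^sub>+\<^sub>1 - w\<^sub>k\<parallel>\<^sup>2 - 2 \<langle>\<epsilon>\<^sub>k, x\<^sub>k\<^sub>+\<^sub>1 - x\<^sup>*\<rangle>\<close>
  in the norm of \<open>\<Phi>\<close>. If the error terms form a convergent series, the distances converge, the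
  increments vanish, and every cluster point is a zero because the graph of \<open>B\<close> is closed; so the
  whole sequence converges (\<open>preconditioned_forward_backward_converges\<close>).

  The new iterate \<open>x\<^sub>k\<^sub>+\<^sub>1\<close> depends on \<open>\<epsilon>\<^sub>k\<close>. It is compared with the point \<open>y\<^sub>k\<close> that the exact gradient
  would have produced: \<open>\<langle>\<epsilon>\<^sub>k, x\<^sub>k\<^sub>+\<^sub>1 - x\<^sup>*\<rangle> = \<langle>\<epsilon>\<^sub>k, x\<^sub>k\<^sub>+\<^sub>1 - y\<^sub>k\<rangle> + \<langle>\<epsilon>\<^sub>k, y\<^sub>k\<rangle> - \<langle>\<epsilon>\<^sub>k, x\<^sup>*\<rangle>\<close>. Proximal maps are
  nonexpansive, so the first term is at most a constant times \<open>\<parallel>\<epsilon>\<^sub>k\<parallel>\<^sup>2\<close>. The strategy sets are compact,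
  so the variance bound is uniform along the iteration and the error of a batch of independent samples
  has second moment at most \<open>B / S\<^sub>k\<close>, which is summable. Hence \<open>\<Sum> \<parallel>\<epsilon>\<^sub>k\<parallel>\<^sup>2\<close> is finite almost surely, and
  \<open>\<Sum> \<langle>\<epsilon>\<^sub>k, y\<^sub>k\<rangle>\<close> and \<open>\<Sum> \<epsilon>\<^sub>k\<close>, being martingales bounded in \<open>L\<^sup>2\<close> (\<open>y\<^sub>k\<close> is bounded and determined by
  the past), converge almost surely. None of the three series involves \<open>x\<^sup>*\<close>, so a single null set
  serves all zeros, and off it the deterministic argument applies
  (\<open>forward_backward_path_converges\<close>).
\<close>

section \<open>Lower semicontinuity and proximal maps\<close>

text \<open>
  Extended-real costs are replaced by real functions on their compact domains. The filter
  \<open>at u within D\<close> omits \<open>u\<close>, where the inequality is immediate.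
\<close>

definition real_lsc_on :: "'a::topological_space set \<Rightarrow> ('a \<Rightarrow> real) \<Rightarrow> bool" where
  "real_lsc_on D h \<longleftrightarrow> (\<forall>u\<in>D. \<forall>c<h u. eventually (\<lambda>v. c < h v) (at u within D))"

text \<open>
  If no point were a minimizer, each point would have a neighbourhood on which \<open>h\<close> exceeds some
  other value of \<open>h\<close>; the least of the finitely many values that belong to a finite subcover would then
  exceed itself.
\<close>

lemma real_lsc_on_attains_min:
  assumes "compact D" "D \<noteq> {}" "real_lsc_on D h"
  shows "\<exists>p\<in>D. \<forall>u\<in>D. h p \<le> h u"
proof (rule ccontr)
  assume "\<not> ?thesis"
  then have "\<forall>p\<in>D. \<exists>u\<in>D. h u < h p" by (meson not_le)
  then obtain y where y: "\<And>p. p \<in> D \<Longrightarrow> y p \<in> D \<and> h (y p) < h p" by metis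
  have "\<exists>T. open T \<and> p \<in> T \<and> (\<forall>v\<in>T \<inter> D. h (y p) < h v)" if "p \<in> D" for p
  proof -
    have "eventually (\<lambda>v. h (y p) < h v) (at p within D)"
      using assms(3) y[OF that] that unfolding real_lsc_on_def by blast
    then obtain T where "open T" "p \<in> T" "\<forall>v\<in>T. v \<noteq> p \<longrightarrow> v \<in> D \<longrightarrow> h (y p) < h v"
      unfolding eventually_at_topological by blast
    then show ?thesis using y[OF that] by (intro exI[of _ T]) auto
  qed
  then obtain T where T: "\<And>p. p \<in> D \<Longrightarrow> open (T p) \<and> p \<in> T p \<and> (\<forall>v\<in>T p \<inter> D. h (y p) < h v)"
    by metis
  obtain E where E: "E \<subseteq> D" "finite E" "D \<subseteq> (\<Union>p\<in>E. T p)"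
    using compactE_image[OF assms(1), of D T] T by blast
  have "E \<noteq> {}" using E assms(2) by auto
  then obtain q where q: "q \<in> E" "\<And>p. p \<in> E \<Longrightarrow> h (y q) \<le> h (y p)"
    using ex_is_arg_min_if_finite[OF E(2), of "\<lambda>p. h (y p)"]
    unfolding is_arg_min_linorder by blast
  have "y q \<in> D" using q(1) E(1) y by blast
  then obtain p where p: "p \<in> E" "y q \<in> T p" using E(3) by blast
  have "h (y p) < h (y q)" using T[of p] p E(1) \<open>y q \<in> D\<close> by blast
  then show False using q(2)[OF p(1)] by simp
qed

lemma real_lsc_on_limit_le:
  assumes lsc: "real_lsc_on D h" and x: "x \<longlonglongrightarrow> xb" "\<And>n. x n \<in> D" "xb \<in> D"
    and t: "t \<longlonglongrightarrow> tb" "\<And>n. h (x n) \<le> t n"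
  shows "h xb \<le> tb"
proof (rule ccontr)
  assume "\<not> ?thesis"
  then obtain c where c: "tb < c" "c < h xb" using dense not_le by metis
  have "eventually (\<lambda>v. c < h v) (at xb within D)"
    using lsc c x(3) unfolding real_lsc_on_def by blast
  then obtain T where T: "open T" "xb \<in> T" "\<forall>v\<in>T. v \<noteq> xb \<longrightarrow> v \<in> D \<longrightarrow> c < h v"
    unfolding eventually_at_topological by blast
  have "eventually (\<lambda>n. x n \<in> T) sequentially" using topological_tendstoD[OF x(1) T(1,2)] .
  moreover have "eventually (\<lambda>n. t n < c) sequentially" using order_tendstoD(2)[OF t(1) c(1)] .
  ultimately have "eventually (\<lambda>n. False) sequentially"
  proof eventually_elim
    case (elim n)
    have "c < h (x n)" using T(3) elim(1) x(2)[of n] c(2) by (cases "x n = xb") auto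
    then show ?case using elim(2) t(2)[of n] by simp
  qed
  then show False by simp
qed

lemma real_lsc_on_add_continuous:
  assumes "real_lsc_on D h" "continuous_on D q"
  shows "real_lsc_on D (\<lambda>u. h u + q u)"
  unfolding real_lsc_on_def
proof (intro ballI allI impI)
  fix u c assume u: "u \<in> D" "c < h u + q u"
  define e where "e = (h u + q u - c) / 2"
  have e: "0 < e" using u(2) by (simp add: e_def)
  have "eventually (\<lambda>v. h u - e < h v) (at u within D)"
    using assms(1) u(1) e unfolding real_lsc_on_def by simp
  moreover have "eventually (\<lambda>v. q u - e < q v) (at u within D)"
    using assms(2) u(1) e by (intro order_tendstoD(1)[of q "q u"]) (auto simp: continuous_on_def)
  ultimately show "eventually (\<lambda>v. c < h v + q v) (at u within D)"
    by eventually_elim (auto simp: e_def field_simps)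
qed

lemma real_lsc_on_cmult:
  assumes "real_lsc_on D h" "(0::real) < a"
  shows "real_lsc_on D (\<lambda>u. a * h u)"
  unfolding real_lsc_on_def
proof (intro ballI allI impI)
  fix u c assume u: "u \<in> D" "c < a * h u"
  have "eventually (\<lambda>v. c / a < h v) (at u within D)"
    using assms u unfolding real_lsc_on_def by (metis mult.commute pos_divide_less_eq)
  then show "eventually (\<lambda>v. c < a * h v) (at u within D)"
    by eventually_elim (use assms(2) in \<open>simp add: field_simps\<close>)
qed

lemma real_lsc_on_comp:
  assumes "real_lsc_on D h" "continuous_on E q" "q ` E \<subseteq> D"
  shows "real_lsc_on E (\<lambda>u. h (q u))"
  unfolding real_lsc_on_def
proof (intro ballI allI impI)
  fix u c assume u: "u \<in> E" "c < h (q u)"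
  then have "eventually (\<lambda>v. c < h v) (at (q u) within D)"
    using assms unfolding real_lsc_on_def by blast
  then obtain T where T: "open T" "q u \<in> T" "\<forall>v\<in>T. v \<noteq> q u \<longrightarrow> v \<in> D \<longrightarrow> c < h v"
    unfolding eventually_at_topological by blast
  have "(q \<longlongrightarrow> q u) (at u within E)" using assms(2) u(1) by (auto simp: continuous_on_def)
  then have "eventually (\<lambda>v. q v \<in> T) (at u within E)" using T(1,2) by (rule topological_tendstoD)
  moreover have "eventually (\<lambda>v. v \<in> E) (at u within E)" by (simp add: eventually_at_filter)
  ultimately show "eventually (\<lambda>v. c < h (q v)) (at u within E)"
  proof eventually_elim
    case (elim v)
    then show ?case using T(3) assms(3) u(2) by (cases "q v = q u") auto
  qed
qed

lemma real_lsc_on_add: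
  assumes "real_lsc_on D h" "real_lsc_on D q"
  shows "real_lsc_on D (\<lambda>u. h u + q u)"
  unfolding real_lsc_on_def
proof (intro ballI allI impI)
  fix u c assume u: "u \<in> D" "c < h u + q u"
  define e where "e = (h u + q u - c) / 2"
  have e: "0 < e" using u(2) by (simp add: e_def)
  have "eventually (\<lambda>v. h u - e < h v) (at u within D)" "eventually (\<lambda>v. q u - e < q v) (at u within D)"
    using assms u(1) e unfolding real_lsc_on_def by simp_all
  then show "eventually (\<lambda>v. c < h v + q v) (at u within D)"
    by eventually_elim (auto simp: e_def field_simps)
qed

lemma real_lsc_on_sum:
  assumes "\<And>i. i \<in> I \<Longrightarrow> real_lsc_on D (h i)"
  shows "real_lsc_on D (\<lambda>u. \<Sum>i\<in>I. h i u)"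
  using assms
proof (induction I rule: infinite_finite_induct)
  case (insert i I)
  then show ?case by (simp add: real_lsc_on_add)
qed (auto simp: real_lsc_on_def)

lemma real_lsc_on_subset:
  assumes "real_lsc_on D h" "E \<subseteq> D" shows "real_lsc_on E h"
  using real_lsc_on_comp[OF assms(1), of E "\<lambda>u. u"] assms(2) by simp

lemma real_lsc_on_of_ereal:
  assumes lsc: "lsc_on V h" and D: "D \<subseteq> V" "\<And>u. u \<in> D \<Longrightarrow> h u = ereal (hr u)"
  shows "real_lsc_on D hr"
  unfolding real_lsc_on_def
proof (intro ballI allI impI)
  fix u c assume u: "u \<in> D" "c < hr u"
  have "ereal c < Liminf (at u within V) h"
    using lsc D u unfolding lsc_on_def by (metis less_ereal.simps(1) less_le_trans subsetD)
  then have "eventually (\<lambda>v. ereal c < h v) (at u within V)" by (rule less_LiminfD)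
  then have "eventually (\<lambda>v. v \<in> D \<longrightarrow> ereal c < h v) (at u within D)"
    using D(1) unfolding eventually_at_filter by (auto elim: eventually_mono)
  moreover have "eventually (\<lambda>v. v \<in> D) (at u within D)" by (simp add: eventually_at_filter)
  ultimately show "eventually (\<lambda>v. c < hr v) (at u within D)"
    by eventually_elim (simp add: D(2))
qed

text \<open>
  The variational characterization of \<open>p = prox\<^sub>h v\<close> on \<open>D\<close>, namely that \<open>v - p\<close> is a subgradient of \<open>h\<close>
  at \<open>p\<close>.
\<close>

definition is_prox :: "'a::real_inner set \<Rightarrow> ('a \<Rightarrow> real) \<Rightarrow> 'a \<Rightarrow> 'a \<Rightarrow> bool" where
  "is_prox D h v p \<longleftrightarrow> p \<in> D \<and> (\<forall>u\<in>D. (v - p) \<bullet> (u - p) \<le> h u - h p)"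

text \<open>
  Compare \<open>p\<close> with \<open>(1 - t) p + t u\<close>: the quadratic term contributes only to second order in \<open>t\<close>, so
  dividing by \<open>t\<close> and letting \<open>t\<close> tend to 0 leaves the subgradient inequality.
\<close>

lemma is_prox_if_minimizer:
  assumes D: "convex D" "convex_on D h" and p: "p \<in> D"
    and min: "\<And>u. u \<in> D \<Longrightarrow> h p + 1/2 * (norm (p - v))\<^sup>2 \<le> h u + 1/2 * (norm (u - v))\<^sup>2"
  shows "is_prox D h v p"
  unfolding is_prox_def
proof (intro conjI ballI)
  fix u assume u: "u \<in> D"
  have *: "(v - p) \<bullet> (u - p) \<le> h u - h p + t * (1/2 * (norm (u - p))\<^sup>2)"
    if t: "0 < t" "t < 1" for t :: real
  proof -
    define y where "y = (1 - t) *\<^sub>R p + t *\<^sub>R u"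
    have "y \<in> D" unfolding y_def using D(1) p u t by (simp add: convexD)
    have y: "y - v = (p - v) + t *\<^sub>R (u - p)" by (simp add: y_def algebra_simps)
    have "h p + 1/2 * (norm (p - v))\<^sup>2 \<le> h y + 1/2 * (norm (y - v))\<^sup>2"
      using min[OF \<open>y \<in> D\<close>] .
    also have "h y \<le> (1 - t) * h p + t * h u"
      unfolding y_def using D(2) p u t by (intro convex_onD) auto
    also have "(norm (y - v))\<^sup>2 = (norm (p - v))\<^sup>2 + 2 * t * ((p - v) \<bullet> (u - p)) + t\<^sup>2 * (norm (u - p))\<^sup>2"
      unfolding y power2_norm_eq_inner
      by (simp add: inner_add_left inner_add_right inner_commute power2_eq_square algebra_simps)
    finally have "0 \<le> t * (h u - h p + (p - v) \<bullet> (u - p) + t * (1/2 * (norm (u - p))\<^sup>2))"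
      by (simp add: algebra_simps power2_eq_square)
    then have "0 \<le> h u - h p + (p - v) \<bullet> (u - p) + t * (1/2 * (norm (u - p))\<^sup>2)"
      using t(1) by (simp add: zero_le_mult_iff)
    moreover have "(p - v) \<bullet> (u - p) = - ((v - p) \<bullet> (u - p))"
      by (simp add: inner_diff_left)
    ultimately show ?thesis by simp
  qed
  show "(v - p) \<bullet> (u - p) \<le> h u - h p"
  proof (rule tendsto_lowerbound)
    show "((\<lambda>t. h u - h p + t * (1/2 * (norm (u - p))\<^sup>2)) \<longlongrightarrow> h u - h p) (at_right 0)"
      by (auto intro!: tendsto_eq_intros)
    show "eventually (\<lambda>t. (v - p) \<bullet> (u - p) \<le> h u - h p + t * (1/2 * (norm (u - p))\<^sup>2)) (at_right 0)"
      unfolding eventually_at_right[OF zero_less_one] using * by (intro exI[of _ 1]) auto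
  qed simp
qed (fact p)

lemma prox_minimizer_exists:
  fixes D :: "'a::real_inner set"
  assumes "compact D" "D \<noteq> {}" "real_lsc_on D h"
  shows "\<exists>p\<in>D. \<forall>u\<in>D. h p + 1/2 * (norm (p - v))\<^sup>2 \<le> h u + 1/2 * (norm (u - v))\<^sup>2"
  by (intro real_lsc_on_attains_min assms real_lsc_on_add_continuous continuous_intros)

lemma is_prox_exists:
  fixes D :: "'a::real_inner set"
  assumes "compact D" "D \<noteq> {}" "convex D" "real_lsc_on D h" "convex_on D h"
  shows "\<exists>p. is_prox D h v p"
proof -
  obtain p where "p \<in> D" "\<And>u. u \<in> D \<Longrightarrow> h p + 1/2 * (norm (p - v))\<^sup>2 \<le> h u + 1/2 * (norm (u - v))\<^sup>2"
    using prox_minimizer_exists[OF assms(1,2,4)] by blast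
  then show ?thesis using is_prox_if_minimizer[OF assms(3,5)] by blast
qed

lemma is_prox_nonexpansive:
  assumes "is_prox D h v p" "is_prox D h v' p'"
  shows "norm (p - p') \<le> norm (v - v')"
proof -
  have "(v - p) \<bullet> (p' - p) \<le> h p' - h p" "(v' - p') \<bullet> (p - p') \<le> h p - h p'"
    using assms unfolding is_prox_def by blast+
  then have "(norm (p - p'))\<^sup>2 \<le> (v - v') \<bullet> (p - p')"
    unfolding power2_norm_eq_inner by (simp add: inner_diff_left inner_diff_right inner_commute algebra_simps)
  also have "\<dots> \<le> norm (v - v') * norm (p - p')" by (rule norm_cauchy_schwarz)
  finally show ?thesis unfolding power2_eq_square
    by (metis mult_le_cancel_right norm_ge_zero norm_le_zero_iff not_le order_less_le)
qed

text \<open>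
  The bridge from \<open>prox\<close>, an extended-real minimization over the whole space \<open>V\<close>, to \<open>is_prox\<close>: outside
  \<open>D\<close> the objective is infinite, so the chosen minimizer lies in \<open>D\<close>.
\<close>

lemma prox_is_prox:
  fixes D :: "'a::real_inner set"
  assumes D: "compact D" "D \<noteq> {}" "convex D" "real_lsc_on D hr" "convex_on D hr"
    and h: "D \<subseteq> V" "\<And>u. u \<in> D \<Longrightarrow> h u = ereal (hr u)" "\<And>u. u \<in> V - D \<Longrightarrow> h u = \<infinity>"
  shows "is_prox D hr v (prox V h v)"
proof -
  let ?f = "\<lambda>u. h u + ereal (1 / 2 * (norm (u - v))\<^sup>2)"
  obtain p where p: "p \<in> D" "\<And>u. u \<in> D \<Longrightarrow> hr p + 1/2 * (norm (p - v))\<^sup>2 \<le> hr u + 1/2 * (norm (u - v))\<^sup>2"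
    using prox_minimizer_exists[OF D(1,2,4)] by blast
  have fD: "?f u = ereal (hr u + 1/2 * (norm (u - v))\<^sup>2)" if "u \<in> D" for u
    using h(2)[OF that] by simp
  have fp: "?f p \<le> ?f u" if "u \<in> V" for u
    using p fD[of u] fD[OF p(1)] h(3)[of u] that by (cases "u \<in> D") auto
  have "is_arg_min ?f (\<lambda>u. u \<in> V) p"
    unfolding is_arg_min_linorder using fp p(1) h(1) by blast
  then have "is_arg_min ?f (\<lambda>u. u \<in> V) (prox V h v)"
    unfolding prox_def arg_min_def by (rule someI)
  then have q: "prox V h v \<in> V" "\<And>u. u \<in> V \<Longrightarrow> ?f (prox V h v) \<le> ?f u"
    unfolding is_arg_min_linorder by blast+
  have qD: "prox V h v \<in> D"
  proof (rule ccontr)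
    assume "prox V h v \<notin> D"
    then have "?f (prox V h v) = \<infinity>" using h(3) q(1) by simp
    then show False using q(2)[of p] fD[OF p(1)] p(1) h(1) by auto
  qed
  show ?thesis
  proof (rule is_prox_if_minimizer[OF D(3,5) qD])
    fix u assume "u \<in> D"
    then show "hr (prox V h v) + 1/2 * (norm (prox V h v - v))\<^sup>2 \<le> hr u + 1/2 * (norm (u - v))\<^sup>2"
      using q(2)[of u] h(1) fD[of u] fD[OF qD] by auto
  qed
qed

lemma convex_on_real_of_ereal:
  assumes "ereal_convex_on V h" and D: "D \<subseteq> V" "convex D" "\<And>u. u \<in> D \<Longrightarrow> h u = ereal (hr u)"
  shows "convex_on D hr"
proof (rule convex_onI)
  fix t :: real and u v assume *: "0 < t" "t < 1" "u \<in> D" "v \<in> D"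
  have "(1 - t) *\<^sub>R u + t *\<^sub>R v \<in> D" using D(2) * by (simp add: convexD)
  moreover have "h ((1 - t) *\<^sub>R u + t *\<^sub>R v) \<le> ereal (1 - t) * h u + ereal t * h v"
    using assms(1) * D(1) unfolding ereal_convex_on_def by blast
  ultimately show "hr ((1 - t) *\<^sub>R u + t *\<^sub>R v) \<le> (1 - t) * hr u + t * hr v"
    using D(3) * by simp
qed (fact D(2))

section \<open>Preconditioned forward-backward iterations with errors\<close>

text \<open>
  Subtracting the partial sums of \<open>\<eta>\<close> turns \<open>a\<close> into a decreasing sequence that is bounded below. The
  terms of \<open>\<eta>\<close> may have either sign and the series need only converge conditionally, which is what the
  martingale part of the errors requires.
\<close>

lemma perturbed_descent_converges:
  fixes a r \<eta> :: "nat \<Rightarrow> real"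
  assumes a: "\<And>k. 0 \<le> a k" and r: "\<And>k. 0 \<le> r k"
    and step: "\<And>k. a (Suc k) \<le> a k - r k + \<eta> k" and eta: "summable \<eta>"
  shows "convergent a" "summable r"
proof -
  define s where "s k = a k - (\<Sum>j<k. \<eta> j)" for k
  have s_step: "s (Suc k) \<le> s k - r k" for k using step[of k] by (simp add: s_def)
  have "convergent (\<lambda>k. \<Sum>j<k. \<eta> j)" using eta summable_iff_convergent by blast
  then have "Bseq (\<lambda>k. \<Sum>j<k. \<eta> j)" by (rule convergent_imp_Bseq)
  then obtain B where B: "\<And>k. \<bar>\<Sum>j<k. \<eta> j\<bar> \<le> B" unfolding Bseq_def by auto
  have lb: "- B \<le> s k" for k using a[of k] B[of k] by (simp add: s_def)
  have dec: "decseq s"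
    by (intro decseq_SucI) (use s_step r in \<open>meson diff_le_eq le_add_same_cancel1 order_trans\<close>)
  have "convergent s" using dec lb by (metis convergentI decseq_convergent)
  then have "convergent (\<lambda>k. s k + (\<Sum>j<k. \<eta> j))"
    using \<open>convergent (\<lambda>k. \<Sum>j<k. \<eta> j)\<close> by (rule convergent_add)
  then show "convergent a" by (simp add: s_def)
  have "(\<Sum>j<k. r j) \<le> s 0 - s k" for k
  proof (induction k)
    case (Suc k) then show ?case using s_step[of k] by simp
  qed simp
  then have "(\<Sum>j<k. r j) \<le> s 0 + B" for k using lb[of k] by (smt (verit))
  then show "summable r" using r by (intro summableI_nonneg_bounded) auto
qed

text \<open>
  The squared \<open>\<Phi>\<close>-distance to a zero decreases up to a convergent perturbation, as in Fejer monotone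
  sequences. The errors enter only through the lower bound \<open>noise\<close> for their inner product with
  \<open>w\<^sub>k\<^sub>+\<^sub>1 - vs\<close>, because in the application this bound is summable while the norms of the errors need
  not be.
\<close>

lemma preconditioned_forward_backward_converges:
  fixes \<Phi> C :: "'a::euclidean_space \<Rightarrow> 'a" and B :: "('a \<times> 'a) set"
    and w e :: "nat \<Rightarrow> 'a" and \<delta> :: "'a \<Rightarrow> nat \<Rightarrow> real"
  defines "Z \<equiv> {v. (v, - C v) \<in> B}"
  assumes lin: "linear \<Phi>" and sym: "\<And>u v. \<Phi> u \<bullet> v = u \<bullet> \<Phi> v"
    and coerc: "0 < \<kappa>" "\<And>v. (norm v)\<^sup>2 \<le> \<kappa> * (\<Phi> v \<bullet> v)"
    and theta: "\<kappa> < 2 * \<theta>"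
    and mono: "\<And>u u' v v'. (u, u') \<in> B \<Longrightarrow> (v, v') \<in> B \<Longrightarrow> 0 \<le> (u' - v') \<bullet> (u - v)"
    and closed: "closed B"
    and C_cont: "continuous_on UNIV C"
    and coco: "\<And>v vs. vs \<in> Z \<Longrightarrow> \<theta> * (norm (C v - C vs))\<^sup>2 \<le> (C v - C vs) \<bullet> (v - vs)"
    and Z_ne: "Z \<noteq> {}"
    and step: "\<And>k. (w (Suc k), \<Phi> (w k - w (Suc k)) - C (w k) - e k) \<in> B"
    and e0: "e \<longlonglongrightarrow> 0"
    and noise: "\<And>vs k. vs \<in> Z \<Longrightarrow> - \<delta> vs k \<le> e k \<bullet> (w (Suc k) - vs)"
    and summ: "\<And>vs. vs \<in> Z \<Longrightarrow> summable (\<delta> vs)"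
  shows "\<exists>wb\<in>Z. w \<longlonglongrightarrow> wb"
proof -
  interpret linear \<Phi> by fact
  define q where "q v = \<Phi> v \<bullet> v" for v
  have q_lb: "(norm v)\<^sup>2 \<le> \<kappa> * q v" for v using coerc(2)[of v] by (simp add: q_def)
  have q_nn: "0 \<le> q v" for v
    using q_lb[of v] coerc(1) by (smt (verit) zero_le_mult_iff zero_le_power2)
  have q_cont: "continuous_on UNIV q"
    unfolding q_def using linear_continuous_on[OF linear_conv_bounded_linear[THEN iffD1, OF lin]]
    by (intro continuous_intros) auto
  define \<tau> where "\<tau> = 1 - \<kappa> / (2 * \<theta>)"
  have th: "0 < \<theta>" using coerc(1) theta by simp
  have tau: "0 < \<tau>" using theta coerc(1) th by (simp add: \<tau>_def field_simps)
  have fejer: "q (w (Suc k) - vs) \<le> q (w k - vs) - \<tau> * q (w k - w (Suc k)) + 2 * \<delta> vs k"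
    if vs: "vs \<in> Z" for vs k
  proof -
    let ?w = "w k" and ?p = "w (Suc k)"
    let ?D = "C ?w - C vs"
    have "0 \<le> (\<Phi> (?w - ?p) - C ?w - e k - (- C vs)) \<bullet> (?p - vs)"
      using mono[OF step, of vs "- C vs" k] vs unfolding Z_def by simp
    then have 1: "0 \<le> \<Phi> (?w - ?p) \<bullet> (?p - vs) - ?D \<bullet> (?p - vs) - e k \<bullet> (?p - vs)"
      by (simp add: inner_diff_left inner_diff_right algebra_simps)
    have 2: "2 * (\<Phi> (?w - ?p) \<bullet> (?p - vs)) = q (?w - vs) - q (?p - vs) - q (?w - ?p)"
    proof -
      have "?w - vs = (?w - ?p) + (?p - vs)" by simp
      then have "q (?w - vs) = q (?w - ?p) + q (?p - vs) + 2 * (\<Phi> (?w - ?p) \<bullet> (?p - vs))"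
        unfolding q_def using sym[of "?p - vs" "?w - ?p"]
        by (simp only: add inner_add_left inner_add_right) (simp add: inner_commute)
      then show ?thesis by simp
    qed
    have 3: "?D \<bullet> (?p - vs) \<ge> \<theta> * (norm ?D)\<^sup>2 - norm ?D * norm (?w - ?p)"
    proof -
      have "?D \<bullet> (?p - vs) = ?D \<bullet> (?w - vs) - ?D \<bullet> (?w - ?p)" by (simp add: inner_diff_right)
      moreover have "?D \<bullet> (?w - ?p) \<le> norm ?D * norm (?w - ?p)" by (rule norm_cauchy_schwarz)
      ultimately show ?thesis using coco[OF vs, of ?w] by simp
    qed
    (* Young's inequality, weighted so that the term in D cancels against the one from cocoercivity. *)
    have 4: "2 * (norm ?D * norm (?w - ?p)) \<le> 2 * \<theta> * (norm ?D)\<^sup>2 + \<kappa> / (2 * \<theta>) * q (?w - ?p)"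
    proof -
      have "0 \<le> (2 * \<theta> * norm ?D - norm (?w - ?p))\<^sup>2" by simp
      then have "2 * (2 * \<theta>) * (norm ?D * norm (?w - ?p)) \<le> (2 * \<theta>) * (2 * \<theta>) * (norm ?D)\<^sup>2 + (norm (?w - ?p))\<^sup>2"
        by (simp add: power2_eq_square algebra_simps)
      also have "\<dots> \<le> (2 * \<theta>) * (2 * \<theta>) * (norm ?D)\<^sup>2 + \<kappa> * q (?w - ?p)" using q_lb by simp
      finally have "(2 * \<theta>) * (2 * (norm ?D * norm (?w - ?p)))
          \<le> (2 * \<theta>) * (2 * \<theta> * (norm ?D)\<^sup>2 + \<kappa> / (2 * \<theta>) * q (?w - ?p))"
        using th by (simp add: distrib_left mult.assoc)
      then show ?thesis using th mult_le_cancel_left_pos[of "2 * \<theta>"] by simp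
    qed
    have 5: "- \<delta> vs k \<le> e k \<bullet> (?p - vs)" by (rule noise[OF vs])
    have t: "\<tau> * q (?w - ?p) = q (?w - ?p) - \<kappa> / (2 * \<theta>) * q (?w - ?p)"
      by (simp add: \<tau>_def left_diff_distrib)
    show ?thesis using 1 2 3 4 5 t by linarith
  qed
  have conv: "convergent (\<lambda>k. q (w k - vs))"
    and summ_q: "summable (\<lambda>k. \<tau> * q (w k - w (Suc k)))" if "vs \<in> Z" for vs
    using perturbed_descent_converges[of "\<lambda>k. q (w k - vs)" "\<lambda>k. \<tau> * q (w k - w (Suc k))" "\<lambda>k. 2 * \<delta> vs k"]
      fejer[OF that] q_nn tau summ[OF that] by (auto intro!: summable_mult)
  obtain v0 where v0: "v0 \<in> Z" using Z_ne by blast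
  have "(\<lambda>k. \<tau> * q (w k - w (Suc k))) \<longlonglongrightarrow> 0" using summ_q[OF v0] by (rule summable_LIMSEQ_zero)
  then have "(\<lambda>k. \<kappa> / \<tau> * (\<tau> * q (w k - w (Suc k)))) \<longlonglongrightarrow> 0" by (rule tendsto_mult_right_zero)
  then have "(\<lambda>k. \<kappa> * q (w k - w (Suc k))) \<longlonglongrightarrow> 0" using tau by simp
  then have "(\<lambda>k. (norm (w k - w (Suc k)))\<^sup>2) \<longlonglongrightarrow> 0"
    by (rule tendsto_sandwich[OF _ _ tendsto_const, rotated 2]) (auto intro!: always_eventually q_lb)
  then have diff0: "(\<lambda>k. w k - w (Suc k)) \<longlonglongrightarrow> 0"
    by (simp add: tendsto_norm_zero_iff)
  obtain K where K: "\<And>k. q (w k - v0) \<le> K"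
    using convergent_imp_Bseq[OF conv[OF v0]] unfolding Bseq_def by (auto simp: q_nn)
  have "norm (w k) \<le> norm v0 + sqrt (\<kappa> * K)" for k
  proof -
    have "(norm (w k - v0))\<^sup>2 \<le> \<kappa> * K" using q_lb[of "w k - v0"] K[of k] coerc(1)
      by (meson mult_left_mono order_less_imp_le order_trans)
    then have "norm (w k - v0) \<le> sqrt (\<kappa> * K)" by (rule real_le_rsqrt)
    then show ?thesis using norm_triangle_sub[of "w k" v0] by simp
  qed
  then have "bounded (range w)" by (intro boundedI) auto
  then obtain wb s where s: "strict_mono s" "(w \<circ> s) \<longlonglongrightarrow> wb"
    using bounded_imp_convergent_subsequence by blast
  have s0: "(\<lambda>n. w (s n) - w (Suc (s n))) \<longlonglongrightarrow> 0"
    using LIMSEQ_subseq_LIMSEQ[OF diff0 s(1)] by (simp add: o_def)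
  have sw: "(\<lambda>n. w (s n)) \<longlonglongrightarrow> wb" using s(2) by (simp add: o_def)
  have sp: "(\<lambda>n. w (Suc (s n))) \<longlonglongrightarrow> wb" using tendsto_diff[OF sw s0] by simp
  have \<Phi>0: "(\<lambda>n. \<Phi> (w (s n) - w (Suc (s n)))) \<longlonglongrightarrow> 0"
    by (rule bounded_linear.tendsto_zero[OF linear_conv_bounded_linear[THEN iffD1, OF lin] s0])
  have C0: "(\<lambda>n. C (w (s n))) \<longlonglongrightarrow> C wb"
    using continuous_on_tendsto_compose[OF C_cont sw] by simp
  have e0': "(\<lambda>n. e (s n)) \<longlonglongrightarrow> 0" using LIMSEQ_subseq_LIMSEQ[OF e0 s(1)] by (simp add: o_def)
  have "(\<lambda>n. (w (Suc (s n)), \<Phi> (w (s n) - w (Suc (s n))) - C (w (s n)) - e (s n))) \<longlonglongrightarrow> (wb, 0 - C wb - 0)"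
    by (intro tendsto_intros sp \<Phi>0 C0 e0')
  then have "(wb, 0 - C wb - 0) \<in> B"
    by (rule closed_sequentially[OF closed step])
  then have wbZ: "wb \<in> Z" unfolding Z_def by simp
  obtain L where L: "(\<lambda>k. q (w k - wb)) \<longlonglongrightarrow> L" using conv[OF wbZ] unfolding convergent_def by blast
  have "(\<lambda>n. q (w (s n) - wb)) \<longlonglongrightarrow> q (wb - wb)"
    by (rule continuous_on_tendsto_compose[OF q_cont tendsto_diff[OF sw tendsto_const]]) auto
  then have "L = 0"
    using LIMSEQ_unique[OF LIMSEQ_subseq_LIMSEQ[OF L s(1)]] by (simp add: o_def q_def zero)
  then have "(\<lambda>k. \<kappa> * q (w k - wb)) \<longlonglongrightarrow> 0" using tendsto_mult_left[OF L, of \<kappa>] by simp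
  then have "(\<lambda>k. (norm (w k - wb))\<^sup>2) \<longlonglongrightarrow> 0"
    by (rule tendsto_sandwich[OF _ _ tendsto_const, rotated 2]) (auto intro!: always_eventually q_lb)
  then have "w \<longlonglongrightarrow> wb" by (simp add: tendsto_norm_zero_iff LIM_zero_iff)
  then show ?thesis using wbZ by blast
qed

section \<open>Mixed variational inequalities and Lagrange multipliers\<close>

lemma vi_of_is_prox_fixed_point:
  assumes "is_prox D h (x - F) x" "u \<in> D"
  shows "0 \<le> F \<bullet> (u - x) + h u - h x"
  using assms unfolding is_prox_def by (force simp: inner_diff_left)

text \<open>
  The solutions are the fixed points of \<open>x \<mapsto> prox\<^sub>h (x - F x)\<close>, a continuous self-map of \<open>K\<close>, so Brouwer's
  theorem applies.
\<close>

lemma vi_solution_exists: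
  fixes K :: "'a::euclidean_space set"
  assumes K: "compact K" "convex K" "K \<noteq> {}" and h: "real_lsc_on K h" "convex_on K h"
    and F: "continuous_on K F"
  shows "\<exists>x\<in>K. \<forall>u\<in>K. 0 \<le> F x \<bullet> (u - x) + h u - h x"
proof -
  define T where "T v = (SOME p. is_prox K h v p)" for v
  have T: "is_prox K h v (T v)" for v
    unfolding T_def by (rule someI_ex) (rule is_prox_exists[OF K(1,3,2) h])
  have T_cont: "continuous_on UNIV T"
    using is_prox_nonexpansive[OF T T]
    by (intro lipschitz_on_continuous_on[of 1] lipschitz_onI) (auto simp: dist_norm)
  obtain x where x: "x \<in> K" "T (x - F x) = x"
  proof (rule brouwer[OF K(1,2,3)])
    show "continuous_on K (\<lambda>x. T (x - F x))"
      by (rule continuous_on_compose2[OF T_cont]) (auto intro!: continuous_intros F)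
    show "(\<lambda>x. T (x - F x)) \<in> K \<rightarrow> K" using T unfolding is_prox_def by blast
  qed
  then have "is_prox K h (x - F x) x" using T by metis
  with x show ?thesis using vi_of_is_prox_fixed_point by blast
qed

text \<open>
  Separate the origin from the convex set of pairs (attainable excess of the objective, attainable slack
  of the constraints). The normal vector of the separating hyperplane has a positive first component,
  since otherwise the Slater point would lie strictly on the wrong side; normalizing that component to 1
  leaves the multiplier.
\<close>

lemma lagrange_multiplier_exists:
  fixes A :: "real ^ 'n ^ 'm" and b :: "real ^ 'm" and D :: "(real ^ 'n) set"
  assumes D: "convex D" "convex_on D \<phi>" and xs: "xs \<in> D" "A *v xs \<le> b"
    and min: "\<And>u. u \<in> D \<Longrightarrow> A *v u \<le> b \<Longrightarrow> \<phi> xs \<le> \<phi> u"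
    and slater: "y0 \<in> D" "\<And>r. (A *v y0) $ r < b $ r"
  shows "\<exists>\<mu>. 0 \<le> \<mu> \<and> \<mu> \<bullet> (A *v xs - b) = 0 \<and> (\<forall>u\<in>D. \<phi> xs \<le> \<phi> u + \<mu> \<bullet> (A *v u - b))"
proof -
  define V where "V = {(t, s). \<exists>u\<in>D. \<phi> u - \<phi> xs < t \<and> A *v u - b \<le> s}"
  have Vc: "convex V"
  proof (rule convexI)
    fix p q :: "real \<times> (real ^ 'm)" and a c :: real
    assume *: "p \<in> V" "q \<in> V" "0 \<le> a" "0 \<le> c" "a + c = 1"
    obtain t s where p: "p = (t, s)" by (cases p)
    obtain t' s' where q: "q = (t', s')" by (cases q)
    obtain u where u: "u \<in> D" "\<phi> u - \<phi> xs < t" "A *v u - b \<le> s" using *(1) p unfolding V_def by auto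
    obtain u' where u': "u' \<in> D" "\<phi> u' - \<phi> xs < t'" "A *v u' - b \<le> s'" using *(2) q unfolding V_def by auto
    have 1: "a *\<^sub>R u + c *\<^sub>R u' \<in> D" using D(1) u u' * by (simp add: convexD)
    have "\<phi> (a *\<^sub>R u + c *\<^sub>R u') \<le> a * \<phi> u + c * \<phi> u'"
      using D(2) u(1) u'(1) *(3,4,5) unfolding convex_on_def by blast
    moreover have "a * (\<phi> u - \<phi> xs) + c * (\<phi> u' - \<phi> xs) < a * t + c * t'"
      using u(2) u'(2) *(3,4,5) by (smt (verit) mult_left_mono mult_strict_left_mono mult_cancel_left1)
    moreover have "a * \<phi> xs + c * \<phi> xs = \<phi> xs" using *(5) by (simp add: distrib_right[symmetric])
    ultimately have 2: "\<phi> (a *\<^sub>R u + c *\<^sub>R u') - \<phi> xs < a * t + c * t'" by (simp add: right_diff_distrib)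
    have "A *v (a *\<^sub>R u + c *\<^sub>R u') - b = a *\<^sub>R (A *v u - b) + c *\<^sub>R (A *v u' - b)"
    proof -
      have "a *\<^sub>R b + c *\<^sub>R b = b" using *(5) by (simp add: scaleR_add_left[symmetric])
      then show ?thesis
        by (simp add: matrix_vector_right_distrib matrix_vector_mult_scaleR scaleR_right_diff_distrib algebra_simps)
    qed
    also have "\<dots> \<le> a *\<^sub>R s + c *\<^sub>R s'"
      using u(3) u'(3) *(3,4) by (auto simp: less_eq_vec_def intro!: add_mono mult_left_mono)
    finally show "a *\<^sub>R p + c *\<^sub>R q \<in> V" unfolding V_def p q using 1 2 by auto
  qed
  have "(0, 0) \<notin> V" using min unfolding V_def by (force simp: less_eq_vec_def)
  then have "0 \<notin> V" by (simp add: zero_prod_def)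
  obtain n where n: "n \<noteq> 0" "\<And>v. v \<in> V \<Longrightarrow> 0 \<le> n \<bullet> v"
    using separating_hyperplane_set_0[OF Vc \<open>0 \<notin> V\<close>] by blast
  obtain \<rho> \<mu> where n_def: "n = (\<rho>, \<mu>)" by (cases n)
  have nV: "0 \<le> \<rho> * t + \<mu> \<bullet> s" if "u \<in> D" "\<phi> u - \<phi> xs < t" "A *v u - b \<le> s" for u t s
    using n(2)[of "(t, s)"] that unfolding V_def n_def by (auto simp: inner_prod_def)
  (* Both coordinates of V are unbounded above, so the normal vector has no negative component; t is so
     large that its term outweighs the fixed remainder K. *)
  have rho0: "0 \<le> \<rho>"
  proof (rule ccontr)
    assume neg: "\<not> 0 \<le> \<rho>"
    define K where "K = \<mu> \<bullet> (A *v xs - b)"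
    define t where "t = 1 + \<bar>K\<bar> / (- \<rho>)"
    have t: "0 < t" using neg by (simp add: t_def add_pos_nonneg divide_nonneg_neg)
    have "0 \<le> \<rho> * t + K" using nV[OF xs(1), of t "A *v xs - b"] t by (simp add: K_def)
    moreover have "\<rho> * t = \<rho> - \<bar>K\<bar>" using neg by (simp add: t_def field_simps)
    ultimately show False using neg by simp
  qed
  have mu0: "0 \<le> \<mu> $ r" for r
  proof (rule ccontr)
    assume neg: "\<not> 0 \<le> \<mu> $ r"
    define K where "K = \<rho> + \<mu> \<bullet> (A *v xs - b)"
    define t where "t = 1 + \<bar>K\<bar> / (- \<mu> $ r)"
    have t: "0 < t" using neg by (simp add: t_def add_pos_nonneg divide_nonneg_neg)
    have "A *v xs - b \<le> A *v xs - b + t *\<^sub>R axis r 1"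
      using t by (auto simp: less_eq_vec_def axis_def)
    then have "0 \<le> K + \<mu> \<bullet> (t *\<^sub>R axis r 1)"
      using nV[OF xs(1), of 1 "A *v xs - b + t *\<^sub>R axis r 1"] by (simp add: K_def inner_add_right)
    then have "0 \<le> K + t * \<mu> $ r" by (simp add: inner_axis)
    moreover have "t * \<mu> $ r = \<mu> $ r - \<bar>K\<bar>" using neg by (simp add: t_def field_simps)
    ultimately show False using neg by simp
  qed
  have rho: "0 < \<rho>"
  proof (rule ccontr)
    assume "\<not> 0 < \<rho>"
    then have r0: "\<rho> = 0" using rho0 by simp
    have le: "0 \<le> \<mu> \<bullet> (A *v y0 - b)"
      using nV[OF slater(1), of "\<phi> y0 - \<phi> xs + 1" "A *v y0 - b"] r0 by simp
    have "\<mu> $ r = 0" for r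
    proof (rule ccontr)
      assume "\<mu> $ r \<noteq> 0"
      then have "0 < \<mu> $ r" using mu0[of r] by simp
      have "\<mu> \<bullet> (A *v y0 - b) < (\<Sum>r\<in>(UNIV::'m set). 0)"
        unfolding inner_vec_def
      proof (rule sum_strict_mono_ex1)
        show "\<forall>x\<in>UNIV. \<mu> $ x \<bullet> (A *v y0 - b) $ x \<le> 0"
          using mu0 slater(2) by (auto intro!: mult_nonneg_nonpos simp: less_imp_le)
        show "\<exists>a\<in>UNIV. \<mu> $ a \<bullet> (A *v y0 - b) $ a < 0"
          using \<open>0 < \<mu> $ r\<close> slater(2)[of r] by (intro bexI[of _ r]) (auto intro!: mult_pos_neg)
      qed simp
      then show False using le by simp
    qed
    then have "\<mu> = 0" by (simp add: vec_eq_iff)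
    then show False using n(1) r0 n_def by (simp add: zero_prod_def)
  qed
  have main: "\<phi> xs \<le> \<phi> u + (\<mu> /\<^sub>R \<rho>) \<bullet> (A *v u - b)" if "u \<in> D" for u
  proof -
    have "0 \<le> \<rho> * (\<phi> u - \<phi> xs) + \<mu> \<bullet> (A *v u - b)"
    proof (rule field_le_epsilon)
      fix e :: real assume "0 < e"
      then show "0 \<le> \<rho> * (\<phi> u - \<phi> xs) + \<mu> \<bullet> (A *v u - b) + e"
        using nV[OF that, of "\<phi> u - \<phi> xs + e / \<rho>" "A *v u - b"] rho by (simp add: algebra_simps)
    qed
    then show ?thesis using rho by (simp add: field_simps)
  qed
  have "(\<mu> /\<^sub>R \<rho>) \<bullet> (A *v xs - b) \<le> 0"
    using xs(2) mu0 rho unfolding inner_vec_def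
    by (intro sum_nonpos) (auto simp: less_eq_vec_def intro!: mult_nonneg_nonpos divide_nonneg_pos)
  then have "(\<mu> /\<^sub>R \<rho>) \<bullet> (A *v xs - b) = 0" using main[OF xs(1)] by simp
  moreover have "0 \<le> \<mu> /\<^sub>R \<rho>" using mu0 rho by (simp add: less_eq_vec_def)
  ultimately show ?thesis using main by blast
qed

section \<open>The Laplacian of a connected graph\<close>

definition graph_laplacian :: "real ^ 'i ^ 'i \<Rightarrow> 'v::real_vector ^ 'i \<Rightarrow> 'v ^ 'i::finite" where
  "graph_laplacian W v = (\<chi> i. \<Sum>j\<in>UNIV. W $ i $ j *\<^sub>R (v $ i - v $ j))"

lemma linear_graph_laplacian: "linear (graph_laplacian W)"
  by (rule linearI)
     (auto simp: graph_laplacian_def vec_eq_iff sum.distrib[symmetric] scaleR_sum_right algebra_simps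
           intro!: sum.cong)

context
  fixes W :: "real ^ 'i ^ 'i::finite"
  assumes graph: "weighted_connected_graph W"
begin

lemma W_sym: "W $ i $ j = W $ j $ i"
  using graph unfolding weighted_connected_graph_def by (metis transpose_def vec_lambda_beta)

lemma W_nonneg: "0 \<le> W $ i $ j"
  using graph unfolding weighted_connected_graph_def by blast

text \<open>
  Summation by parts: the form is a sum over edges, which exhibits symmetry, positivity and the kernel
  of the Laplacian at once.
\<close>

lemma inner_graph_laplacian:
  fixes u v :: "'v::real_inner ^ 'i"
  shows "2 * (graph_laplacian W u \<bullet> v) = (\<Sum>i\<in>UNIV. \<Sum>j\<in>UNIV. W $ i $ j * ((u $ i - u $ j) \<bullet> (v $ i - v $ j)))"
proof -
  have 1: "graph_laplacian W u \<bullet> v = (\<Sum>i\<in>UNIV. \<Sum>j\<in>UNIV. W $ i $ j * ((u $ i - u $ j) \<bullet> v $ i))"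
    by (simp add: inner_vec_def graph_laplacian_def inner_sum_left)
  also have "\<dots> = (\<Sum>i\<in>UNIV. \<Sum>j\<in>UNIV. W $ j $ i * ((u $ j - u $ i) \<bullet> v $ j))"
    by (rule sum.swap)
  also have "\<dots> = (\<Sum>i\<in>UNIV. \<Sum>j\<in>UNIV. - (W $ i $ j * ((u $ i - u $ j) \<bullet> v $ j)))"
    by (intro sum.cong refl) (simp add: W_sym[of _ i for i] inner_diff_left algebra_simps)
  finally have 2: "graph_laplacian W u \<bullet> v = (\<Sum>i\<in>UNIV. \<Sum>j\<in>UNIV. - (W $ i $ j * ((u $ i - u $ j) \<bullet> v $ j)))" .
  have "2 * (graph_laplacian W u \<bullet> v) = graph_laplacian W u \<bullet> v + graph_laplacian W u \<bullet> v" by simp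
  also have "\<dots> = (\<Sum>i\<in>UNIV. \<Sum>j\<in>UNIV. W $ i $ j * ((u $ i - u $ j) \<bullet> v $ i) - W $ i $ j * ((u $ i - u $ j) \<bullet> v $ j))"
    by (subst 2, subst 1) (simp add: sum.distrib[symmetric] del: sum.distrib)
  finally show ?thesis by (simp add: inner_diff_right right_diff_distrib)
qed

lemma graph_laplacian_self_adjoint:
  fixes u v :: "'v::real_inner ^ 'i"
  shows "graph_laplacian W u \<bullet> v = u \<bullet> graph_laplacian W v"
  using inner_graph_laplacian[of u v] inner_graph_laplacian[of v u] by (simp add: inner_commute)

text \<open>
  Apply the Cauchy-Schwarz inequality with weights \<open>w\<^sub>i\<^sub>j\<close> in each row, and recognize the quadratic form
  in the sum of the rows. The constant is the bound \<open>2 d\<^sup>*\<close> on the largest eigenvalue.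
\<close>

lemma graph_laplacian_cocoercive:
  fixes v :: "'v::real_inner ^ 'i"
  shows "(norm (graph_laplacian W v))\<^sup>2 \<le> 2 * max_wdegree W * (graph_laplacian W v \<bullet> v)"
proof -
  have deg: "wdegree W i \<le> max_wdegree W" for i unfolding max_wdegree_def by simp
  have row: "(norm (graph_laplacian W v $ i))\<^sup>2 \<le> max_wdegree W * (\<Sum>j\<in>UNIV. W $ i $ j * (norm (v $ i - v $ j))\<^sup>2)" for i
  proof -
    have "norm (graph_laplacian W v $ i) \<le> (\<Sum>j\<in>UNIV. sqrt (W $ i $ j) * (sqrt (W $ i $ j) * norm (v $ i - v $ j)))"
      unfolding graph_laplacian_def vec_lambda_beta
      by (rule sum_norm_le) (simp add: W_nonneg mult.assoc[symmetric])
    then have "(norm (graph_laplacian W v $ i))\<^sup>2 \<le> (\<Sum>j\<in>UNIV. sqrt (W $ i $ j) * (sqrt (W $ i $ j) * norm (v $ i - v $ j)))\<^sup>2"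
      by (simp add: power_mono)
    also have "\<dots> \<le> (\<Sum>j\<in>UNIV. (sqrt (W $ i $ j))\<^sup>2) * (\<Sum>j\<in>UNIV. (sqrt (W $ i $ j) * norm (v $ i - v $ j))\<^sup>2)"
      by (rule Cauchy_Schwarz_ineq_sum)
    also have "\<dots> = wdegree W i * (\<Sum>j\<in>UNIV. W $ i $ j * (norm (v $ i - v $ j))\<^sup>2)"
      by (simp add: wdegree_def W_nonneg power_mult_distrib)
    also have "\<dots> \<le> max_wdegree W * (\<Sum>j\<in>UNIV. W $ i $ j * (norm (v $ i - v $ j))\<^sup>2)"
      by (intro mult_right_mono deg sum_nonneg) (simp add: W_nonneg)
    finally show ?thesis .
  qed
  have "(norm (graph_laplacian W v))\<^sup>2 = (\<Sum>i\<in>UNIV. (norm (graph_laplacian W v $ i))\<^sup>2)"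
    by (simp add: power2_norm_eq_inner inner_vec_def)
  also have "\<dots> \<le> (\<Sum>i\<in>UNIV. max_wdegree W * (\<Sum>j\<in>UNIV. W $ i $ j * (norm (v $ i - v $ j))\<^sup>2))"
    by (intro sum_mono row)
  also have "\<dots> = max_wdegree W * (2 * (graph_laplacian W v \<bullet> v))"
    by (subst inner_graph_laplacian) (simp add: sum_distrib_left power2_norm_eq_inner)
  finally show ?thesis by simp
qed

text \<open>
  The quadratic form vanishes, hence so does each edge term; connectedness carries the equality from
  edge to edge.
\<close>

lemma graph_laplacian_kernel:
  fixes v :: "'v::real_inner ^ 'i"
  assumes "graph_laplacian W v = 0"
  shows "v $ i = v $ j"
proof -
  have edge: "v $ k = v $ l" if "0 < W $ k $ l" for k l
  proof -
    have nn: "0 \<le> W $ i $ j * ((v $ i - v $ j) \<bullet> (v $ i - v $ j))" for i j by (simp add: W_nonneg)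
    have "(\<Sum>i\<in>UNIV. \<Sum>j\<in>UNIV. W $ i $ j * ((v $ i - v $ j) \<bullet> (v $ i - v $ j))) = 0"
      using inner_graph_laplacian[of v v] assms by simp
    then have "(\<Sum>j\<in>UNIV. W $ k $ j * ((v $ k - v $ j) \<bullet> (v $ k - v $ j))) = 0"
      by (subst (asm) sum_nonneg_eq_0_iff) (auto intro!: sum_nonneg nn)
    then have "W $ k $ l * ((v $ k - v $ l) \<bullet> (v $ k - v $ l)) = 0"
      by (subst (asm) sum_nonneg_eq_0_iff) (auto intro!: nn)
    then show ?thesis using that by simp
  qed
  have "(i, j) \<in> {(k, l). W $ k $ l > 0}\<^sup>*"
    using graph unfolding weighted_connected_graph_def by blast
  then show ?thesis by (induction rule: rtrancl_induct) (auto dest: edge)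
qed

text \<open>
  For a self-adjoint map the range is the orthogonal complement of the kernel, and the kernel consists
  of the constant vectors. This supplies the auxiliary variable \<open>z\<close> of an equilibrium.
\<close>

lemma graph_laplacian_range:
  fixes y :: "'v::euclidean_space ^ 'i"
  assumes "(\<Sum>i\<in>UNIV. y $ i) = 0"
  shows "\<exists>v. graph_laplacian W v = y"
proof -
  have sub: "subspace (range (graph_laplacian W :: 'v ^ 'i \<Rightarrow> _))"
    by (rule linear_subspace_image[OF linear_graph_laplacian subspace_UNIV])
  obtain p q where pq: "p \<in> span (range (graph_laplacian W :: 'v ^ 'i \<Rightarrow> _))"
      "\<And>w. w \<in> span (range (graph_laplacian W)) \<Longrightarrow> orthogonal q w" "y = p + q"
    using orthogonal_subspace_decomp_exists[of "range (graph_laplacian W :: 'v ^ 'i \<Rightarrow> _)" y] by metis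
  have sp: "span (range (graph_laplacian W :: 'v ^ 'i \<Rightarrow> _)) = range (graph_laplacian W)"
    using sub by (simp add: span_eq_iff)
  obtain v where v: "p = graph_laplacian W v" using pq(1) sp by blast
  have "q \<bullet> graph_laplacian W (graph_laplacian W q) = 0"
    using pq(2)[of "graph_laplacian W (graph_laplacian W q)"] sp unfolding orthogonal_def by blast
  then have "graph_laplacian W q = 0" 
    by (simp only: graph_laplacian_self_adjoint[symmetric, of q] inner_eq_zero_iff)
  then have const: "q $ i = q $ j" for i j by (rule graph_laplacian_kernel)
  have "(\<Sum>i\<in>UNIV. graph_laplacian W v $ i) = 0"
  proof (rule euclidean_eqI)
    fix b :: 'v assume "b \<in> Basis"
    define c where "c = (\<chi> i::'i. b)"
    have "graph_laplacian W v \<bullet> c = v \<bullet> graph_laplacian W c" by (rule graph_laplacian_self_adjoint)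
    also have "graph_laplacian W c = 0" by (simp add: graph_laplacian_def c_def vec_eq_iff)
    finally show "(\<Sum>i\<in>UNIV. graph_laplacian W v $ i) \<bullet> b = 0 \<bullet> b"
      by (simp add: inner_vec_def c_def inner_sum_left)
  qed
  then have "(\<Sum>i\<in>UNIV. q $ i) = 0" using assms pq(3) v by (simp add: sum.distrib)
  moreover have "(\<Sum>i\<in>UNIV. q $ i) = real CARD('i) *\<^sub>R q $ j" for j
  proof -
    have "(\<Sum>i\<in>UNIV. q $ i) = (\<Sum>i\<in>(UNIV::'i set). q $ j)" by (intro sum.cong refl const)
    then show ?thesis by (simp add: sum_constant_scaleR)
  qed
  ultimately have "q $ j = 0" for j by simp
  then show ?thesis using pq(3) v by (intro exI[of _ v]) (simp add: vec_eq_iff)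
qed

end

section \<open>Positive definiteness of the preconditioner\<close>

text \<open>
  Gershgorin's bound for the least eigenvalue. Each off-diagonal term is bounded by
  \<open>2 \<bar>v\<^sub>r v\<^sub>c\<bar> \<le> v\<^sub>r\<^sup>2 + v\<^sub>c\<^sup>2\<close>, and by symmetry the two halves are the same.
\<close>

lemma symmetric_diagonally_dominant_quadratic_form:
  fixes P :: "real ^ 'k ^ 'k"
  assumes sym: "\<And>r c. P $ r $ c = P $ c $ r"
    and dom: "\<And>r. \<gamma> + (\<Sum>c\<in>UNIV. if c = r then 0 else \<bar>P $ r $ c\<bar>) \<le> P $ r $ r"
  shows "\<gamma> * (norm v)\<^sup>2 \<le> (P *v v) \<bullet> v"
proof -
  define R where "R r c = (if c = r then 0 else \<bar>P $ r $ c\<bar>)" for r c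
  have R_sym: "R r c = R c r" for r c using sym by (auto simp: R_def)
  have R0: "0 \<le> R r c" for r c by (simp add: R_def)
  have entry: "(if c = r then P $ r $ r * (v $ r)\<^sup>2 else 0) - R r c * ((v $ r)\<^sup>2 + (v $ c)\<^sup>2) / 2 \<le> P $ r $ c * v $ c * v $ r" for r c
  proof (cases "c = r")
    case True then show ?thesis by (simp add: R_def power2_eq_square)
  next
    case False
    have "0 \<le> (\<bar>v $ r\<bar> - \<bar>v $ c\<bar>)\<^sup>2" by simp
    also have "\<dots> = (v $ r)\<^sup>2 + (v $ c)\<^sup>2 - 2 * \<bar>v $ c * v $ r\<bar>" by (simp add: power2_diff abs_mult)
    finally have "R r c * (2 * \<bar>v $ c * v $ r\<bar>) \<le> R r c * ((v $ r)\<^sup>2 + (v $ c)\<^sup>2)"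
      by (intro mult_left_mono R0) simp
    moreover have "\<bar>P $ r $ c * v $ c * v $ r\<bar> = R r c * \<bar>v $ c * v $ r\<bar>"
      using False by (simp add: R_def abs_mult)
    ultimately show ?thesis using False by (simp add: abs_le_iff)
  qed
  have swap: "(\<Sum>r\<in>UNIV. \<Sum>c\<in>UNIV. R r c * (v $ c)\<^sup>2) = (\<Sum>r\<in>UNIV. \<Sum>c\<in>UNIV. R r c * (v $ r)\<^sup>2)"
    by (subst sum.swap) (simp add: R_sym)
  have "\<gamma> * (norm v)\<^sup>2 = (\<Sum>r\<in>UNIV. \<gamma> * (v $ r)\<^sup>2)"
    unfolding power2_norm_eq_inner inner_vec_def by (simp add: sum_distrib_left power2_eq_square)
  also have "\<dots> \<le> (\<Sum>r\<in>UNIV. (P $ r $ r - (\<Sum>c\<in>UNIV. R r c)) * (v $ r)\<^sup>2)"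
    using dom by (intro sum_mono mult_right_mono) (auto simp: R_def le_diff_eq)
  also have "\<dots> = (\<Sum>r\<in>UNIV. P $ r $ r * (v $ r)\<^sup>2) - (\<Sum>r\<in>UNIV. \<Sum>c\<in>UNIV. R r c * (v $ r)\<^sup>2)"
    by (simp add: left_diff_distrib sum_subtractf sum_distrib_right)
  also have "\<dots> = (\<Sum>r\<in>UNIV. \<Sum>c\<in>UNIV. (if c = r then P $ r $ r * (v $ r)\<^sup>2 else 0) - R r c * ((v $ r)\<^sup>2 + (v $ c)\<^sup>2) / 2)"
    using swap by (simp add: sum_subtractf sum_divide_distrib[symmetric] distrib_left sum.distrib)
  also have "\<dots> \<le> (\<Sum>r\<in>UNIV. \<Sum>c\<in>UNIV. P $ r $ c * v $ c * v $ r)"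
    by (intro sum_mono entry)
  also have "\<dots> = (P *v v) \<bullet> v"
    by (simp add: inner_vec_def matrix_vector_mult_def sum_distrib_right)
  finally show ?thesis .
qed

text \<open>
  This is the bound of the least eigenvalue of \<open>P\<close> by the inverse of the largest eigenvalue of \<open>P\<^sup>-\<^sup>1\<close>,
  proved without a spectral decomposition by the Cauchy-Schwarz inequality for the form of \<open>P\<close>, applied
  to \<open>v\<close> and \<open>P\<^sup>-\<^sup>1 v\<close>.
\<close>

lemma norm_le_matrix_inv_quadratic_form:
  fixes P :: "real ^ 'k ^ 'k"
  assumes sym: "\<And>u v. (P *v u) \<bullet> v = u \<bullet> (P *v v)"
    and pos: "0 < \<gamma>" "\<And>v. \<gamma> * (norm v)\<^sup>2 \<le> (P *v v) \<bullet> v"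
  shows "(norm v)\<^sup>2 \<le> matrix_norm (matrix_inv P) * ((P *v v) \<bullet> v)" and "0 < matrix_norm (matrix_inv P)"
proof -
  have inj: "v = 0" if "P *v v = 0" for v
  proof -
    have "\<gamma> * (norm v)\<^sup>2 \<le> 0" using pos(2)[of v] that by simp
    then show ?thesis using pos(1) by (simp add: mult_le_0_iff)
  qed
  then have "\<exists>Q. Q ** P = mat 1" by (simp add: matrix_left_invertible_ker)
  then have "invertible P" using invertible_left_inverse by blast
  then have PQ: "P ** matrix_inv P = mat 1" unfolding invertible_def matrix_inv_def by (rule someI2_ex) blast
  let ?Q = "matrix_inv P"
  have P_Q: "P *v (?Q *v v) = v" for v by (simp add: matrix_vector_mul_assoc PQ)
  have bl: "bounded_linear (\<lambda>v. ?Q *v v)" by (rule matrix_vector_mul_bounded_linear)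
  have Qle: "norm (?Q *v v) \<le> matrix_norm ?Q * norm v" for v
    unfolding matrix_norm_def by (rule onorm[OF bl])
  have nn: "0 \<le> (P *v v) \<bullet> v" for v
    using pos(2)[of v] pos(1) by (meson less_imp_le mult_nonneg_nonneg order_trans zero_le_power2)
  have main: "(norm v)\<^sup>2 \<le> matrix_norm ?Q * ((P *v v) \<bullet> v)" for v
  proof (cases "v = 0")
    case False
    define w where "w = ?Q *v v"
    define N where "N = matrix_norm ?Q"
    define q where "q = (P *v v) \<bullet> v"
    define s where "s = norm v"
    have s: "0 < s" using False by (simp add: s_def)
    have Pw: "P *v w = v" by (simp add: w_def P_Q)
    have ww: "(P *v w) \<bullet> w \<le> N * s\<^sup>2"
    proof -
      have "v \<bullet> w \<le> norm v * norm w" by (rule norm_cauchy_schwarz)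
      also have "\<dots> \<le> norm v * (N * norm v)" unfolding N_def w_def by (intro mult_left_mono Qle) simp
      finally show ?thesis by (simp add: Pw s_def power2_eq_square mult_ac)
    qed
    have cross: "(P *v v) \<bullet> w = s\<^sup>2" using sym[of v w] Pw by (simp add: s_def power2_norm_eq_inner)
    (* Expand the form at w - t v; the discriminant is read off by choosing t = s^2 / q below. *)
    have quad: "0 \<le> N * s\<^sup>2 - 2 * t * s\<^sup>2 + t\<^sup>2 * q" for t
    proof -
      have "0 \<le> (P *v (w - t *\<^sub>R v)) \<bullet> (w - t *\<^sub>R v)" by (rule nn)
      also have "\<dots> = (P *v w) \<bullet> w - 2 * t * ((P *v v) \<bullet> w) + t\<^sup>2 * q"
        using sym[of w v] by (simp add: q_def matrix_vector_mult_diff_distrib matrix_vector_mult_scaleR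
            inner_diff_left inner_diff_right power2_eq_square inner_commute algebra_simps)
      finally show ?thesis using ww by (simp add: cross)
    qed
    have q: "0 < q"
    proof -
      have "0 < \<gamma> * s\<^sup>2" using pos(1) s by simp
      then show ?thesis using pos(2)[of v] by (simp add: q_def s_def)
    qed
    have "0 \<le> N * s\<^sup>2 - 2 * (s\<^sup>2 / q) * s\<^sup>2 + (s\<^sup>2 / q)\<^sup>2 * q" by (rule quad)
    then have "s\<^sup>2 * s\<^sup>2 / q \<le> N * s\<^sup>2" using q by (simp add: power2_eq_square)
    then have "s\<^sup>2 * s\<^sup>2 \<le> (N * q) * s\<^sup>2" using q by (simp add: field_simps)
    then have "s\<^sup>2 \<le> N * q" by (rule mult_right_le_imp_le) (use s in simp)
    then show ?thesis by (simp add: s_def N_def q_def)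
  qed simp
  show "(norm v)\<^sup>2 \<le> matrix_norm ?Q * ((P *v v) \<bullet> v)" by (rule main)
  show "0 < matrix_norm ?Q"
  proof -
    let ?e = "axis undefined 1 :: real ^ 'k"
    have "1 \<le> matrix_norm ?Q * ((P *v ?e) \<bullet> ?e)" using main[of ?e] by (simp add: norm_axis_1)
    then show ?thesis using nn[of ?e] by (smt (verit) mult_nonpos_nonneg)
  qed
qed

type_synonym ('n, 'm, 'i) state = "(real ^ 'n) \<times> (real ^ 'm ^ 'i) \<times> (real ^ 'm ^ 'i)"

text \<open>
  The isometry between triples, on which the algorithm is most easily described, and the vectors on
  which the preconditioning matrix acts.
\<close>

definition stack :: "('n::finite, 'm::finite, 'i::finite) state \<Rightarrow> real ^ ('n + 'i \<times> 'm + 'i \<times> 'm)" where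
  "stack w = (\<chi> r. case r of Inl j \<Rightarrow> fst w $ j | Inr (Inl q) \<Rightarrow> fst (snd w) $ fst q $ snd q
     | Inr (Inr q) \<Rightarrow> snd (snd w) $ fst q $ snd q)"

text \<open>
  The block diagonal constraint matrix \<open>\<^bold>A\<close>; \<open>multiplier_map\<close> is its transpose.
\<close>

definition constraint_map :: "('n::finite \<Rightarrow> 'i) \<Rightarrow> real ^ 'n ^ 'm \<Rightarrow> real ^ 'n \<Rightarrow> real ^ 'm ^ 'i::finite" where
  "constraint_map own A x = (\<chi> i. block_columns own A i *v x)"

definition multiplier_map :: "('n::finite \<Rightarrow> 'i) \<Rightarrow> real ^ 'n ^ 'm \<Rightarrow> real ^ 'm ^ 'i::finite \<Rightarrow> real ^ 'n" where
  "multiplier_map own A l = (\<chi> j. \<Sum>r\<in>UNIV. A $ r $ j * l $ own j $ r)"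

text \<open>
  The preconditioner as an operator on triples (see \<open>preconditioner_stack\<close>).
\<close>

definition metric_operator ::
    "('n::finite \<Rightarrow> 'i::finite) \<Rightarrow> real ^ 'n ^ 'm \<Rightarrow> real ^ 'i ^ 'i \<Rightarrow> ('i \<Rightarrow> real) \<Rightarrow> ('i \<Rightarrow> real) \<Rightarrow> ('i \<Rightarrow> real) \<Rightarrow>
     ('n, 'm::finite, 'i) state \<Rightarrow> ('n, 'm, 'i) state" where
  "metric_operator own A W \<alpha> \<nu> \<sigma> = (\<lambda>(x, z, l).
     ((\<chi> j. x $ j / \<alpha> (own j)) - multiplier_map own A l,
      (\<chi> i. z $ i /\<^sub>R \<nu> i) - graph_laplacian W l,
      (\<chi> i. l $ i /\<^sub>R \<sigma> i) - constraint_map own A x - graph_laplacian W z))"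

lemma sum_UNIV_Plus:
  fixes h :: "'a::finite + 'b::finite \<Rightarrow> 'c::comm_monoid_add"
  shows "(\<Sum>r\<in>UNIV. h r) = (\<Sum>a\<in>UNIV. h (Inl a)) + (\<Sum>b\<in>UNIV. h (Inr b))"
  by (simp add: UNIV_Plus_UNIV[symmetric] sum.Plus del: UNIV_Plus_UNIV)

lemma sum_UNIV_Times:
  fixes h :: "'a::finite \<times> 'b::finite \<Rightarrow> 'c::comm_monoid_add"
  shows "(\<Sum>r\<in>UNIV. h r) = (\<Sum>a\<in>UNIV. \<Sum>b\<in>UNIV. h (a, b))"
  by (simp add: sum.cartesian_product)

lemma sum_delta_mult:
  fixes c v :: "'k::finite \<Rightarrow> real"
  shows "(\<Sum>k\<in>UNIV. (if i = k then c k else 0) * v k) = c i * v i"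
    and "(\<Sum>k\<in>UNIV. (if k = i then c k else 0) * v k) = c i * v i"
proof -
  have "(if i = k then c k else 0) * v k = (if i = k then c k * v k else 0)"
      "(if k = i then c k else 0) * v k = (if k = i then c k * v k else 0)" for k by auto
  then show "(\<Sum>k\<in>UNIV. (if i = k then c k else 0) * v k) = c i * v i"
    "(\<Sum>k\<in>UNIV. (if k = i then c k else 0) * v k) = c i * v i" by simp_all
qed

lemma inner_stack: "stack u \<bullet> stack v = u \<bullet> v"
  by (simp add: stack_def inner_prod_def inner_vec_def sum_UNIV_Plus sum_UNIV_Times)

lemma constraint_map_nth:
  "constraint_map own A x $ i $ r = (\<Sum>j | own j = i. A $ r $ j * x $ j)"
  by (simp add: constraint_map_def block_columns_def matrix_vector_mult_def if_distrib if_distribR sum.If_cases cong: if_cong)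

lemma linear_constraint_map: "linear (constraint_map own A)"
  by (rule linearI) (simp_all add: constraint_map_def vec_eq_iff matrix_vector_right_distrib matrix_vector_mult_scaleR)

lemma linear_multiplier_map: "linear (multiplier_map own A)"
  by (rule linearI) (simp_all add: multiplier_map_def vec_eq_iff sum.distrib distrib_left sum_distrib_left mult.left_commute)

lemma multiplier_map_adjoint: "multiplier_map own A l \<bullet> x = l \<bullet> constraint_map own A x"
proof -
  have "multiplier_map own A l \<bullet> x = (\<Sum>j\<in>UNIV. \<Sum>r\<in>UNIV. A $ r $ j * l $ own j $ r * x $ j)"
    by (simp add: inner_vec_def multiplier_map_def sum_distrib_right)
  also have "\<dots> = (\<Sum>i\<in>UNIV. \<Sum>j | own j = i. \<Sum>r\<in>UNIV. A $ r $ j * l $ own j $ r * x $ j)"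
    using sum.group[of UNIV UNIV own "\<lambda>j. \<Sum>r\<in>UNIV. A $ r $ j * l $ own j $ r * x $ j"] by simp
  also have "\<dots> = (\<Sum>i\<in>UNIV. \<Sum>r\<in>UNIV. \<Sum>j | own j = i. A $ r $ j * l $ own j $ r * x $ j)"
    by (intro sum.cong refl sum.swap)
  also have "\<dots> = l \<bullet> constraint_map own A x"
    by (simp add: inner_vec_def constraint_map_nth sum_distrib_left mult_ac)
  finally show ?thesis .
qed

lemma block_diagonal_nth: "block_diagonal own A $ q $ j = (if own j = fst q then A $ snd q $ j else 0)"
  by (simp add: block_diagonal_def block_columns_def)

lemma graph_laplacian_nth:
  fixes v :: "real ^ 'm ^ 'i"
  shows "graph_laplacian W v $ i $ r = (\<Sum>k\<in>UNIV. laplacian W $ i $ k * v $ k $ r)"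
proof -
  have "(\<Sum>k\<in>UNIV. laplacian W $ i $ k * v $ k $ r) = wdegree W i * v $ i $ r - (\<Sum>k\<in>UNIV. W $ i $ k * v $ k $ r)"
    by (simp add: laplacian_def left_diff_distrib sum_subtractf sum_delta_mult(1))
  then show ?thesis
    by (simp add: graph_laplacian_def wdegree_def right_diff_distrib sum_subtractf sum_distrib_right)
qed

lemma preconditioner_stack:
  fixes w :: "('n::finite, 'm::finite, 'i::finite) state"
  shows "preconditioner own A W \<alpha> \<nu> \<sigma> *v stack w = stack (metric_operator own A W \<alpha> \<nu> \<sigma> w)"
proof -
  obtain x z l where w: "w = (x, z, l)" by (cases w)
  have kron: "(\<Sum>a\<in>UNIV. \<Sum>b\<in>UNIV. laplacian W $ i $ a * mat 1 $ s $ b * v $ a $ b) = graph_laplacian W v $ i $ s"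
    for i s and v :: "real ^ 'm ^ 'i"
    by (simp add: graph_laplacian_nth mat_def mult.assoc sum_distrib_left[symmetric] sum_delta_mult(1))
  have diag: "(\<Sum>a\<in>UNIV. \<Sum>b\<in>UNIV. (if i = a \<and> s = b then c a else 0) * v $ a $ b) = c i * v $ i $ s"
    for i s c and v :: "real ^ 'm ^ 'i"
  proof -
    have "(if i = a \<and> s = b then c a else 0) = (if i = a then if s = b then c a else 0 else 0)" for a b by simp
    then show ?thesis by (subst sum.swap) (simp add: sum_delta_mult(1))
  qed
  have "(preconditioner own A W \<alpha> \<nu> \<sigma> *v stack w) $ r = stack (metric_operator own A W \<alpha> \<nu> \<sigma> w) $ r" for r
  proof -
    consider (p) j where "r = Inl j" | (z) i s where "r = Inr (Inl (i, s))" | (l) i s where "r = Inr (Inr (i, s))"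
      by (metis old.sum.exhaust surj_pair)
    then show ?thesis
    proof cases
      case p
      have "(\<Sum>a\<in>UNIV. \<Sum>b\<in>UNIV. (if own j = a then A $ b $ j else 0) * l $ a $ b) = (\<Sum>b\<in>UNIV. A $ b $ j * l $ own j $ b)"
        by (subst sum.swap) (simp add: sum_delta_mult(1))
      then show ?thesis
        by (simp add: p w matrix_vector_mult_def preconditioner_def stack_def metric_operator_def sum_UNIV_Plus
            sum_UNIV_Times block_diagonal_nth transpose_def multiplier_map_def sum_negf divide_inverse
            mult.commute[of "inverse _"] sum_delta_mult(1) cong: if_cong)
    next
      case z
      show ?thesis
        by (simp add: z w matrix_vector_mult_def preconditioner_def stack_def metric_operator_def sum_UNIV_Plus
            sum_UNIV_Times stacked_laplacian_def sum_negf kron diag)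
    next
      case l
      have "(\<Sum>j\<in>UNIV. (if own j = i then A $ s $ j else 0) * x $ j) = constraint_map own A x $ i $ s"
        unfolding constraint_map_nth sum.inter_filter[OF finite[of UNIV], simplified] by (intro sum.cong) auto
      then show ?thesis
        by (simp add: l w matrix_vector_mult_def preconditioner_def stack_def metric_operator_def sum_UNIV_Plus
            sum_UNIV_Times stacked_laplacian_def sum_negf block_diagonal_nth kron diag cong: if_cong)
    qed

  qed
  then show ?thesis by (simp add: vec_eq_iff)
qed

lemma inner_metric_operator:
  "metric_operator own A W \<alpha> \<nu> \<sigma> u \<bullet> v = (preconditioner own A W \<alpha> \<nu> \<sigma> *v stack u) \<bullet> stack v"
  by (simp add: preconditioner_stack inner_stack)

context
  fixes own :: "'n::finite \<Rightarrow> 'i::finite" and A :: "real ^ 'n ^ 'm::finite" and W :: "real ^ 'i ^ 'i"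
    and \<alpha> \<nu> \<sigma> :: "'i \<Rightarrow> real" and \<gamma> :: real
  assumes graph: "weighted_connected_graph W" and own: "surj own"
    and gamma: "0 < \<gamma>"
    and alpha: "\<And>i. 0 < \<alpha> i \<and>
          \<alpha> i \<le> inverse (\<gamma> + (MAX j\<in>{j. own j = i}. \<Sum>r\<in>UNIV. \<bar>transpose (block_columns own A i) $ j $ r\<bar>))"
    and nu: "\<And>i. 0 < \<nu> i \<and> \<nu> i \<le> inverse (\<gamma> + 2 * wdegree W i)"
    and sigma: "\<And>i. 0 < \<sigma> i \<and>
          \<sigma> i \<le> inverse (\<gamma> + 2 * wdegree W i
            + (MAX r\<in>UNIV. \<Sum>j | own j = i. \<bar>block_columns own A i $ r $ j\<bar>))"
begin

lemma laplacian_row_sum: "(\<Sum>k\<in>UNIV. \<bar>laplacian W $ i $ k\<bar>) \<le> 2 * wdegree W i"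
proof -
  have d: "0 \<le> wdegree W i" unfolding wdegree_def by (intro sum_nonneg W_nonneg[OF graph])
  have "\<bar>laplacian W $ i $ k\<bar> \<le> (if i = k then wdegree W i else 0) + W $ i $ k" for k
    using d W_nonneg[OF graph, of i k] by (auto simp: laplacian_def)
  then have "(\<Sum>k\<in>UNIV. \<bar>laplacian W $ i $ k\<bar>) \<le> (\<Sum>k\<in>UNIV. (if i = k then wdegree W i else 0) + W $ i $ k)"
    by (rule sum_mono)
  also have "\<dots> = 2 * wdegree W i" by (simp add: sum.distrib wdegree_def)
  finally show ?thesis .
qed

lemma le_inverse_step: "0 < s \<Longrightarrow> s \<le> inverse (c :: real) \<Longrightarrow> c \<le> inverse s"
  by (metis inverse_inverse_eq inverse_positive_iff_positive le_imp_inverse_le less_le_trans)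

lemma preconditioner_symmetric:
  "preconditioner own A W \<alpha> \<nu> \<sigma> $ r $ c = preconditioner own A W \<alpha> \<nu> \<sigma> $ c $ r"
proof -
  have "laplacian W $ i $ j = laplacian W $ j $ i" for i j
    using W_sym[OF graph, of i j] by (auto simp: laplacian_def)
  then have "stacked_laplacian W $ p $ q = (stacked_laplacian W $ q $ p :: real)" for p q :: "'i \<times> 'm"
    by (auto simp: stacked_laplacian_def mat_def)
  then show ?thesis
    by (auto simp: preconditioner_def transpose_def split: sum.splits)
qed

text \<open>
  Each of the three bounds on the step sizes is the dominance condition for one block of rows: \<open>2 d\<^sub>i\<close>
  bounds the absolute row sums of the Laplacian, and the maxima bound those of \<open>A\<^sub>i\<^sup>\<top>\<close> and \<open>A\<^sub>i\<close>.
\<close>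

lemma preconditioner_diagonally_dominant:
  "\<gamma> + (\<Sum>c\<in>UNIV. if c = r then 0 else \<bar>preconditioner own A W \<alpha> \<nu> \<sigma> $ r $ c\<bar>)
     \<le> preconditioner own A W \<alpha> \<nu> \<sigma> $ r $ r"
proof -
  have kron: "(\<Sum>a\<in>UNIV. \<Sum>b\<in>(UNIV :: 'm set). \<bar>laplacian W $ i $ a * mat 1 $ s $ b\<bar>) \<le> 2 * wdegree W i" for i s
  proof -
    have "(\<Sum>b\<in>(UNIV :: 'm set). \<bar>laplacian W $ i $ a * mat 1 $ s $ b\<bar>) = \<bar>laplacian W $ i $ a\<bar>" for a
    proof -
      have "\<bar>laplacian W $ i $ a * mat 1 $ s $ b\<bar> = (if s = b then \<bar>laplacian W $ i $ a\<bar> else 0)" for b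
        by (simp add: mat_def)
      then show ?thesis by simp
    qed
    then show ?thesis using laplacian_row_sum by simp
  qed
  consider (p) j where "r = Inl j" | (z) i s where "r = Inr (Inl (i, s))" | (l) i s where "r = Inr (Inr (i, s))"
    by (metis old.sum.exhaust surj_pair)
  then show ?thesis
  proof cases
    case p
    have "(\<Sum>a\<in>UNIV. \<Sum>b\<in>UNIV. \<bar>if own j = a then A $ b $ j else 0\<bar>) = (\<Sum>b\<in>UNIV. \<bar>A $ b $ j\<bar>)"
    proof -
      have "\<bar>if own j = a then A $ b $ j else 0\<bar> = (if own j = a then \<bar>A $ b $ j\<bar> else 0)" for a b by simp
      then show ?thesis by (subst sum.swap) simp
    qed
    also have "\<dots> \<le> (MAX j'\<in>{j'. own j' = own j}. \<Sum>r\<in>UNIV. \<bar>transpose (block_columns own A (own j)) $ j' $ r\<bar>)"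
      by (rule Max_ge) (auto simp: transpose_def block_columns_def intro!: image_eqI[of _ _ j])
    finally have "\<gamma> + (\<Sum>a\<in>UNIV. \<Sum>b\<in>UNIV. \<bar>if own j = a then A $ b $ j else 0\<bar>) \<le> inverse (\<alpha> (own j))"
      using le_inverse_step[OF conjunct1[OF alpha] conjunct2[OF alpha], of "own j"] by linarith
    moreover have "(\<Sum>j'\<in>UNIV. if j' = j then 0 else \<bar>if j = j' then inverse (\<alpha> (own j)) else 0\<bar>) = 0"
      by (intro sum.neutral) auto
    ultimately show ?thesis
      by (simp add: p preconditioner_def sum_UNIV_Plus sum_UNIV_Times block_diagonal_nth transpose_def cong: if_cong)
  next
    case z
    have "(\<Sum>a\<in>UNIV. \<Sum>b\<in>UNIV. if (a, b) = (i, s) then 0 else \<bar>if (i, s) = (a, b) then inverse (\<nu> i) else 0\<bar>) = 0"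
      by (intro sum.neutral ballI) auto
    moreover have "\<gamma> + 2 * wdegree W i \<le> inverse (\<nu> i)"
      using le_inverse_step nu by blast
    ultimately show ?thesis using kron[of i s]
      by (simp add: z preconditioner_def sum_UNIV_Plus sum_UNIV_Times stacked_laplacian_def cong: if_cong)
  next
    case l
    have "(\<Sum>a\<in>UNIV. \<Sum>b\<in>UNIV. if (a, b) = (i, s) then 0 else \<bar>if (i, s) = (a, b) then inverse (\<sigma> i) else 0\<bar>) = 0"
      by (intro sum.neutral ballI) auto
    moreover have "(\<Sum>j\<in>UNIV. \<bar>if own j = i then A $ s $ j else 0\<bar>) = (\<Sum>j | own j = i. \<bar>block_columns own A i $ s $ j\<bar>)"
      unfolding sum.inter_filter[OF finite[of UNIV], simplified] by (intro sum.cong) (auto simp: block_columns_def)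
    moreover have "(\<Sum>j | own j = i. \<bar>block_columns own A i $ s $ j\<bar>)
        \<le> (MAX r\<in>UNIV. \<Sum>j | own j = i. \<bar>block_columns own A i $ r $ j\<bar>)"
      by (rule Max_ge) auto
    moreover have "\<gamma> + 2 * wdegree W i + (MAX r\<in>UNIV. \<Sum>j | own j = i. \<bar>block_columns own A i $ r $ j\<bar>) \<le> inverse (\<sigma> i)"
      using le_inverse_step sigma by blast
    moreover note kron[of i s]
    ultimately have "(\<Sum>a\<in>UNIV. \<Sum>b\<in>UNIV. if (a, b) = (i, s) then 0 else \<bar>if (i, s) = (a, b) then inverse (\<sigma> i) else 0\<bar>) = 0"
      "\<gamma> + ((\<Sum>j\<in>UNIV. \<bar>if own j = i then A $ s $ j else 0\<bar>)
        + (\<Sum>a\<in>UNIV. \<Sum>b\<in>(UNIV :: 'm set). \<bar>laplacian W $ i $ a * mat 1 $ s $ b\<bar>)) \<le> inverse (\<sigma> i)"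
      by linarith+
    then show ?thesis
      by (simp add: l preconditioner_def sum_UNIV_Plus sum_UNIV_Times stacked_laplacian_def block_diagonal_nth cong: if_cong)
  qed
qed

lemma metric_operator_self_adjoint:
  "metric_operator own A W \<alpha> \<nu> \<sigma> u \<bullet> v = u \<bullet> metric_operator own A W \<alpha> \<nu> \<sigma> v"
proof -
  have "transpose (preconditioner own A W \<alpha> \<nu> \<sigma>) = preconditioner own A W \<alpha> \<nu> \<sigma>"
    by (simp add: transpose_def vec_eq_iff preconditioner_symmetric[symmetric])
  then have "(preconditioner own A W \<alpha> \<nu> \<sigma> *v stack u) \<bullet> stack v = stack u \<bullet> (preconditioner own A W \<alpha> \<nu> \<sigma> *v stack v)"
    by (metis dot_lmul_matrix vector_transpose_matrix)
  then show ?thesis by (metis inner_commute inner_metric_operator)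
qed

lemma norm_le_metric_operator:
  defines "\<kappa> \<equiv> matrix_norm (matrix_inv (preconditioner own A W \<alpha> \<nu> \<sigma>))"
  shows "(norm u)\<^sup>2 \<le> \<kappa> * (metric_operator own A W \<alpha> \<nu> \<sigma> u \<bullet> u)" "0 < \<kappa>"
proof -
  let ?P = "preconditioner own A W \<alpha> \<nu> \<sigma>"
  have t: "transpose ?P = ?P"
    by (simp add: transpose_def vec_eq_iff preconditioner_symmetric[symmetric])
  have sym: "(?P *v u) \<bullet> v = u \<bullet> (?P *v v)" for u v
    by (metis t dot_lmul_matrix vector_transpose_matrix)
  have dom: "\<gamma> * (norm v)\<^sup>2 \<le> (?P *v v) \<bullet> v" for v
    by (rule symmetric_diagonally_dominant_quadratic_form[OF preconditioner_symmetric preconditioner_diagonally_dominant])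
  show "(norm u)\<^sup>2 \<le> \<kappa> * (metric_operator own A W \<alpha> \<nu> \<sigma> u \<bullet> u)"
    using norm_le_matrix_inv_quadratic_form(1)[OF sym gamma dom, of "stack u"]
    by (simp add: \<kappa>_def inner_metric_operator power2_norm_eq_inner inner_stack)
  show "0 < \<kappa>"
    unfolding \<kappa>_def by (rule norm_le_matrix_inv_quadratic_form(2)[OF sym gamma dom])
qed

end

lemma linear_metric_operator:
  fixes own :: "'n::finite \<Rightarrow> 'i::finite" and A :: "real ^ 'n ^ 'm::finite"
  shows "linear (metric_operator own A W \<alpha> \<nu> \<sigma>)"
proof -
  interpret c: linear "constraint_map own A" by (rule linear_constraint_map)
  interpret m: linear "multiplier_map own A" by (rule linear_multiplier_map)
  interpret g: linear "graph_laplacian W :: real ^ 'm ^ 'i \<Rightarrow> _" by (rule linear_graph_laplacian)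
  show ?thesis
    by (rule linearI)
       (auto simp: metric_operator_def c.add c.scale m.add m.scale g.add g.scale vec_eq_iff
         algebra_simps add_divide_distrib scaleR_right_diff_distrib)
qed

section \<open>The Karush-Kuhn-Tucker operator of the game\<close>

lemma block_add: "block own i (x + y) = block own i x + block own i y"
  and block_diff: "block own i (x - y) = block own i x - block own i y"
  and block_scaleR: "block own i (c *\<^sub>R x) = c *\<^sub>R block own i x"
  by (auto simp: block_def vec_eq_iff)

lemma linear_block: "linear (block own i)"
  by (rule linearI) (simp_all add: block_add block_scaleR)

lemma sum_inner_block:
  fixes own :: "'n::finite \<Rightarrow> 'i::finite"
  shows "(\<Sum>i\<in>UNIV. (block own i u \<bullet> block own i v) / \<alpha> i) = (\<chi> j. u $ j / \<alpha> (own j)) \<bullet> v"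
proof -
  have "(\<Sum>i\<in>UNIV. (block own i u \<bullet> block own i v) / \<alpha> i)
      = (\<Sum>i\<in>UNIV. \<Sum>j\<in>UNIV. if own j = i then u $ j * v $ j / \<alpha> (own j) else 0)"
    by (auto simp: inner_vec_def block_def sum_divide_distrib intro!: sum.cong)
  also have "\<dots> = (\<Sum>j\<in>UNIV. u $ j * v $ j / \<alpha> (own j))"
    by (subst sum.swap) simp
  finally show ?thesis by (simp add: inner_vec_def)
qed

lemma transpose_block_columns_mult:
  "transpose (block_columns own A i) *v (l $ i) = block own i (multiplier_map own A l)"
  by (auto simp: vec_eq_iff transpose_def block_columns_def block_def multiplier_map_def matrix_vector_mult_def)

lemma block_columns_mult_block: "block_columns own A i *v block own i x = constraint_map own A x $ i"
  by (auto simp: vec_eq_iff constraint_map_def block_columns_def block_def matrix_vector_mult_def intro!: sum.cong)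

lemma inner_const_constraint_map:
  fixes A :: "real ^ 'n ^ 'm" and own :: "'n \<Rightarrow> 'i::finite"
  shows "(\<chi> i. c) \<bullet> constraint_map own A x = c \<bullet> (A *v x)"
proof -
  have "(\<chi> i. c) \<bullet> constraint_map own A x = (\<Sum>j\<in>UNIV. \<Sum>r\<in>UNIV. A $ r $ j * c $ r * x $ j)"
    unfolding multiplier_map_adjoint[symmetric]
    by (simp add: inner_vec_def multiplier_map_def sum_distrib_right)
  also have "\<dots> = c \<bullet> (A *v x)"
    by (subst sum.swap) (simp add: inner_vec_def matrix_vector_mult_def sum_distrib_left mult_ac)
  finally show ?thesis .
qed

lemma nonneg_inner_nonpos:
  fixes u v :: "real ^ 'm"
  assumes "0 \<le> u" "v \<le> 0" shows "u \<bullet> v \<le> 0"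
  unfolding inner_vec_def
  by (rule sum_nonpos) (use assms in \<open>auto simp: less_eq_vec_def intro: mult_nonneg_nonpos\<close>)

lemma convex_nonneg_orthant: "convex {u :: real ^ 'm. 0 \<le> u}"
  by (auto simp: convex_def less_eq_vec_def)

lemma closed_nonneg_orthant: "closed {u :: real ^ 'm. 0 \<le> u}"
  unfolding less_eq_vec_def by (intro closed_Collect_all closed_Collect_le continuous_intros)

text \<open>
  The relation \<open>(\<partial>h x + A\<^sup>\<top> l, L l, N l - A x - L z)\<close>, where \<open>N\<close> is the normal cone of the nonnegative
  orthant. Subdifferential and normal cone are written as variational inequalities, which makes closedness
  and monotonicity direct.
\<close>

definition kkt_operator ::
    "('n::finite \<Rightarrow> 'i::finite) \<Rightarrow> real ^ 'n ^ 'm::finite \<Rightarrow> real ^ 'i ^ 'i \<Rightarrow> (real ^ 'n) set \<Rightarrow> (real ^ 'n \<Rightarrow> real) \<Rightarrow>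
     (('n, 'm, 'i) state \<times> ('n, 'm, 'i) state) set" where
  "kkt_operator own A W Y h = {((x, z, l), (u, v, n)).
     x \<in> Y \<and> (\<forall>y\<in>Y. (u - multiplier_map own A l) \<bullet> (y - x) \<le> h y - h x) \<and>
     v = graph_laplacian W l \<and>
     0 \<le> l \<and> (\<forall>l'\<ge>0. (n + constraint_map own A x + graph_laplacian W z) \<bullet> (l' - l) \<le> 0)}"

definition forward_map ::
    "real ^ 'i ^ 'i \<Rightarrow> (real ^ 'n \<Rightarrow> real ^ 'n) \<Rightarrow> ('i \<Rightarrow> real ^ 'm) \<Rightarrow> ('n::finite, 'm::finite, 'i::finite) state \<Rightarrow> ('n, 'm, 'i) state" where
  "forward_map W F bs = (\<lambda>(x, z, l). (F x, 0, graph_laplacian W l + (\<chi> i. bs i)))"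

context
  fixes own :: "'n::finite \<Rightarrow> 'i::finite" and A :: "real ^ 'n ^ 'm::finite" and W :: "real ^ 'i ^ 'i"
  assumes graph: "weighted_connected_graph W"
begin

text \<open>
  The couplings by \<open>A\<close> and \<open>L\<close> are skew and cancel; the subdifferential and the normal cone contribute
  nonnegative terms.
\<close>

lemma kkt_operator_monotone:
  assumes "(p, p') \<in> kkt_operator own A W Y h" "(q, q') \<in> kkt_operator own A W Y h"
  shows "0 \<le> (p' - q') \<bullet> (p - q)"
proof -
  interpret c: linear "constraint_map own A :: _ \<Rightarrow> real ^ 'm ^ 'i" by (rule linear_constraint_map)
  interpret m: linear "multiplier_map own A :: real ^ 'm ^ 'i \<Rightarrow> _" by (rule linear_multiplier_map)
  interpret g: linear "graph_laplacian W :: real ^ 'm ^ 'i \<Rightarrow> _" by (rule linear_graph_laplacian)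
  obtain x z l u v n where p: "p = (x, z, l)" "p' = (u, v, n)" by (metis surj_pair)
  obtain x' z' l' u' v' n' where q: "q = (x', z', l')" "q' = (u', v', n')" by (metis surj_pair)
  have P: "x \<in> Y" "\<And>y. y \<in> Y \<Longrightarrow> (u - multiplier_map own A l) \<bullet> (y - x) \<le> h y - h x" "v = graph_laplacian W l" "0 \<le> l"
     "\<And>l'. 0 \<le> l' \<Longrightarrow> (n + constraint_map own A x + graph_laplacian W z) \<bullet> (l' - l) \<le> 0"
    using assms(1) unfolding p kkt_operator_def by auto
  have Q: "x' \<in> Y" "\<And>y. y \<in> Y \<Longrightarrow> (u' - multiplier_map own A l') \<bullet> (y - x') \<le> h y - h x'" "v' = graph_laplacian W l'" "0 \<le> l'"
     "\<And>l. 0 \<le> l \<Longrightarrow> (n' + constraint_map own A x' + graph_laplacian W z') \<bullet> (l - l') \<le> 0"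
    using assms(2) unfolding q kkt_operator_def by auto
  define dx dl dz where "dx = x - x'" and "dl = l - l'" and "dz = z - z'"
  have "(u - multiplier_map own A l) \<bullet> (x' - x) + (u' - multiplier_map own A l') \<bullet> (x - x') \<le> 0"
    using P(2)[OF Q(1)] Q(2)[OF P(1)] by simp
  then have 1: "multiplier_map own A dl \<bullet> dx \<le> (u - u') \<bullet> dx"
    by (simp add: dx_def dl_def m.diff inner_diff_left inner_diff_right)
  have "(n + constraint_map own A x + graph_laplacian W z) \<bullet> (l' - l) + (n' + constraint_map own A x' + graph_laplacian W z') \<bullet> (l - l') \<le> 0"
    using P(5)[OF Q(4)] Q(5)[OF P(4)] by simp
  then have 2: "- (constraint_map own A dx \<bullet> dl) - graph_laplacian W dz \<bullet> dl \<le> (n - n') \<bullet> dl"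
    by (simp add: dx_def dl_def dz_def c.diff g.diff inner_diff_left inner_diff_right inner_add_left algebra_simps)
  have 3: "(v - v') \<bullet> dz = graph_laplacian W dz \<bullet> dl"
    using graph_laplacian_self_adjoint[OF graph, of dl dz] by (simp add: P(3) Q(3) g.diff[symmetric] dl_def inner_commute)
  have 4: "multiplier_map own A dl \<bullet> dx = constraint_map own A dx \<bullet> dl"
    by (subst multiplier_map_adjoint) (rule inner_commute)
  have "(p' - q') \<bullet> (p - q) = (u - u') \<bullet> dx + ((v - v') \<bullet> dz + (n - n') \<bullet> dl)"
    by (simp add: p q inner_prod_def dx_def dl_def dz_def)
  then show ?thesis using 1 2 3 4 by linarith
qed

text \<open>
  The inequalities pass to the limit by continuity, except for the term \<open>h x\<close>, which has the right sign
  for lower semicontinuity to suffice.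
\<close>

lemma kkt_operator_closed:
  assumes Y: "closed Y" and h: "real_lsc_on Y h"
  shows "closed (kkt_operator own A W Y h)"
  unfolding closed_sequential_limits
proof (intro allI impI, elim conjE)
  fix p :: "nat \<Rightarrow> ('n, 'm, 'i) state \<times> ('n, 'm, 'i) state" and pb
  assume pk: "\<forall>k. p k \<in> kkt_operator own A W Y h" and lim: "p \<longlonglongrightarrow> pb"
  define x z l u v n where "x k = fst (fst (p k))" and "z k = fst (snd (fst (p k)))" and "l k = snd (snd (fst (p k)))"
    and "u k = fst (snd (p k))" and "v k = fst (snd (snd (p k)))" and "n k = snd (snd (snd (p k)))" for k
  note defs = x_def z_def l_def u_def v_def n_def
  obtain xb zb lb ub vb nb where pb: "pb = ((xb, zb, lb), (ub, vb, nb))" by (metis surj_pair)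
  have lims: "x \<longlonglongrightarrow> xb" "z \<longlonglongrightarrow> zb" "l \<longlonglongrightarrow> lb" "u \<longlonglongrightarrow> ub" "v \<longlonglongrightarrow> vb" "n \<longlonglongrightarrow> nb"
    using tendsto_fst[OF tendsto_fst[OF lim]] tendsto_fst[OF tendsto_snd[OF tendsto_fst[OF lim]]]
      tendsto_snd[OF tendsto_snd[OF tendsto_fst[OF lim]]] tendsto_fst[OF tendsto_snd[OF lim]]
      tendsto_fst[OF tendsto_snd[OF tendsto_snd[OF lim]]] tendsto_snd[OF tendsto_snd[OF tendsto_snd[OF lim]]]
    by (simp_all add: defs[abs_def] pb)
  have P: "x k \<in> Y" "\<And>y. y \<in> Y \<Longrightarrow> (u k - multiplier_map own A (l k)) \<bullet> (y - x k) \<le> h y - h (x k)" "v k = graph_laplacian W (l k)" "0 \<le> l k"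
     "\<And>l'. 0 \<le> l' \<Longrightarrow> (n k + constraint_map own A (x k) + graph_laplacian W (z k)) \<bullet> (l' - l k) \<le> 0" for k
    using pk[rule_format, of k] unfolding kkt_operator_def defs by (auto simp: case_prod_beta')
  note blt = bounded_linear.tendsto[OF linear_conv_bounded_linear[THEN iffD1]]
  have K: "(\<lambda>k. constraint_map own A (x k) :: real ^ 'm ^ 'i) \<longlonglongrightarrow> constraint_map own A xb"
    by (rule blt[OF linear_constraint_map lims(1)])
  have M: "(\<lambda>k. multiplier_map own A (l k)) \<longlonglongrightarrow> multiplier_map own A lb"
    by (rule blt[OF linear_multiplier_map lims(3)])
  have Gl: "(\<lambda>k. graph_laplacian W (l k)) \<longlonglongrightarrow> graph_laplacian W lb"
    by (rule blt[OF linear_graph_laplacian lims(3)])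
  have Gz: "(\<lambda>k. graph_laplacian W (z k)) \<longlonglongrightarrow> graph_laplacian W zb"
    by (rule blt[OF linear_graph_laplacian lims(2)])
  have xb: "xb \<in> Y" using closed_sequentially[OF Y P(1) lims(1)] .
  have "(ub - multiplier_map own A lb) \<bullet> (y - xb) \<le> h y - h xb" if y: "y \<in> Y" for y
  proof -
    have "h xb \<le> h y - (ub - multiplier_map own A lb) \<bullet> (y - xb)"
    proof (rule real_lsc_on_limit_le[OF h lims(1) P(1) xb])
      show "(\<lambda>k. h y - (u k - multiplier_map own A (l k)) \<bullet> (y - x k)) \<longlonglongrightarrow> h y - (ub - multiplier_map own A lb) \<bullet> (y - xb)"
        by (intro tendsto_intros lims M)
      show "h (x k) \<le> h y - (u k - multiplier_map own A (l k)) \<bullet> (y - x k)" for k using P(2)[OF y, of k] by simp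
    qed
    then show ?thesis by simp
  qed
  moreover have "vb = graph_laplacian W lb"
  proof -
    have "v = (\<lambda>k. graph_laplacian W (l k))" using P(3) by auto
    then show ?thesis using LIMSEQ_unique[OF lims(5)] Gl by simp
  qed
  moreover have "0 \<le> lb"
  proof -
    have "0 \<le> lb $ i $ r" for i r
    proof (rule LIMSEQ_le_const)
      show "(\<lambda>k. l k $ i $ r) \<longlonglongrightarrow> lb $ i $ r" by (intro tendsto_vec_nth lims)
      show "\<exists>N. \<forall>k\<ge>N. 0 \<le> l k $ i $ r" using P(4) by (auto simp: less_eq_vec_def)
    qed
    then show ?thesis by (simp add: less_eq_vec_def)
  qed
  moreover have "(nb + constraint_map own A xb + graph_laplacian W zb) \<bullet> (l' - lb) \<le> 0" if "0 \<le> l'" for l'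
  proof (rule LIMSEQ_le_const2)
    show "(\<lambda>k. (n k + constraint_map own A (x k) + graph_laplacian W (z k)) \<bullet> (l' - l k))
        \<longlonglongrightarrow> (nb + constraint_map own A xb + graph_laplacian W zb) \<bullet> (l' - lb)"
      by (intro tendsto_intros lims K Gz)
    show "\<exists>N. \<forall>k\<ge>N. (n k + constraint_map own A (x k) + graph_laplacian W (z k)) \<bullet> (l' - l k) \<le> 0"
      using P(5)[OF that] by blast
  qed
  ultimately show "pb \<in> kkt_operator own A W Y h" using xb by (auto simp: pb kkt_operator_def)
qed

lemma inner_const_graph_laplacian: "(\<chi> i. c) \<bullet> graph_laplacian W (v :: real ^ 'm ^ 'i) = 0"
proof -
  have "(\<chi> i. c) \<bullet> graph_laplacian W v = graph_laplacian W (\<chi> i. c) \<bullet> v"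
    by (rule graph_laplacian_self_adjoint[OF graph, symmetric])
  also have "graph_laplacian W (\<chi> i. c) = 0" by (simp add: graph_laplacian_def vec_eq_iff)
  finally show ?thesis by simp
qed

lemma inner_const: "(\<chi> i. c) \<bullet> (v :: real ^ 'm ^ 'i) = c \<bullet> (\<Sum>i\<in>UNIV. v $ i)"
  by (simp add: inner_vec_def[of "\<chi> i. c"] inner_sum_right)

text \<open>
  The second component forces a common multiplier \<open>\<mu>\<close>. Testing the third component with vectors that are
  equal for all agents eliminates \<open>z\<close> and sums the local constraints to \<open>A x - b\<close>, so it gives feasibility
  and complementary slackness.
\<close>

lemma zero_imp_vi:
  assumes zero: "((x, z, l), - forward_map W F bs (x, z, l)) \<in> kkt_operator own A W Y h"
    and b: "b = (\<Sum>i\<in>UNIV. bs i)"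
  shows "x \<in> Y" "A *v x \<le> b" "\<And>y. y \<in> Y \<Longrightarrow> A *v y \<le> b \<Longrightarrow> 0 \<le> F x \<bullet> (y - x) + h y - h x"
proof -
  have P: "x \<in> Y" "\<And>y. y \<in> Y \<Longrightarrow> (- F x - multiplier_map own A l) \<bullet> (y - x) \<le> h y - h x"
      "graph_laplacian W l = 0" "0 \<le> l"
    and P5: "\<And>l'. 0 \<le> l' \<Longrightarrow> (- (graph_laplacian W l + (\<chi> i. bs i)) + constraint_map own A x + graph_laplacian W z) \<bullet> (l' - l) \<le> 0"
    using zero unfolding kkt_operator_def forward_map_def by auto
  define s where "s = constraint_map own A x + graph_laplacian W z - (\<chi> i. bs i)"
  have s: "s \<bullet> (l' - l) \<le> 0" if "0 \<le> l'" for l'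
    using P5[OF that] P(3) by (simp add: s_def algebra_simps)
  show "x \<in> Y" by fact
  have sc: "(\<chi> i. c) \<bullet> s = c \<bullet> (A *v x - b)" for c
    using inner_const_constraint_map[of c own A x] inner_const_graph_laplacian[of c z]
    by (simp add: s_def inner_diff_right inner_add_right inner_const[of _ "\<chi> i. bs i"] b)
  define \<mu> where "\<mu> = l $ undefined"
  have l: "l = (\<chi> i. \<mu>)" using graph_laplacian_kernel[OF graph P(3)] by (auto simp: vec_eq_iff \<mu>_def)
  have \<mu>0: "0 \<le> \<mu>" using P(4) by (simp add: less_eq_vec_def \<mu>_def)
  show feas: "A *v x \<le> b"
  proof -
    have "(A *v x - b) $ r \<le> 0" for r
    proof -
      have "0 \<le> l + (\<chi> i. axis r 1)" using P(4) by (auto simp: less_eq_vec_def axis_def)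
      from s[OF this] have "(\<chi> i. axis r 1) \<bullet> s \<le> 0" by (simp add: inner_commute)
      then show ?thesis unfolding sc by (simp add: inner_axis')
    qed
    then show ?thesis by (simp add: less_eq_vec_def)
  qed
  have comp: "\<mu> \<bullet> (A *v x - b) = 0"
  proof -
    have "s \<bullet> l \<le> 0" using s[of "l + l"] P(4) by (simp add: less_eq_vec_def)
    moreover have "0 \<le> s \<bullet> l" using s[of 0] by simp
    ultimately show ?thesis using sc[of \<mu>] l by (simp add: inner_commute)
  qed
  fix y assume y: "y \<in> Y" "A *v y \<le> b"
  have "multiplier_map own A l \<bullet> (y - x) = (\<chi> i. \<mu>) \<bullet> constraint_map own A (y - x)"
    by (simp only: multiplier_map_adjoint l)
  also have "\<dots> = \<mu> \<bullet> (A *v y - b) - \<mu> \<bullet> (A *v x - b)"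
    by (simp add: inner_const_constraint_map matrix_vector_mult_diff_distrib inner_diff_right)
  also have "\<dots> \<le> 0"
    using nonneg_inner_nonpos[OF \<mu>0, of "A *v y - b"] y(2) comp by (simp add: less_eq_vec_def)
  finally show "0 \<le> F x \<bullet> (y - x) + h y - h x"
    using P(2)[OF y(1)] by (simp add: inner_diff_left)
qed

text \<open>
  The solution \<open>x\<close> minimizes \<open>\<langle>F x, u\<rangle> + h u\<close> over the feasible points, so there is a multiplier \<open>\<mu>\<close>, which
  is given to every agent. The total slack \<open>A x - b\<close> is divided equally among the agents; what the local
  slacks differ from this share sums to 0 and is therefore of the form \<open>L z\<close>.
\<close>

lemma vi_imp_zero:
  assumes Y: "convex Y" "convex_on Y h" and b: "b = (\<Sum>i\<in>UNIV. bs i)"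
    and x: "x \<in> Y" "A *v x \<le> b" "\<And>y. y \<in> Y \<Longrightarrow> A *v y \<le> b \<Longrightarrow> 0 \<le> F x \<bullet> (y - x) + h y - h x"
    and slater: "y0 \<in> Y" "\<And>r. (A *v y0) $ r < b $ r"
  shows "\<exists>z l. ((x, z, l), - forward_map W F bs (x, z, l)) \<in> kkt_operator own A W Y h"
proof -
  define \<phi> where "\<phi> u = F x \<bullet> u + h u" for u
  have "convex_on Y (\<lambda>u. F x \<bullet> u)"
    using Y(1) by (auto simp: convex_on_def inner_add_right)
  then have \<phi>: "convex_on Y \<phi>" unfolding \<phi>_def using Y(2) by (rule convex_on_add)
  have min: "\<phi> x \<le> \<phi> u" if "u \<in> Y" "A *v u \<le> b" for u
    using x(3)[OF that] by (simp add: \<phi>_def inner_diff_right)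
  obtain \<mu> where \<mu>: "0 \<le> \<mu>" "\<mu> \<bullet> (A *v x - b) = 0" "\<And>u. u \<in> Y \<Longrightarrow> \<phi> x \<le> \<phi> u + \<mu> \<bullet> (A *v u - b)"
    using lagrange_multiplier_exists[OF Y(1) \<phi> x(1,2) min slater] by blast
  define l where "l = (\<chi> i::'i. \<mu>)"
  (* s is the share of each agent in the total slack. *)
  define s where "s = (A *v x - b) /\<^sub>R real CARD('i)"
  define y where "y = (\<chi> i. s) - constraint_map own A x + (\<chi> i. bs i)"
  have "(\<Sum>i\<in>UNIV. y $ i) = 0"
  proof -
    have "c \<bullet> (\<Sum>i\<in>UNIV. y $ i) = 0" for c
    proof -
      have "(\<chi> i. c) \<bullet> (\<chi> i::'i. s) = c \<bullet> (A *v x - b)"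
        by (simp add: inner_const s_def sum_constant_scaleR del: sum_constant)
      then have "(\<chi> i. c) \<bullet> y = 0"
        using inner_const_constraint_map[of c own A x]
        by (simp add: y_def inner_diff_right inner_add_right inner_const[of _ "\<chi> i. bs i"] b)
      then show ?thesis by (simp add: inner_const)
    qed
    then show ?thesis using inner_eq_zero_iff by blast
  qed
  then obtain z where z: "graph_laplacian W z = y" using graph_laplacian_range[OF graph] by blast
  have lap_l: "graph_laplacian W l = 0" by (simp add: graph_laplacian_def l_def vec_eq_iff)
  have l0: "0 \<le> l" using \<mu>(1) by (simp add: l_def less_eq_vec_def)
  have 1: "(- F x - multiplier_map own A l) \<bullet> (u - x) \<le> h u - h x" if u: "u \<in> Y" for u
  proof -
    have "multiplier_map own A l \<bullet> (u - x) = (\<chi> i. \<mu>) \<bullet> constraint_map own A (u - x)"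
      by (simp only: multiplier_map_adjoint l_def)
    also have "\<dots> = \<mu> \<bullet> (A *v u - b) - \<mu> \<bullet> (A *v x - b)"
      by (simp add: inner_const_constraint_map matrix_vector_mult_diff_distrib inner_diff_right)
    finally show ?thesis using \<mu>(2) \<mu>(3)[OF u] by (simp add: \<phi>_def inner_diff_left inner_diff_right)
  qed
  have 2: "(- (graph_laplacian W l + (\<chi> i. bs i)) + constraint_map own A x + graph_laplacian W z) \<bullet> (l' - l) \<le> 0"
    if l': "0 \<le> l'" for l'
  proof -
    have "- (graph_laplacian W l + (\<chi> i. bs i)) + constraint_map own A x + graph_laplacian W z = (\<chi> i. s)"
      by (simp add: lap_l z y_def)
    moreover have "(\<chi> i. s) \<bullet> l = 0"
      using \<mu>(2) by (simp add: l_def inner_const s_def sum_constant_scaleR inner_commute del: sum_constant)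
    moreover have "(\<chi> i. s) \<bullet> l' \<le> 0"
    proof -
      have "s \<bullet> l' $ i \<le> 0" for i
      proof -
        have "s \<le> 0" using x(2) by (auto simp: s_def less_eq_vec_def mult_le_0_iff)
        moreover have "0 \<le> l' $ i" using l' by (simp add: less_eq_vec_def)
        ultimately show ?thesis using nonneg_inner_nonpos by (metis inner_commute)
      qed
      then show ?thesis by (simp add: inner_vec_def[of "\<chi> i. s"] sum_nonpos)
    qed
    ultimately show ?thesis by (simp add: inner_diff_right)
  qed
  have "((x, z, l), - forward_map W F bs (x, z, l)) \<in> kkt_operator own A W Y h"
    using x(1) 1 2 l0 lap_l by (simp add: kkt_operator_def forward_map_def)
  then show ?thesis by blast
qed

lemma forward_map_cocoercive:
  assumes \<theta>: "0 < \<theta>" "\<theta> \<le> \<beta>" "2 * max_wdegree W * \<theta> \<le> 1"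
    and F: "\<beta> * (norm (F x - F x'))\<^sup>2 \<le> (F x - F x') \<bullet> (x - x')"
  shows "\<theta> * (norm (forward_map W F bs (x, z, l) - forward_map W F bs (x', z', l' :: real ^ 'm ^ 'i)))\<^sup>2
     \<le> (forward_map W F bs (x, z, l) - forward_map W F bs (x', z', l')) \<bullet> ((x, z, l) - (x', z', l'))"
proof -
  interpret g: linear "graph_laplacian W :: real ^ 'm ^ 'i \<Rightarrow> _" by (rule linear_graph_laplacian)
  let ?d = "l - l'"
  have D: "forward_map W F bs (x, z, l) - forward_map W F bs (x', z', l') = (F x - F x', 0, graph_laplacian W ?d)"
    by (simp add: forward_map_def g.diff)
  have coc: "(norm (graph_laplacian W ?d))\<^sup>2 \<le> 2 * max_wdegree W * (graph_laplacian W ?d \<bullet> ?d)"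
    by (rule graph_laplacian_cocoercive[OF graph])
  have nn: "0 \<le> graph_laplacian W ?d \<bullet> ?d"
  proof -
    have "0 \<le> 2 * (graph_laplacian W ?d \<bullet> ?d)"
      unfolding inner_graph_laplacian[OF graph] by (intro sum_nonneg mult_nonneg_nonneg W_nonneg[OF graph]) auto
    then show ?thesis by simp
  qed
  have "\<theta> * (norm (graph_laplacian W ?d))\<^sup>2 \<le> \<theta> * (2 * max_wdegree W * (graph_laplacian W ?d \<bullet> ?d))"
    using coc \<theta>(1) by (intro mult_left_mono) auto
  also have "\<dots> = (2 * max_wdegree W * \<theta>) * (graph_laplacian W ?d \<bullet> ?d)" by simp
  also have "\<dots> \<le> 1 * (graph_laplacian W ?d \<bullet> ?d)" by (intro mult_right_mono \<theta>(3) nn)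
  finally have 2: "\<theta> * (norm (graph_laplacian W ?d))\<^sup>2 \<le> graph_laplacian W ?d \<bullet> ?d" by simp
  have 1: "\<theta> * (norm (F x - F x'))\<^sup>2 \<le> (F x - F x') \<bullet> (x - x')"
    using mult_right_mono[OF \<theta>(2), of "(norm (F x - F x'))\<^sup>2"] F by simp
  show ?thesis unfolding D
    using 1 2 by (simp add: power2_norm_eq_inner inner_prod_def distrib_left)
qed

text \<open>
  The terms of \<open>\<Phi>\<close> off the diagonal are chosen so that the implicit couplings in \<open>B\<close> become explicit:
  they shift \<open>l\<^sub>k\<^sub>+\<^sub>1\<close> to \<open>l\<^sub>k\<close> in the first two components and produce the extrapolations
  \<open>2 x\<^sub>k\<^sub>+\<^sub>1 - x\<^sub>k\<close> and \<open>2 z\<^sub>k\<^sub>+\<^sub>1 - z\<^sub>k\<close> in the third.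
\<close>

lemma step_in_kkt_operator:
  fixes x xp G :: "real ^ 'n" and z zp l lp :: "real ^ 'm ^ 'i"
  assumes steps: "\<And>i. 0 < \<alpha> i" "\<And>i. 0 < \<nu> i" "\<And>i. 0 < \<sigma> i"
    and xp: "\<And>i. is_prox (\<Omega> i) (\<lambda>u. \<alpha> i * h i u)
        (block own i x - \<alpha> i *\<^sub>R (block own i G + transpose (block_columns own A i) *v (l $ i))) (block own i xp)"
    and zp: "\<And>i. zp $ i = z $ i - \<nu> i *\<^sub>R (\<Sum>j\<in>UNIV. W $ i $ j *\<^sub>R (l $ i - l $ j))"
    and lp: "\<And>i. lp $ i = closest_point {u. 0 \<le> u}
              (l $ i
                + \<sigma> i *\<^sub>R (block_columns own A i *v (2 *\<^sub>R block own i xp - block own i x) - bs i)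
                + \<sigma> i *\<^sub>R (\<Sum>j\<in>UNIV. W $ i $ j *\<^sub>R (2 *\<^sub>R (zp $ i - zp $ j) - (z $ i - z $ j)))
                - \<sigma> i *\<^sub>R (\<Sum>j\<in>UNIV. W $ i $ j *\<^sub>R (l $ i - l $ j)))"
  shows "((xp, zp, lp), metric_operator own A W \<alpha> \<nu> \<sigma> ((x, z, l) - (xp, zp, lp)) - forward_map W F bs (x, z, l) - (G - F x, 0, 0))
      \<in> kkt_operator own A W (strategy_set own \<Omega>) (\<lambda>y. \<Sum>i\<in>UNIV. h i (block own i y))"
proof -
  interpret c: linear "constraint_map own A :: _ \<Rightarrow> real ^ 'm ^ 'i" by (rule linear_constraint_map)
  interpret m: linear "multiplier_map own A :: real ^ 'm ^ 'i \<Rightarrow> _" by (rule linear_multiplier_map)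
  interpret g: linear "graph_laplacian W :: real ^ 'm ^ 'i \<Rightarrow> _" by (rule linear_graph_laplacian)
  let ?Y = "strategy_set own \<Omega>" and ?h = "\<lambda>y. \<Sum>i\<in>UNIV. h i (block own i y)"
  define u where "u = (\<chi> j. (x - xp) $ j / \<alpha> (own j)) - multiplier_map own A (l - lp) - F x - (G - F x)"
  define v where "v = (\<chi> i. (z - zp) $ i /\<^sub>R \<nu> i) - graph_laplacian W (l - lp)"
  define n where "n = (\<chi> i. (l - lp) $ i /\<^sub>R \<sigma> i) - constraint_map own A (x - xp) - graph_laplacian W (z - zp)
      - (graph_laplacian W l + (\<chi> i. bs i))"
  have eq: "metric_operator own A W \<alpha> \<nu> \<sigma> ((x, z, l) - (xp, zp, lp)) - forward_map W F bs (x, z, l) - (G - F x, 0, 0) = (u, v, n)"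
    by (simp add: metric_operator_def forward_map_def u_def v_def n_def)
  have xpY: "xp \<in> ?Y" using xp by (simp add: strategy_set_def is_prox_def)
  have 1: "(u - multiplier_map own A lp) \<bullet> (y - xp) \<le> ?h y - ?h xp" if y: "y \<in> ?Y" for y
  proof -
    let ?q = "x - xp - (\<chi> j. \<alpha> (own j) * (G + multiplier_map own A l) $ j)"
    have bl: "block own i ?q \<bullet> block own i (y - xp) / \<alpha> i \<le> h i (block own i y) - h i (block own i xp)" for i
    proof -
      have "block own i y \<in> \<Omega> i" using y by (simp add: strategy_set_def)
      then have "(block own i x - \<alpha> i *\<^sub>R (block own i G + block own i (multiplier_map own A l)) - block own i xp)
          \<bullet> (block own i y - block own i xp) \<le> \<alpha> i * h i (block own i y) - \<alpha> i * h i (block own i xp)"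
        using xp[of i] unfolding is_prox_def transpose_block_columns_mult by blast
      also have "block own i x - \<alpha> i *\<^sub>R (block own i G + block own i (multiplier_map own A l)) - block own i xp = block own i ?q"
        by (auto simp: block_def vec_eq_iff)
      finally show ?thesis using steps(1)[of i] by (simp add: block_diff field_simps)
    qed
    have "u - multiplier_map own A lp = (\<chi> j. ?q $ j / \<alpha> (own j))"
    proof -
      have "\<alpha> (own j) \<noteq> 0" for j using steps(1)[of "own j"] by simp
      then show ?thesis by (simp add: vec_eq_iff u_def m.diff diff_divide_distrib)
    qed
    then have "(u - multiplier_map own A lp) \<bullet> (y - xp) = (\<Sum>i\<in>UNIV. block own i ?q \<bullet> block own i (y - xp) / \<alpha> i)"
      by (simp only: sum_inner_block)
    also have "\<dots> \<le> (\<Sum>i\<in>UNIV. h i (block own i y) - h i (block own i xp))" by (intro sum_mono bl)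
    finally show ?thesis by (simp add: sum_subtractf)
  qed
  have 2: "v = graph_laplacian W lp"
  proof -
    have "(z - zp) $ i /\<^sub>R \<nu> i = graph_laplacian W l $ i" for i
      using steps(2)[of i] by (simp add: zp graph_laplacian_def)
    then show ?thesis by (simp add: v_def g.diff)
  qed
  define q where "q = (\<chi> i. l $ i + \<sigma> i *\<^sub>R (constraint_map own A (2 *\<^sub>R xp - x) $ i - bs i)
      + \<sigma> i *\<^sub>R graph_laplacian W (2 *\<^sub>R zp - z) $ i - \<sigma> i *\<^sub>R graph_laplacian W l $ i)"
  have lpq: "lp $ i = closest_point {u. 0 \<le> u} (q $ i)" for i
  proof -
    have "block_columns own A i *v (2 *\<^sub>R block own i xp - block own i x) = constraint_map own A (2 *\<^sub>R xp - x) $ i"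
      by (simp add: block_columns_mult_block[symmetric] block_diff block_scaleR)
    moreover have "(\<Sum>j\<in>UNIV. W $ i $ j *\<^sub>R (2 *\<^sub>R (zp $ i - zp $ j) - (z $ i - z $ j))) = graph_laplacian W (2 *\<^sub>R zp - z) $ i"
      by (simp add: graph_laplacian_def algebra_simps)
    ultimately show ?thesis unfolding lp by (simp add: q_def graph_laplacian_def)
  qed
  have lp0: "0 \<le> lp"
    using closest_point_in_set[OF closed_nonneg_orthant, of "q $ _"] lpq by (auto simp: less_eq_vec_def[of 0 lp])
  have 3: "(n + constraint_map own A xp + graph_laplacian W zp) \<bullet> (l' - lp) \<le> 0" if l': "0 \<le> l'" for l'
  proof -
    have "(n + constraint_map own A xp + graph_laplacian W zp) $ i = (q $ i - lp $ i) /\<^sub>R \<sigma> i" for i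
    proof -
      have "\<sigma> i \<noteq> 0" using steps(3)[of i] by simp
      then have "(q $ i - lp $ i) /\<^sub>R \<sigma> i = (l $ i - lp $ i) /\<^sub>R \<sigma> i + (constraint_map own A (2 *\<^sub>R xp - x) $ i - bs i)
          + graph_laplacian W (2 *\<^sub>R zp - z) $ i - graph_laplacian W l $ i"
        by (simp add: q_def algebra_simps)
      also have "constraint_map own A (2 *\<^sub>R xp - x) = 2 *\<^sub>R constraint_map own A xp - constraint_map own A x"
        by (simp only: c.diff c.scale)
      also have "graph_laplacian W (2 *\<^sub>R zp - z) = 2 *\<^sub>R graph_laplacian W zp - graph_laplacian W z"
        by (simp only: g.diff g.scale)
      finally show ?thesis
        by (simp add: n_def c.diff g.diff scaleR_2)
    qed
    moreover have "((q $ i - lp $ i) /\<^sub>R \<sigma> i) \<bullet> (l' $ i - lp $ i) \<le> 0" for i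
    proof -
      have "(q $ i - lp $ i) \<bullet> (l' $ i - lp $ i) \<le> 0"
        unfolding lpq by (rule closest_point_dot[OF convex_nonneg_orthant closed_nonneg_orthant]) (use l' in \<open>simp add: less_eq_vec_def\<close>)
      then show ?thesis using steps(3)[of i] by (simp add: mult_le_0_iff)
    qed
    ultimately show ?thesis by (simp add: inner_vec_def[of "n + constraint_map own A xp + graph_laplacian W zp"] sum_nonpos)
  qed
  show ?thesis unfolding eq using xpY 1 2 3 lp0 by (simp add: kkt_operator_def)
qed

end

section \<open>Convergence along a sample path\<close>

lemma sum_block: "(\<Sum>i\<in>UNIV. block own i y) = (y :: real ^ 'n)" for own :: "'n::finite \<Rightarrow> 'i::finite"
  by (simp add: vec_eq_iff block_def)

lemma continuous_on_block: "continuous_on S (block own i)"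
  by (rule linear_continuous_on[OF linear_conv_bounded_linear[THEN iffD1, OF linear_block]])

lemma compact_strategy_set:
  fixes own :: "'n::finite \<Rightarrow> 'i::finite"
  assumes "\<And>i. compact (\<Omega> i)"
  shows "compact (strategy_set own \<Omega>)"
proof -
  have "closed (strategy_set own \<Omega>)"
  proof -
    have "strategy_set own \<Omega> = (\<Inter>i. block own i -` \<Omega> i)" by (auto simp: strategy_set_def)
    moreover have "closed (block own i -` \<Omega> i)" for i
      using assms by (intro closed_vimage compact_imp_closed continuous_on_block) auto
    ultimately show ?thesis by auto
  qed
  moreover have "bounded (strategy_set own \<Omega>)"
  proof -
    have "\<exists>c. \<forall>u\<in>\<Omega> i. norm u \<le> c" for i
      using compact_imp_bounded[OF assms[of i]] by (simp add: bounded_iff)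
    then obtain c where c: "\<And>i u. u \<in> \<Omega> i \<Longrightarrow> norm u \<le> c i" by metis
    have "norm y \<le> (\<Sum>i\<in>UNIV. c i)" if "y \<in> strategy_set own \<Omega>" for y
    proof -
      have "norm y = norm (\<Sum>i\<in>UNIV. block own i y)" by (simp only: sum_block)
      also have "\<dots> \<le> (\<Sum>i\<in>UNIV. c i)"
        by (rule sum_norm_le) (use that c in \<open>auto simp: strategy_set_def\<close>)
      finally show ?thesis .
    qed
    then show ?thesis by (auto simp: bounded_iff)
  qed
  ultimately show ?thesis by (simp add: compact_eq_bounded_closed)
qed

lemma convex_strategy_set:
  assumes "\<And>i. convex (\<Omega> i)"
  shows "convex (strategy_set own \<Omega>)"
proof -
  have "strategy_set own \<Omega> = (\<Inter>i. block own i -` \<Omega> i)" by (auto simp: strategy_set_def)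
  then show ?thesis by (simp add: convex_INT convex_linear_vimage[OF linear_block] assms)
qed

lemma real_lsc_on_total_cost:
  fixes own :: "'n::finite \<Rightarrow> 'i::finite"
  assumes "\<And>i. real_lsc_on (\<Omega> i) (h i)"
  shows "real_lsc_on (strategy_set own \<Omega>) (\<lambda>y. \<Sum>i\<in>UNIV. h i (block own i y))"
  by (intro real_lsc_on_sum real_lsc_on_comp[OF assms continuous_on_block]) (auto simp: strategy_set_def)

lemma convex_on_total_cost:
  fixes own :: "'n::finite \<Rightarrow> 'i::finite"
  assumes "\<And>i. convex_on (\<Omega> i) (h i)"
  shows "convex_on (strategy_set own \<Omega>) (\<lambda>y. \<Sum>i\<in>UNIV. h i (block own i y))"
proof (rule convex_onI)
  show "convex (strategy_set own \<Omega>)"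
    by (intro convex_strategy_set convex_on_imp_convex[OF assms])
  fix t :: real and u v
  assume *: "0 < t" "t < 1" "u \<in> strategy_set own \<Omega>" "v \<in> strategy_set own \<Omega>"
  have "h i (block own i ((1 - t) *\<^sub>R u + t *\<^sub>R v)) \<le> (1 - t) * h i (block own i u) + t * h i (block own i v)" for i
    unfolding block_add block_scaleR
    using * by (intro convex_onD[OF assms[of i]]) (auto simp: strategy_set_def)
  then have "(\<Sum>i\<in>UNIV. h i (block own i ((1 - t) *\<^sub>R u + t *\<^sub>R v)))
      \<le> (\<Sum>i\<in>UNIV. (1 - t) * h i (block own i u) + t * h i (block own i v))"
    by (rule sum_mono)
  then show "(\<Sum>i\<in>UNIV. h i (block own i ((1 - t) *\<^sub>R u + t *\<^sub>R v)))
      \<le> (1 - t) * (\<Sum>i\<in>UNIV. h i (block own i u)) + t * (\<Sum>i\<in>UNIV. h i (block own i v))"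
    by (simp add: sum.distrib sum_distrib_left)
qed

text \<open>
  The real counterpart of \<open>vi_solutions\<close>, for costs that are finite on \<open>K\<close>.
\<close>

definition real_vi_solutions :: "(real ^ 'n) set \<Rightarrow> (real ^ 'n \<Rightarrow> real ^ 'n) \<Rightarrow> (real ^ 'n \<Rightarrow> real) \<Rightarrow> (real ^ 'n) set" where
  "real_vi_solutions K F h = {x \<in> K. \<forall>y\<in>K. 0 \<le> F x \<bullet> (y - x) + h y - h x}"

lemma real_vi_solutions_nonempty:
  fixes own :: "'n::finite \<Rightarrow> 'i::finite"
  assumes Omega: "\<And>i. compact (\<Omega> i)"
    and h: "\<And>i. real_lsc_on (\<Omega> i) (h i)" "\<And>i. convex_on (\<Omega> i) (h i)"
    and slater: "slater own \<Omega> A b" and F: "continuous_on UNIV F"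
  shows "real_vi_solutions (feasible_set own \<Omega> A b) F (\<lambda>y. \<Sum>i\<in>UNIV. h i (block own i y)) \<noteq> {}"
proof -
  let ?K = "feasible_set own \<Omega> A b" and ?Y = "strategy_set own \<Omega>"
  have KY: "?K = ?Y \<inter> {y. \<forall>r. (A *v y) $ r \<le> b $ r}"
    by (auto simp: feasible_set_def less_eq_vec_def)
  have cont: "continuous_on UNIV (\<lambda>y. A *v y)"
    by (rule linear_continuous_on[OF matrix_vector_mul_bounded_linear])
  have "closed {y. \<forall>r. (A *v y) $ r \<le> b $ r}"
    by (intro closed_Collect_all closed_Collect_le continuous_intros continuous_on_component cont)
  then have comp: "compact ?K" unfolding KY by (intro compact_Int_closed compact_strategy_set Omega)
  have "convex {y. \<forall>r. (A *v y) $ r \<le> b $ r}"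
    by (auto simp: convex_def matrix_vector_right_distrib matrix_vector_mult_scaleR intro!: convex_bound_le)
  then have conv: "convex ?K"
    unfolding KY by (intro convex_Int convex_strategy_set convex_on_imp_convex[OF h(2)])
  have ne: "?K \<noteq> {}" using slater unfolding slater_def KY by (force simp: less_imp_le)
  have sub: "?K \<subseteq> ?Y" by (auto simp: feasible_set_def)
  have "\<exists>x\<in>?K. \<forall>u\<in>?K. 0 \<le> F x \<bullet> (u - x) + (\<Sum>i\<in>UNIV. h i (block own i u)) - (\<Sum>i\<in>UNIV. h i (block own i x))"
    by (rule vi_solution_exists[OF comp conv ne])
       (auto intro: real_lsc_on_subset[OF real_lsc_on_total_cost[OF h(1)] sub]
          convex_on_subset[OF convex_on_total_cost[OF h(2)] sub conv] continuous_on_subset[OF F])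
  then show ?thesis by (auto simp: real_vi_solutions_def)
qed

text \<open>
  The algorithm run with gradient estimates \<open>G k\<close>. The point \<open>xt k\<close> stands for the iterate that the exact
  gradient would have produced. The three summability conditions do not mention the solution to which
  distances are measured.
\<close>

lemma forward_backward_path_converges:
  fixes own :: "'n::finite \<Rightarrow> 'i::finite" and A :: "real ^ 'n ^ 'm::finite"
    and h :: "'i \<Rightarrow> real ^ 'n \<Rightarrow> real" and x G xt :: "nat \<Rightarrow> real ^ 'n" and z l :: "nat \<Rightarrow> real ^ 'm ^ 'i"
    and F :: "real ^ 'n \<Rightarrow> real ^ 'n" and \<Omega> :: "'i \<Rightarrow> (real ^ 'n) set" and b :: "real ^ 'm"
  defines "total_cost \<equiv> (\<lambda>y. \<Sum>i\<in>UNIV. h i (block own i y))"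
    and "\<epsilon> \<equiv> (\<lambda>k. G k - F (x k))"
  defines "SOL \<equiv> real_vi_solutions (feasible_set own \<Omega> A b) F total_cost"
  assumes graph: "weighted_connected_graph W" and own: "surj own"
    and Omega: "\<And>i. compact (\<Omega> i)"
    and h: "\<And>i. real_lsc_on (\<Omega> i) (h i)" "\<And>i. convex_on (\<Omega> i) (h i)"
    and b: "b = (\<Sum>i\<in>UNIV. bs i)" and slater: "slater own \<Omega> A b"
    and F_cont: "continuous_on UNIV F"
    and coco: "\<And>y ys. ys \<in> SOL \<Longrightarrow> (F y - F ys) \<bullet> (y - ys) \<ge> \<beta> * (norm (F y - F ys))\<^sup>2"
    and gamma: "0 < \<gamma>"
    and alpha: "\<And>i. 0 < \<alpha> i \<and>
          \<alpha> i \<le> inverse (\<gamma> + (MAX j\<in>{j. own j = i}. \<Sum>r\<in>UNIV. \<bar>transpose (block_columns own A i) $ j $ r\<bar>))"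
    and nu: "\<And>i. 0 < \<nu> i \<and> \<nu> i \<le> inverse (\<gamma> + 2 * wdegree W i)"
    and sigma: "\<And>i. 0 < \<sigma> i \<and>
          \<sigma> i \<le> inverse (\<gamma> + 2 * wdegree W i
            + (MAX r\<in>UNIV. \<Sum>j | own j = i. \<bar>block_columns own A i $ r $ j\<bar>))"
    and \<theta>: "0 < \<theta>" "\<theta> \<le> \<beta>" "2 * max_wdegree W * \<theta> \<le> 1"
    and norm_inv: "matrix_norm (matrix_inv (preconditioner own A W \<alpha> \<nu> \<sigma>)) < 2 * \<theta>"
    and x_step: "\<And>k i. is_prox (\<Omega> i) (\<lambda>u. \<alpha> i * h i u)
        (block own i (x k) - \<alpha> i *\<^sub>R (block own i (G k) + transpose (block_columns own A i) *v (l k $ i)))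
        (block own i (x (Suc k)))"
    and z_step: "\<And>k i. z (Suc k) $ i = z k $ i - \<nu> i *\<^sub>R (\<Sum>j\<in>UNIV. W $ i $ j *\<^sub>R (l k $ i - l k $ j))"
    and l_step: "\<And>k i. l (Suc k) $ i = closest_point {u. 0 \<le> u}
              (l k $ i
                + \<sigma> i *\<^sub>R (block_columns own A i *v (2 *\<^sub>R block own i (x (Suc k)) - block own i (x k)) - bs i)
                + \<sigma> i *\<^sub>R (\<Sum>j\<in>UNIV. W $ i $ j *\<^sub>R (2 *\<^sub>R (z (Suc k) $ i - z (Suc k) $ j) - (z k $ i - z k $ j)))
                - \<sigma> i *\<^sub>R (\<Sum>j\<in>UNIV. W $ i $ j *\<^sub>R (l k $ i - l k $ j)))"
    and near: "\<And>k. norm (x (Suc k) - xt k) \<le> C * norm (\<epsilon> k)"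
    and summ: "summable (\<lambda>k. (norm (\<epsilon> k))\<^sup>2)" "summable (\<lambda>k. \<epsilon> k \<bullet> xt k)" "\<And>j. summable (\<lambda>k. \<epsilon> k $ j)"
  shows "\<exists>xs\<in>SOL. x \<longlonglongrightarrow> xs"
proof -
  let ?Y = "strategy_set own \<Omega>"
  let ?B = "kkt_operator own A W ?Y total_cost"
  let ?C = "forward_map W F bs :: ('n, 'm, 'i) state \<Rightarrow> _"
  let ?\<Phi> = "metric_operator own A W \<alpha> \<nu> \<sigma>"
  let ?\<kappa> = "matrix_norm (matrix_inv (preconditioner own A W \<alpha> \<nu> \<sigma>))"
  let ?Z = "{v. (v, - ?C v) \<in> ?B}"
  let ?w = "\<lambda>k. (x k, z k, l k)"
  let ?e = "\<lambda>k. (\<epsilon> k, 0, 0) :: ('n, 'm, 'i) state"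
  let ?\<delta> = "\<lambda>(vs :: ('n, 'm, 'i) state) k. C * (norm (\<epsilon> k))\<^sup>2 - \<epsilon> k \<bullet> xt k + \<epsilon> k \<bullet> fst vs"
  have Y: "compact ?Y" "convex ?Y"
    by (intro compact_strategy_set Omega convex_strategy_set convex_on_imp_convex[OF h(2)])+
  have total_cost_props: "real_lsc_on ?Y total_cost" "convex_on ?Y total_cost"
    unfolding total_cost_def by (intro real_lsc_on_total_cost convex_on_total_cost h)+
  have Z_SOL: "fst v \<in> SOL" if "v \<in> ?Z" for v
  proof -
    obtain xv zv lv where v: "v = (xv, zv, lv)" by (metis surj_pair)
    from zero_imp_vi[OF graph _ b, of xv zv lv F own A ?Y total_cost] that show ?thesis
      by (auto simp: v SOL_def real_vi_solutions_def feasible_set_def)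
  qed
  obtain y0 where y0: "y0 \<in> ?Y" "\<And>r. (A *v y0) $ r < b $ r" using slater unfolding slater_def by blast
  have Z_ne: "?Z \<noteq> {}"
  proof -
    obtain xs where "xs \<in> SOL"
      using real_vi_solutions_nonempty[OF Omega h slater F_cont] unfolding SOL_def total_cost_def by blast
    then have "\<exists>z l. ((xs, z, l), - ?C (xs, z, l)) \<in> ?B"
      by (intro vi_imp_zero[OF graph Y(2) total_cost_props(2) b _ _ _ y0])
         (auto simp: SOL_def real_vi_solutions_def feasible_set_def)
    then show ?thesis by blast
  qed
  have "\<exists>wb\<in>?Z. ?w \<longlonglongrightarrow> wb"
  proof (rule preconditioned_forward_backward_converges[where \<Phi> = ?\<Phi> and \<kappa> = ?\<kappa> and \<theta> = \<theta> and B = ?B and e = ?e and \<delta> = ?\<delta>])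
    show "linear ?\<Phi>" by (rule linear_metric_operator)
    show "?\<Phi> u \<bullet> v = u \<bullet> ?\<Phi> v" for u v
      by (rule metric_operator_self_adjoint[OF graph own gamma alpha nu sigma])
    show "0 < ?\<kappa>" "(norm v)\<^sup>2 \<le> ?\<kappa> * (?\<Phi> v \<bullet> v)" for v
      using norm_le_metric_operator[OF graph own gamma alpha nu sigma] by blast+
    show "?\<kappa> < 2 * \<theta>" by fact
    show "0 \<le> (u' - v') \<bullet> (u - v)" if "(u, u') \<in> ?B" "(v, v') \<in> ?B" for u u' v v'
      by (rule kkt_operator_monotone[OF graph that])
    show "closed ?B"
      by (rule kkt_operator_closed[OF graph compact_imp_closed[OF Y(1)] total_cost_props(1)])
    show "continuous_on UNIV ?C"
    proof -
      have G: "continuous_on UNIV (\<lambda>p :: ('n, 'm, 'i) state. graph_laplacian W (snd (snd p)))"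
        by (rule continuous_on_compose2[OF linear_continuous_on[OF linear_conv_bounded_linear[THEN iffD1, OF linear_graph_laplacian]], of UNIV])
           (auto intro!: continuous_intros)
      show ?thesis unfolding forward_map_def case_prod_beta'
        by (intro continuous_intros G continuous_on_compose2[OF F_cont]) auto
    qed
    show "\<theta> * (norm (?C v - ?C vs))\<^sup>2 \<le> (?C v - ?C vs) \<bullet> (v - vs)" if "vs \<in> ?Z" for v vs
    proof -
      obtain xv zv lv where v: "v = (xv, zv, lv)" by (metis surj_pair)
      obtain xs zs ls where vs: "vs = (xs, zs, ls)" by (metis surj_pair)
      have "xs \<in> SOL" using Z_SOL[OF that] by (simp add: vs)
      then show ?thesis unfolding v vs
        by (intro forward_map_cocoercive[OF graph \<theta>] coco)
    qed
    show "?Z \<noteq> {}" by (rule Z_ne)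
    show "(?w (Suc k), ?\<Phi> (?w k - ?w (Suc k)) - ?C (?w k) - ?e k) \<in> ?B" for k
      unfolding \<epsilon>_def total_cost_def
      by (rule step_in_kkt_operator[OF graph _ _ _ x_step z_step l_step]) (use alpha nu sigma in auto)
    show "?e \<longlonglongrightarrow> 0"
    proof -
      have "(\<lambda>k. (norm (\<epsilon> k))\<^sup>2) \<longlonglongrightarrow> 0" using summ(1) by (rule summable_LIMSEQ_zero)
      then have "\<epsilon> \<longlonglongrightarrow> 0" by (simp add: tendsto_norm_zero_iff)
      then have "(\<lambda>k. (\<epsilon> k, 0, 0) :: ('n, 'm, 'i) state) \<longlonglongrightarrow> (0, 0, 0)" by (intro tendsto_intros)
      then show ?thesis by (simp add: zero_prod_def)
    qed
    show "- ?\<delta> vs k \<le> ?e k \<bullet> (?w (Suc k) - vs)" if "vs \<in> ?Z" for vs k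
    proof -
      have "?e k \<bullet> (?w (Suc k) - vs) = \<epsilon> k \<bullet> (x (Suc k) - fst vs)" by (simp add: inner_prod_def)
      also have "\<dots> = \<epsilon> k \<bullet> (x (Suc k) - xt k) + \<epsilon> k \<bullet> xt k - \<epsilon> k \<bullet> fst vs" by (simp add: inner_diff_right)
      moreover have "- (C * (norm (\<epsilon> k))\<^sup>2) \<le> \<epsilon> k \<bullet> (x (Suc k) - xt k)"
      proof -
        have "\<bar>\<epsilon> k \<bullet> (x (Suc k) - xt k)\<bar> \<le> norm (\<epsilon> k) * norm (x (Suc k) - xt k)" by (rule Cauchy_Schwarz_ineq2)
        also have "\<dots> \<le> norm (\<epsilon> k) * (C * norm (\<epsilon> k))" by (intro mult_left_mono near) simp
        also have "\<dots> = C * (norm (\<epsilon> k))\<^sup>2" by (simp add: power2_eq_square)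
        finally show ?thesis by simp
      qed
      ultimately show ?thesis by simp
    qed
    show "summable (?\<delta> vs)" if "vs \<in> ?Z" for vs
    proof -
      have "summable (\<lambda>k. \<epsilon> k \<bullet> fst vs)"
        unfolding inner_vec_def by (intro summable_sum) (simp add: summ(3) summable_mult2)
      then show ?thesis by (intro summable_add summable_diff summable_mult summ(1,2))
    qed
  qed
  then obtain wb where wb: "wb \<in> ?Z" "?w \<longlonglongrightarrow> wb" by blast
  have "x \<longlonglongrightarrow> fst wb" using tendsto_fst[OF wb(2)] by simp
  then show ?thesis using Z_SOL[OF wb(1)] by blast
qed

section \<open>Convergence of square-integrable martingales\<close>

lemma integrable_mult_if_square_integrable:
  fixes u v :: "'w \<Rightarrow> real"
  assumes "u \<in> borel_measurable M" "v \<in> borel_measurable M"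
    and "integrable M (\<lambda>\<omega>. (u \<omega>)\<^sup>2)" "integrable M (\<lambda>\<omega>. (v \<omega>)\<^sup>2)"
  shows "integrable M (\<lambda>\<omega>. u \<omega> * v \<omega>)"
proof (rule Bochner_Integration.integrable_bound)
  show "integrable M (\<lambda>\<omega>. (u \<omega>)\<^sup>2 + (v \<omega>)\<^sup>2)" using assms by simp
  show "AE \<omega> in M. norm (u \<omega> * v \<omega>) \<le> norm ((u \<omega>)\<^sup>2 + (v \<omega>)\<^sup>2)"
  proof (rule AE_I2)
    fix \<omega>
    have "0 \<le> (\<bar>u \<omega>\<bar> - \<bar>v \<omega>\<bar>)\<^sup>2" by simp
    also have "\<dots> = (u \<omega>)\<^sup>2 + (v \<omega>)\<^sup>2 - 2 * (\<bar>u \<omega>\<bar> * \<bar>v \<omega>\<bar>)" by (simp add: power2_diff)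
    moreover have "0 \<le> \<bar>u \<omega>\<bar> * \<bar>v \<omega>\<bar>" by simp
    ultimately have "\<bar>u \<omega>\<bar> * \<bar>v \<omega>\<bar> \<le> (u \<omega>)\<^sup>2 + (v \<omega>)\<^sup>2" by linarith
    then show "norm (u \<omega> * v \<omega>) \<le> norm ((u \<omega>)\<^sup>2 + (v \<omega>)\<^sup>2)" by (simp add: abs_mult)
  qed
qed (use assms in simp)

text \<open>
  Being a martingale difference is expressed by orthogonality to the square-integrable functions of the
  past, the only form in which it is used and the form in which independence provides it.
\<close>

locale square_integrable_martingale_difference = prob_space M for M :: "'w measure" +
  fixes G :: "nat \<Rightarrow> 'w measure" and D :: "nat \<Rightarrow> 'w \<Rightarrow> real"
  assumes sub: "subalgebra M (G n)" and filt: "subalgebra (G (Suc n)) (G n)"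
    and adapted: "D n \<in> borel_measurable (G (Suc n))"
    and sq: "integrable M (\<lambda>\<omega>. (D n \<omega>)\<^sup>2)"
    and orth: "h \<in> borel_measurable (G n) \<Longrightarrow> integrable M (\<lambda>\<omega>. (h \<omega>)\<^sup>2) \<Longrightarrow>
                 (\<integral>\<omega>. h \<omega> * D n \<omega> \<partial>M) = 0"
begin

lemma filt_le: "m \<le> n \<Longrightarrow> subalgebra (G n) (G m)"
proof (induction rule: dec_induct)
  case base then show ?case by (simp add: subalgebra_def)
next
  case (step n) then show ?case using filt[of n] unfolding subalgebra_def by blast
qed

lemma D_measurable_G: "k < n \<Longrightarrow> D k \<in> borel_measurable (G n)"
  by (rule measurable_from_subalg[OF filt_le adapted]) simp

lemma D_measurable [measurable]: "D k \<in> borel_measurable M"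
  using measurable_from_subalg[OF sub adapted] .

lemma partial_sum_measurable: "k \<le> n \<Longrightarrow> (\<lambda>\<omega>. \<Sum>j<k. D j \<omega>) \<in> borel_measurable (G n)"
  by (intro borel_measurable_sum D_measurable_G) auto

text \<open>
  Kolmogorov's inequality. The sum \<open>U\<close>, stopped when \<open>\<bar>T\<bar>\<close> first reaches \<open>\<epsilon>\<close>, has orthogonal increments
  no larger than those of \<open>T\<close>, and it remains at distance \<open>\<epsilon>\<close> or more from 0 once \<open>T\<close> has been there.
\<close>

lemma maximal_inequality:
  assumes eps: "0 < \<epsilon>"
  shows "prob {\<omega> \<in> space M. \<exists>k\<le>n. \<epsilon> \<le> \<bar>\<Sum>j<k. D j \<omega>\<bar>} \<le> (\<Sum>j<n. \<integral>\<omega>. (D j \<omega>)\<^sup>2 \<partial>M) / \<epsilon>\<^sup>2"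
proof -
  define T where "T k \<omega> = (\<Sum>j<k. D j \<omega>)" for k \<omega>
  define B where "B k \<omega> \<longleftrightarrow> (\<forall>j\<le>k. \<bar>T j \<omega>\<bar> < \<epsilon>)" for k \<omega>
  define c where "c k \<omega> = (if B k \<omega> then 1 else 0 :: real)" for k \<omega>
  define U where "U k \<omega> = (\<Sum>j<k. c j \<omega> * D j \<omega>)" for k \<omega>
  have cG: "c k \<in> borel_measurable (G k)" for k
  proof -
    have "T j \<in> borel_measurable (G k)" if "j \<le> k" for j
      unfolding T_def by (rule partial_sum_measurable[OF that])
    then have "(\<Inter>j\<in>{..k}. {\<omega> \<in> space (G k). \<bar>T j \<omega>\<bar> < \<epsilon>}) \<in> sets (G k)"
      by (intro sets.finite_INT) auto
    also have "(\<Inter>j\<in>{..k}. {\<omega> \<in> space (G k). \<bar>T j \<omega>\<bar> < \<epsilon>}) = {\<omega> \<in> space (G k). B k \<omega>}"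
      by (auto simp: B_def)
    finally have [measurable]: "Measurable.pred (G k) (B k)" by (simp add: pred_def)
    show ?thesis unfolding c_def by measurable
  qed
  have cGn: "c k \<in> borel_measurable (G n)" if "k \<le> n" for k n
    using measurable_from_subalg[OF filt_le[OF that] cG] .
  have UG: "U k \<in> borel_measurable (G k)" for k
    unfolding U_def by (intro borel_measurable_sum borel_measurable_times cGn D_measurable_G) auto
  note cM [measurable] = measurable_from_subalg[OF sub cG]
  note UM [measurable] = measurable_from_subalg[OF sub UG]
  have c01: "(c k \<omega>)\<^sup>2 = c k \<omega>" "0 \<le> c k \<omega>" "c k \<omega> \<le> 1" for k \<omega> by (simp_all add: c_def)
  have cD: "integrable M (\<lambda>\<omega>. (c k \<omega> * D k \<omega>)\<^sup>2)" for k
    by (rule Bochner_Integration.integrable_bound[OF sq[of k]])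
       (auto simp: power_mult_distrib c01 mult_left_le_one_le)
  have UU: "integrable M (\<lambda>\<omega>. (U k \<omega>)\<^sup>2) \<and> (\<integral>\<omega>. (U k \<omega>)\<^sup>2 \<partial>M) \<le> (\<Sum>j<k. \<integral>\<omega>. (D j \<omega>)\<^sup>2 \<partial>M)" for k
  proof (induction k)
    case 0 then show ?case by (simp add: U_def)
  next
    case (Suc k)
    have iU: "integrable M (\<lambda>\<omega>. (U k \<omega>)\<^sup>2)" using Suc by simp
    have icU: "integrable M (\<lambda>\<omega>. (c k \<omega> * U k \<omega>)\<^sup>2)"
      by (rule Bochner_Integration.integrable_bound[OF iU])
         (auto simp: power_mult_distrib c01 mult_left_le_one_le)
    have icross: "integrable M (\<lambda>\<omega>. (c k \<omega> * U k \<omega>) * D k \<omega>)"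
      by (rule integrable_mult_if_square_integrable[OF _ _ icU sq]) measurable
    have cross: "(\<integral>\<omega>. (c k \<omega> * U k \<omega>) * D k \<omega> \<partial>M) = 0"
      by (rule orth[OF borel_measurable_times[OF cG UG] icU])
    have eq: "(U (Suc k) \<omega>)\<^sup>2 = ((U k \<omega>)\<^sup>2 + 2 * ((c k \<omega> * U k \<omega>) * D k \<omega>)) + (c k \<omega> * D k \<omega>)\<^sup>2" for \<omega>
      by (simp add: U_def power2_sum)
    have "(\<integral>\<omega>. (c k \<omega> * D k \<omega>)\<^sup>2 \<partial>M) \<le> (\<integral>\<omega>. (D k \<omega>)\<^sup>2 \<partial>M)"
      by (intro integral_mono cD sq) (simp add: power_mult_distrib c01 mult_left_le_one_le)
    then show ?case unfolding eq using Suc iU icross cD[of k] cross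
      by (subst Bochner_Integration.integral_add) auto
  qed
  have path: "(B k \<omega> \<and> U k \<omega> = T k \<omega>) \<or> (\<not> B k \<omega> \<and> \<epsilon> \<le> \<bar>U k \<omega>\<bar>)" for k \<omega>
  proof (induction k)
    case 0 then show ?case using eps by (simp add: B_def T_def U_def)
  next
    case (Suc k)
    have BS: "B (Suc k) \<omega> \<longleftrightarrow> B k \<omega> \<and> \<bar>T (Suc k) \<omega>\<bar> < \<epsilon>" by (auto simp: B_def le_Suc_eq)
    have US: "U (Suc k) \<omega> = U k \<omega> + c k \<omega> * D k \<omega>" by (simp add: U_def)
    have TS: "T (Suc k) \<omega> = T k \<omega> + D k \<omega>" by (simp add: T_def)
    show ?case using Suc BS US TS by (auto simp: c_def)
  qed
  have "{\<omega> \<in> space M. \<exists>k\<le>n. \<epsilon> \<le> \<bar>\<Sum>j<k. D j \<omega>\<bar>} \<subseteq> {\<omega> \<in> space M. \<epsilon>\<^sup>2 \<le> (U n \<omega>)\<^sup>2}"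
  proof
    fix \<omega> assume *: "\<omega> \<in> {\<omega> \<in> space M. \<exists>k\<le>n. \<epsilon> \<le> \<bar>\<Sum>j<k. D j \<omega>\<bar>}"
    then have "\<not> B n \<omega>" unfolding B_def T_def by force
    then have "\<epsilon> \<le> \<bar>U n \<omega>\<bar>" using path by blast
    then have "\<epsilon>\<^sup>2 \<le> (U n \<omega>)\<^sup>2" using eps by (metis abs_le_square_iff abs_of_pos)
    then show "\<omega> \<in> {\<omega> \<in> space M. \<epsilon>\<^sup>2 \<le> (U n \<omega>)\<^sup>2}" using * by simp
  qed
  then have "prob {\<omega> \<in> space M. \<exists>k\<le>n. \<epsilon> \<le> \<bar>\<Sum>j<k. D j \<omega>\<bar>} \<le> prob {\<omega> \<in> space M. \<epsilon>\<^sup>2 \<le> (U n \<omega>)\<^sup>2}"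
    by (intro finite_measure_mono) measurable
  also have "\<dots> \<le> (\<integral>\<omega>. (U n \<omega>)\<^sup>2 \<partial>M) / \<epsilon>\<^sup>2"
    using UU[of n] eps by (intro integral_Markov_inequality_measure[where A = "{}"]) auto
  also have "\<dots> \<le> (\<Sum>j<n. \<integral>\<omega>. (D j \<omega>)\<^sup>2 \<partial>M) / \<epsilon>\<^sup>2"
    using UU[of n] by (intro divide_right_mono) auto
  finally show ?thesis .
qed

lemma shift: "square_integrable_martingale_difference M (\<lambda>n. G (m + n)) (\<lambda>n. D (m + n))"
  by unfold_locales (use sub filt adapted sq orth in auto)

text \<open>
  By the maximal inequality, the probability that the sums oscillate by \<open>\<epsilon>\<close> after time \<open>m\<close> tends to 0 as
  \<open>m\<close> grows; so almost surely the partial sums are Cauchy.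
\<close>

lemma AE_summable:
  assumes summ: "summable (\<lambda>n. \<integral>\<omega>. (D n \<omega>)\<^sup>2 \<partial>M)"
  shows "AE \<omega> in M. summable (\<lambda>n. D n \<omega>)"
proof -
  define v where "v n = (\<integral>\<omega>. (D n \<omega>)\<^sup>2 \<partial>M)" for n
  have v0: "0 \<le> v n" for n by (simp add: v_def)
  define E where "E \<epsilon> m n = {\<omega> \<in> space M. \<exists>k\<le>n. \<epsilon> \<le> \<bar>\<Sum>j<k. D (m + j) \<omega>\<bar>}" for \<epsilon> m n
  have E_sets [measurable]: "E \<epsilon> m n \<in> sets M" for \<epsilon> m n unfolding E_def by measurable
  have tail: "prob (\<Union>n. E \<epsilon> m n) \<le> (\<Sum>j. v (m + j)) / \<epsilon>\<^sup>2" if "0 < \<epsilon>" for \<epsilon> m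
  proof (rule LIMSEQ_le_const2)
    show "(\<lambda>n. prob (E \<epsilon> m n)) \<longlonglongrightarrow> prob (\<Union>n. E \<epsilon> m n)"
      by (rule finite_Lim_measure_incseq) (auto simp: incseq_def E_def intro: order_trans)
    have sm: "summable (\<lambda>j. v (m + j))" using summ summable_iff_shift[of v m] unfolding v_def by (simp add: add.commute)
    have "prob (E \<epsilon> m n) \<le> (\<Sum>j. v (m + j)) / \<epsilon>\<^sup>2" for n
    proof -
      interpret s: square_integrable_martingale_difference M "\<lambda>n. G (m + n)" "\<lambda>n. D (m + n)" by (rule shift)
      have "prob (E \<epsilon> m n) \<le> (\<Sum>j<n. v (m + j)) / \<epsilon>\<^sup>2"
        unfolding E_def v_def by (rule s.maximal_inequality[OF that])
      also have "\<dots> \<le> (\<Sum>j. v (m + j)) / \<epsilon>\<^sup>2"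
        by (intro divide_right_mono sum_le_suminf sm) (auto simp: v0)
      finally show ?thesis .
    qed
    then show "\<exists>N. \<forall>n\<ge>N. prob (E \<epsilon> m n) \<le> (\<Sum>j. v (m + j)) / \<epsilon>\<^sup>2" by blast
  qed
  have null: "(\<Inter>m. \<Union>n. E \<epsilon> m n) \<in> null_sets M" if e: "0 < \<epsilon>" for \<epsilon>
  proof -
    have "(\<lambda>m. (\<Sum>j. v (j + m)) / \<epsilon>\<^sup>2) \<longlonglongrightarrow> 0 / \<epsilon>\<^sup>2"
      by (intro tendsto_divide suminf_exist_split2) (use summ e in \<open>auto simp: v_def\<close>)
    then have lim: "(\<lambda>m. (\<Sum>j. v (m + j)) / \<epsilon>\<^sup>2) \<longlonglongrightarrow> 0" by (simp add: add.commute)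
    have "prob (\<Inter>m. \<Union>n. E \<epsilon> m n) \<le> (\<Sum>j. v (m + j)) / \<epsilon>\<^sup>2" for m
      by (rule order_trans[OF finite_measure_mono tail[OF e]]) auto
    then have "prob (\<Inter>m. \<Union>n. E \<epsilon> m n) \<le> 0"
      using LIMSEQ_le_const[OF lim] by blast
    then have "prob (\<Inter>m. \<Union>n. E \<epsilon> m n) = 0" by (simp add: measure_le_0_iff)
    then show ?thesis by (intro null_setsI) (auto simp: emeasure_eq_measure)
  qed
  have "AE \<omega> in M. \<forall>i::nat. \<omega> \<notin> (\<Inter>m. \<Union>n. E (inverse (real (Suc i))) m n)"
    unfolding AE_all_countable by (intro allI AE_not_in null) simp
  moreover have "AE \<omega> in M. \<omega> \<in> space M" by simp
  ultimately show ?thesis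
  proof eventually_elim
    case (elim \<omega>)
    show ?case unfolding summable_Cauchy
    proof (intro allI impI)
      fix e :: real assume "0 < e"
      then obtain i where i: "inverse (real (Suc i)) < e / 2" using reals_Archimedean[of "e / 2"] by auto
      obtain m where m: "\<And>n. \<omega> \<notin> E (inverse (real (Suc i))) m n" using elim(1) by blast
      have small: "\<bar>\<Sum>j<k. D (m + j) \<omega>\<bar> < e / 2" for k
        using m[of k] i elim(2) unfolding E_def by force
      have "norm (\<Sum>j=a..<b. D j \<omega>) < e" if a: "m \<le> a" for a b
      proof (cases "a \<le> b")
        case True
        have sh: "(\<Sum>j<k. D (m + j) \<omega>) = (\<Sum>j=m..<m+k. D j \<omega>)" for k
          using sum.shift_bounds_nat_ivl[of "\<lambda>j. D j \<omega>" 0 m k] by (simp add: add.commute lessThan_atLeast0)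
        have "(\<Sum>j=a..<b. D j \<omega>) = (\<Sum>j=m..<b. D j \<omega>) - (\<Sum>j=m..<a. D j \<omega>)"
          using sum.atLeastLessThan_concat[of m a b "\<lambda>j. D j \<omega>"] a True by simp
        also have "\<dots> = (\<Sum>j<b-m. D (m + j) \<omega>) - (\<Sum>j<a-m. D (m + j) \<omega>)"
          unfolding sh using a True by simp
        finally show ?thesis using small[of "b - m"] small[of "a - m"] unfolding real_norm_def by linarith
      qed (use \<open>0 < e\<close> in simp)
      then show "\<exists>N. \<forall>a\<ge>N. \<forall>b. norm (\<Sum>j=a..<b. D j \<omega>) < e" by blast
    qed
  qed
qed

end

lemma AE_summable_if_integrals_summable:
  fixes f :: "nat \<Rightarrow> 'w \<Rightarrow> real"
  assumes int: "\<And>n. integrable M (f n)" and nn: "\<And>n \<omega>. 0 \<le> f n \<omega>"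
    and summ: "summable (\<lambda>n. \<integral>\<omega>. f n \<omega> \<partial>M)"
  shows "AE \<omega> in M. summable (\<lambda>n. f n \<omega>)"
proof -
  have [measurable]: "f n \<in> borel_measurable M" for n using int by blast
  have "(\<integral>\<^sup>+\<omega>. (\<Sum>n. ennreal (f n \<omega>)) \<partial>M) = (\<Sum>n. \<integral>\<^sup>+\<omega>. ennreal (f n \<omega>) \<partial>M)"
    by (rule nn_integral_suminf) measurable
  also have "\<dots> = (\<Sum>n. ennreal (\<integral>\<omega>. f n \<omega> \<partial>M))"
    by (intro suminf_cong nn_integral_eq_integral int) (auto simp: nn)
  also have "\<dots> = ennreal (\<Sum>n. \<integral>\<omega>. f n \<omega> \<partial>M)"
    by (rule suminf_ennreal2[OF _ summ]) (simp add: nn)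
  finally have "(\<integral>\<^sup>+\<omega>. (\<Sum>n. ennreal (f n \<omega>)) \<partial>M) \<noteq> \<infinity>" by simp
  then have "AE \<omega> in M. (\<Sum>n. ennreal (f n \<omega>)) \<noteq> \<infinity>"
    by (intro nn_integral_PInf_AE) auto
  then show ?thesis
    by eventually_elim (auto intro!: summable_suminf_not_top simp: nn)
qed

section \<open>Independence of past and present samples\<close>

text \<open>
  The joint law of \<open>(\<omega>, X \<omega>)\<close> on \<open>N \<Otimes>\<^sub>M R\<close> is a product measure, so Fubini's theorem integrates out the
  sample first. Independence is stated for families of events because the past is given
  as a \<open>\<sigma>\<close>-algebra.
\<close>

lemma (in prob_space) expectation_independent_pair:
  fixes \<Phi> :: "'a \<times> 's \<Rightarrow> real"
  assumes N: "subalgebra M N" and X [measurable]: "X \<in> measurable M R"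
    and ind: "indep_set (sets N) {X -` C \<inter> space M | C. C \<in> sets R}"
    and \<Phi> [measurable]: "\<Phi> \<in> borel_measurable (N \<Otimes>\<^sub>M R)"
  shows "(\<integral>\<^sup>+\<omega>. ennreal (\<Phi> (\<omega>, X \<omega>)) \<partial>M) = (\<integral>\<^sup>+\<omega>. \<integral>\<^sup>+q. ennreal (\<Phi> (\<omega>, q)) \<partial>distr M R X \<partial>M)" (is ?nn)
    and "integrable M (\<lambda>\<omega>. \<Phi> (\<omega>, X \<omega>)) \<Longrightarrow> (\<integral>\<omega>. \<Phi> (\<omega>, X \<omega>) \<partial>M) = (\<integral>\<omega>. \<integral>q. \<Phi> (\<omega>, q) \<partial>distr M R X \<partial>M)"
proof -
  have [measurable]: "(\<lambda>\<omega>. \<omega>) \<in> measurable M N"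
    using N by (auto simp: measurable_def subalgebra_def sets.Int_space_eq2)
  define P where "P = distr M N (\<lambda>\<omega>. \<omega>)"
  define Q where "Q = distr M R X"
  have sets_PQ [measurable_cong]: "sets P = sets N" "sets Q = sets R" by (simp_all add: P_def Q_def)
  interpret P: prob_space P unfolding P_def by (rule prob_space_distr) measurable
  interpret Q: prob_space Q unfolding Q_def by (rule prob_space_distr) measurable
  interpret PQ: pair_sigma_finite P Q ..
  have joint: "distr M (N \<Otimes>\<^sub>M R) (\<lambda>\<omega>. (\<omega>, X \<omega>)) = P \<Otimes>\<^sub>M Q"
  proof (rule pair_measure_eqI[symmetric])
    fix A B assume "A \<in> sets P" "B \<in> sets Q"
    then have AB [measurable]: "A \<in> sets N" "B \<in> sets R" by (auto simp: sets_PQ)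
    have A: "A \<subseteq> space M" "A \<in> sets M"
      using sets.sets_into_space[OF AB(1)] AB(1) N by (auto simp: subalgebra_def)
    have "emeasure P A * emeasure Q B = ennreal (prob A * prob (X -` B \<inter> space M))"
      using A by (simp add: P_def Q_def emeasure_distr emeasure_eq_measure Int_absorb2 ennreal_mult)
    also have "prob A * prob (X -` B \<inter> space M) = prob (A \<inter> (X -` B \<inter> space M))"
      by (rule indep_setD[OF ind AB(1), symmetric]) (use AB(2) in blast)
    also have "A \<inter> (X -` B \<inter> space M) = (\<lambda>\<omega>. (\<omega>, X \<omega>)) -` (A \<times> B) \<inter> space M" using A by auto
    finally show "emeasure P A * emeasure Q B = emeasure (distr M (N \<Otimes>\<^sub>M R) (\<lambda>\<omega>. (\<omega>, X \<omega>))) (A \<times> B)"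
      by (simp add: emeasure_distr emeasure_eq_measure)
  next
    show "sets (P \<Otimes>\<^sub>M Q) = sets (distr M (N \<Otimes>\<^sub>M R) (\<lambda>\<omega>. (\<omega>, X \<omega>)))"
      using sets_pair_measure_cong[OF sets_PQ] by simp
  qed unfold_locales
  have \<Phi>PQ: "\<Phi> \<in> borel_measurable (P \<Otimes>\<^sub>M Q)"
    using \<Phi> measurable_cong_sets[OF sets_pair_measure_cong[OF sets_PQ] refl] by blast
  have "(\<integral>\<^sup>+\<omega>. ennreal (\<Phi> (\<omega>, X \<omega>)) \<partial>M) = (\<integral>\<^sup>+z. ennreal (\<Phi> z) \<partial>(P \<Otimes>\<^sub>M Q))"
    unfolding joint[symmetric] by (subst nn_integral_distr) auto
  also have "\<dots> = (\<integral>\<^sup>+\<omega>. \<integral>\<^sup>+q. ennreal (\<Phi> (\<omega>, q)) \<partial>Q \<partial>P)"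
    by (rule Q.nn_integral_fst[symmetric]) measurable
  also have "\<dots> = (\<integral>\<^sup>+\<omega>. \<integral>\<^sup>+q. ennreal (\<Phi> (\<omega>, q)) \<partial>Q \<partial>M)"
    unfolding P_def by (subst nn_integral_distr) measurable
  finally show ?nn by (simp add: Q_def)
  assume int: "integrable M (\<lambda>\<omega>. \<Phi> (\<omega>, X \<omega>))"
  have intPQ: "integrable (P \<Otimes>\<^sub>M Q) \<Phi>"
    unfolding joint[symmetric] by (subst integrable_distr_eq) (use int in auto)
  have "(\<integral>\<omega>. \<Phi> (\<omega>, X \<omega>) \<partial>M) = (\<integral>z. \<Phi> z \<partial>(P \<Otimes>\<^sub>M Q))"
    unfolding joint[symmetric] by (subst integral_distr) auto
  also have "\<dots> = (\<integral>\<omega>. \<integral>q. \<Phi> (\<omega>, q) \<partial>Q \<partial>P)"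
    by (rule PQ.integral_fst'[symmetric, OF intPQ])
  also have "\<dots> = (\<integral>\<omega>. \<integral>q. \<Phi> (\<omega>, q) \<partial>Q \<partial>M)"
    unfolding P_def by (subst integral_distr) (auto intro!: Q.borel_measurable_lebesgue_integral)
  finally show "(\<integral>\<omega>. \<Phi> (\<omega>, X \<omega>) \<partial>M) = (\<integral>\<omega>. \<integral>q. \<Phi> (\<omega>, q) \<partial>distr M R X \<partial>M)" by (simp add: Q_def)
qed

locale iid_sampling = prob_space M for M :: "'w measure" +
  fixes init :: "'w \<Rightarrow> 'a::topological_space" and I :: "'k set"
    and X :: "'k \<Rightarrow> 'w \<Rightarrow> 's::topological_space" and Q :: "'s measure"
  assumes init: "init \<in> borel_measurable M"
    and indep: "indep_vars (\<lambda>_. borel) X I"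
    and init_indep: "indep_set (sets (vimage_algebra (space M) init borel))
         (sets (vimage_algebra (space M) (\<lambda>\<omega>. \<lambda>i\<in>I. X i \<omega>) (Pi\<^sub>M I (\<lambda>_. borel))))"
    and law: "i \<in> I \<Longrightarrow> distr M borel (X i) = Q"
begin

text \<open>
  The \<open>\<sigma>\<close>-algebra generated by the initial data and the samples with index in \<open>J\<close>.
\<close>

definition past :: "'k set \<Rightarrow> 'w measure" where
  "past J = vimage_algebra (space M) (\<lambda>\<omega>. (init \<omega>, \<lambda>i\<in>J. X i \<omega>)) (borel \<Otimes>\<^sub>M Pi\<^sub>M J (\<lambda>_. borel))"

lemma X_measurable: "i \<in> I \<Longrightarrow> X i \<in> borel_measurable M"
  using indep unfolding indep_vars_def by auto

lemma space_past [simp]: "space (past J) = space M" by (simp add: past_def)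

lemma init_measurable_past: "init \<in> borel_measurable (past J)"
  and X_measurable_past: "i \<in> J \<Longrightarrow> X i \<in> borel_measurable (past J)"
proof -
  have V: "(\<lambda>\<omega>. (init \<omega>, \<lambda>i\<in>J. X i \<omega>)) \<in> measurable (past J) (borel \<Otimes>\<^sub>M Pi\<^sub>M J (\<lambda>_. borel))"
    unfolding past_def by (rule measurable_vimage_algebra1) (auto simp: space_pair_measure space_PiM)
  show "init \<in> borel_measurable (past J)"
    using measurable_compose[OF V measurable_fst] by simp
  show "i \<in> J \<Longrightarrow> X i \<in> borel_measurable (past J)"
    using measurable_compose[OF measurable_compose[OF V measurable_snd] measurable_component_singleton[of i J]]
    by simp
qed

lemma past_le:
  assumes "space N = space M" "init \<in> borel_measurable N" "\<And>i. i \<in> J \<Longrightarrow> X i \<in> borel_measurable N"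
  shows "subalgebra N (past J)"
proof -
  have "(\<lambda>\<omega>. (init \<omega>, \<lambda>i\<in>J. X i \<omega>)) \<in> measurable N (borel \<Otimes>\<^sub>M Pi\<^sub>M J (\<lambda>_. borel))"
    by (intro measurable_Pair measurable_restrict assms) auto
  then have "(\<lambda>\<omega>. \<omega>) \<in> measurable N (past J)"
    unfolding past_def by (intro measurable_vimage_algebra2) (use assms(1) in auto)
  then have id: "(\<lambda>\<omega>. \<omega>) -` A \<inter> space N \<in> sets N" if "A \<in> sets (past J)" for A
    using that by (rule measurable_sets)
  have "A \<in> sets N" if "A \<in> sets (past J)" for A
    using id[OF that] sets.sets_into_space[OF that] assms(1) by (simp add: Int_absorb2)
  then have "sets (past J) \<subseteq> sets N" by blast
  then show ?thesis using assms(1) by (simp add: subalgebra_def)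
qed

lemma past_subalgebra: "J \<subseteq> I \<Longrightarrow> subalgebra M (past J)"
  by (intro past_le init X_measurable) auto

lemma past_mono: "J \<subseteq> J' \<Longrightarrow> subalgebra (past J') (past J)"
  by (intro past_le init_measurable_past X_measurable_past) auto

lemma sets_past: "sets (past J) = sigma_sets (space M)
    {init -` A \<inter> (\<lambda>\<omega>. \<lambda>i\<in>J. X i \<omega>) -` B \<inter> space M | A B. A \<in> sets borel \<and> B \<in> sets (Pi\<^sub>M J (\<lambda>_. borel))}"
proof -
  let ?f = "\<lambda>\<omega>. (init \<omega>, \<lambda>i\<in>J. X i \<omega>)"
  let ?P = "{a \<times> b | a b. a \<in> sets (borel :: 'a measure) \<and> b \<in> sets (Pi\<^sub>M J (\<lambda>_. borel :: 's measure))}"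
  have f: "?f \<in> space M \<rightarrow> space borel \<times> space (Pi\<^sub>M J (\<lambda>_. borel))" by (auto simp: space_PiM)
  have "sets (past J) = {?f -` A \<inter> space M | A. A \<in> sigma_sets (space borel \<times> space (Pi\<^sub>M J (\<lambda>_. borel))) ?P}"
    unfolding past_def using f by (subst sets_vimage_algebra2) (auto simp: space_pair_measure sets_pair_measure)
  also have "\<dots> = sigma_sets (space M) {?f -` C \<inter> space M | C. C \<in> ?P}"
    by (rule sigma_sets_vimage_commute[OF f])
  also have "{?f -` C \<inter> space M | C. C \<in> ?P} = {init -` A \<inter> (\<lambda>\<omega>. \<lambda>i\<in>J. X i \<omega>) -` B \<inter> space M | A B.
      A \<in> sets borel \<and> B \<in> sets (Pi\<^sub>M J (\<lambda>_. borel))}" (is "?L = ?R")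
  proof
    show "?L \<subseteq> ?R"
    proof
      fix p assume "p \<in> ?L"
      then obtain A B where "A \<in> sets borel" "B \<in> sets (Pi\<^sub>M J (\<lambda>_. borel :: 's measure))" "p = ?f -` (A \<times> B) \<inter> space M" by auto
      moreover have "?f -` (A \<times> B) \<inter> space M = init -` A \<inter> (\<lambda>\<omega>. \<lambda>i\<in>J. X i \<omega>) -` B \<inter> space M" by auto
      ultimately show "p \<in> ?R" by blast
    qed
    show "?R \<subseteq> ?L"
    proof
      fix p assume "p \<in> ?R"
      then obtain A B where "A \<in> sets borel" "B \<in> sets (Pi\<^sub>M J (\<lambda>_. borel :: 's measure))"
          "p = init -` A \<inter> (\<lambda>\<omega>. \<lambda>i\<in>J. X i \<omega>) -` B \<inter> space M" by auto
      moreover have "?f -` (A \<times> B) \<inter> space M = init -` A \<inter> (\<lambda>\<omega>. \<lambda>i\<in>J. X i \<omega>) -` B \<inter> space M" by auto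
      ultimately show "p \<in> ?L" by blast
    qed
  qed
  finally show ?thesis .
qed

text \<open>
  The events \<open>{init \<in> A, X\<^sub>J \<in> B}\<close> form a generator of \<open>past J\<close> that is closed under intersections. On them
  the probability factorizes: first split off the initial data, then the sample \<open>i\<close> from those in \<open>J\<close>.
\<close>

lemma past_indep:
  assumes J: "J \<subseteq> I" "i \<in> I" "i \<notin> J"
  shows "indep_set (sets (past J)) {X i -` C \<inter> space M | C. C \<in> sets borel}"
proof -
  define U where "U = (\<lambda>\<omega>. \<lambda>i\<in>I. X i \<omega>)"
  define V where "V = (\<lambda>\<omega>. \<lambda>i\<in>J. X i \<omega>)"
  have VM: "V \<in> measurable M (Pi\<^sub>M J (\<lambda>_. borel))"
    unfolding V_def by (intro measurable_restrict X_measurable) (use J in auto)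
  note [measurable] = init X_measurable[OF J(2)] VM
  let ?E = "{init -` A \<inter> V -` B \<inter> space M | A B. A \<in> sets borel \<and> B \<in> sets (Pi\<^sub>M J (\<lambda>_. borel))}"
  let ?F = "{X i -` C \<inter> space M | C. C \<in> sets borel}"
  have VX: "prob (V -` B \<inter> X i -` C \<inter> space M) = prob (V -` B \<inter> space M) * prob (X i -` C \<inter> space M)"
    if B: "B \<in> sets (Pi\<^sub>M J (\<lambda>_. borel))" and C: "C \<in> sets borel" for B C
  proof -
    let ?C = "{v \<in> space (Pi\<^sub>M {i} (\<lambda>_. borel)). v i \<in> C}"
    have "?C = (\<lambda>v. v i) -` C \<inter> space (Pi\<^sub>M {i} (\<lambda>_. borel))" by auto
    then have CP: "?C \<in> sets (Pi\<^sub>M {i} (\<lambda>_. borel))"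
      using measurable_sets[OF measurable_component_singleton[of i "{i}" "\<lambda>_. borel"] C] by simp
    have "indep_var (Pi\<^sub>M J (\<lambda>_. borel)) V (Pi\<^sub>M {i} (\<lambda>_. borel)) (\<lambda>\<omega>. \<lambda>i\<in>{i}. X i \<omega>)"
      unfolding V_def by (rule indep_var_restrict[OF indep]) (use J in auto)
    from indep_varD[OF this B CP]
    have "prob ((\<lambda>x. (V x, \<lambda>i\<in>{i}. X i x)) -` (B \<times> ?C) \<inter> space M) =
        prob (V -` B \<inter> space M) * prob ((\<lambda>\<omega>. \<lambda>i\<in>{i}. X i \<omega>) -` ?C \<inter> space M)" .
    moreover have "(\<lambda>x. (V x, \<lambda>i\<in>{i}. X i x)) -` (B \<times> ?C) \<inter> space M = V -` B \<inter> X i -` C \<inter> space M"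
      by (auto simp: space_PiM)
    moreover have "(\<lambda>\<omega>. \<lambda>i\<in>{i}. X i \<omega>) -` ?C \<inter> space M = X i -` C \<inter> space M"
      by (auto simp: space_PiM)
    ultimately show ?thesis by simp
  qed
  have IU: "prob (init -` A \<inter> (V -` B \<inter> X i -` C) \<inter> space M) = prob (init -` A \<inter> space M) * prob (V -` B \<inter> X i -` C \<inter> space M)"
    if A: "A \<in> sets borel" and B: "B \<in> sets (Pi\<^sub>M J (\<lambda>_. borel))" and C: "C \<in> sets borel" for A B C
  proof -
    let ?S = "vimage_algebra (space M) U (Pi\<^sub>M I (\<lambda>_. borel))"
    have US: "U \<in> measurable ?S (Pi\<^sub>M I (\<lambda>_. borel))"
      by (rule measurable_vimage_algebra1) (auto simp: U_def space_PiM)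
    have "(\<lambda>\<omega>. restrict (U \<omega>) J) \<in> measurable ?S (Pi\<^sub>M J (\<lambda>_. borel))"
      using measurable_compose[OF US measurable_restrict_subset[OF J(1)]] .
    also have "(\<lambda>\<omega>. restrict (U \<omega>) J) = V" using J(1) by (auto simp: U_def V_def restrict_def fun_eq_iff)
    finally have "V -` B \<inter> space ?S \<in> sets ?S" using B by (rule measurable_sets)
    moreover have "(\<lambda>\<omega>. U \<omega> i) \<in> borel_measurable ?S"
      using measurable_compose[OF US measurable_component_singleton[OF J(2)]] .
    then have "X i \<in> borel_measurable ?S" using J(2) by (simp add: U_def)
    then have "X i -` C \<inter> space ?S \<in> sets ?S" using C by (rule measurable_sets)
    ultimately have S: "V -` B \<inter> X i -` C \<inter> space M \<in> sets ?S"
      using sets.Int[of "V -` B \<inter> space M" ?S "X i -` C \<inter> space M"] by (simp add: Int_ac)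
    have "prob ((init -` A \<inter> space M) \<inter> (V -` B \<inter> X i -` C \<inter> space M)) = prob (init -` A \<inter> space M) * prob (V -` B \<inter> X i -` C \<inter> space M)"
      using indep_setD[OF init_indep in_vimage_algebra[OF A] S[unfolded U_def]] .
    then show ?thesis by (simp add: Int_ac)
  qed
  have "indep_set ?E ?F"
  proof (subst indep_sets2_eq, intro conjI ballI)
    show "?E \<subseteq> events" by auto
    show "?F \<subseteq> events" by auto
    fix p q assume "p \<in> ?E" "q \<in> ?F"
    then obtain A B C where ABC [measurable]: "A \<in> sets borel" "B \<in> sets (Pi\<^sub>M J (\<lambda>_. borel))" "C \<in> sets borel"
      and pq: "p = init -` A \<inter> V -` B \<inter> space M" "q = X i -` C \<inter> space M" by auto
    have "prob (init -` A \<inter> (V -` B \<inter> X i -` UNIV) \<inter> space M) = prob (init -` A \<inter> space M) * prob (V -` B \<inter> X i -` UNIV \<inter> space M)"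
      by (rule IU) auto
    moreover have "p \<inter> q = init -` A \<inter> (V -` B \<inter> X i -` C) \<inter> space M" by (auto simp: pq)
    ultimately show "prob (p \<inter> q) = prob p * prob q"
      using IU[OF ABC] VX[OF ABC(2,3)] by (simp add: pq Int_assoc)
  qed
  moreover have "Int_stable ?E"
  proof (rule Int_stableI)
    fix p q assume "p \<in> ?E" "q \<in> ?E"
    then obtain A B A' B' where *: "A \<in> sets borel" "B \<in> sets (Pi\<^sub>M J (\<lambda>_. borel))"
        "A' \<in> sets borel" "B' \<in> sets (Pi\<^sub>M J (\<lambda>_. borel))"
      and pq: "p = init -` A \<inter> V -` B \<inter> space M" "q = init -` A' \<inter> V -` B' \<inter> space M" by auto
    have "p \<inter> q = init -` (A \<inter> A') \<inter> V -` (B \<inter> B') \<inter> space M" by (auto simp: pq)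
    then show "p \<inter> q \<in> ?E" using * by blast
  qed
  moreover have "Int_stable ?F"
  proof (rule Int_stableI)
    fix p q assume "p \<in> ?F" "q \<in> ?F"
    then obtain C C' where *: "C \<in> sets borel" "C' \<in> sets borel" "p = X i -` C \<inter> space M" "q = X i -` C' \<inter> space M" by auto
    have "p \<inter> q = X i -` (C \<inter> C') \<inter> space M" by (auto simp: *)
    then show "p \<inter> q \<in> ?F" using * by blast
  qed
  ultimately have "indep_set (sigma_sets (space M) ?E) (sigma_sets (space M) ?F)"
    by (rule indep_set_sigma_sets)
  moreover have "?F \<subseteq> sigma_sets (space M) ?F" by (auto intro: sigma_sets.Basic)
  ultimately show ?thesis unfolding sets_past V_def[symmetric] indep_sets2_eq by blast
qed

end

text \<open>
  The value \<open>H y q\<close> is the error of the estimate at \<open>y\<close> from the sample \<open>q\<close>. The moment bound \<open>B\<close> is uniform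
  on the set \<open>K\<close> in which the query points lie.
\<close>

locale noisy_oracle = iid_sampling M init I X Q
  for M :: "'w measure" and init :: "'w \<Rightarrow> 'a::topological_space" and I :: "'k set"
    and X :: "'k \<Rightarrow> 'w \<Rightarrow> 's::topological_space" and Q :: "'s measure" +
  fixes H :: "'y::topological_space \<Rightarrow> 's \<Rightarrow> 'v::euclidean_space" and K :: "'y set" and B :: real
  assumes H_measurable: "(\<lambda>(y, q). H y q) \<in> borel_measurable (borel \<Otimes>\<^sub>M borel)"
    and H_integrable: "y \<in> K \<Longrightarrow> integrable Q (H y)"
    and H_mean: "y \<in> K \<Longrightarrow> (\<integral>q. H y q \<partial>Q) = 0"
    and H_square_integrable: "y \<in> K \<Longrightarrow> integrable Q (\<lambda>q. (norm (H y q))\<^sup>2)"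
    and H_second_moment: "y \<in> K \<Longrightarrow> (\<integral>q. (norm (H y q))\<^sup>2 \<partial>Q) \<le> B"
begin

context
  fixes J i y
  assumes J: "J \<subseteq> I" "i \<in> I" "i \<notin> J"
    and y: "y \<in> borel_measurable (past J)" "\<And>\<omega>. \<omega> \<in> space M \<Longrightarrow> y \<omega> \<in> K"
begin

lemma H_pair_measurable: "(\<lambda>(\<omega>, q). H (y \<omega>) q) \<in> borel_measurable (past J \<Otimes>\<^sub>M borel)"
proof -
  have "(\<lambda>p. (y (fst p), snd p)) \<in> measurable (past J \<Otimes>\<^sub>M borel) (borel \<Otimes>\<^sub>M borel)"
    using y(1) by measurable
  from measurable_compose[OF this H_measurable] show ?thesis by (simp add: case_prod_beta')
qed

lemma H_sample_measurable: "(\<lambda>\<omega>. H (y \<omega>) (X i \<omega>)) \<in> borel_measurable M"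
proof -
  have "(\<lambda>\<omega>. (y \<omega>, X i \<omega>)) \<in> measurable M (borel \<Otimes>\<^sub>M borel)"
    using measurable_from_subalg[OF past_subalgebra[OF J(1)] y(1)] X_measurable[OF J(2)] by measurable
  from measurable_compose[OF this H_measurable] show ?thesis by simp
qed

lemma sample_second_moment:
  shows "integrable M (\<lambda>\<omega>. (norm (H (y \<omega>) (X i \<omega>)))\<^sup>2)" (is ?int)
    and "(\<integral>\<omega>. (norm (H (y \<omega>) (X i \<omega>)))\<^sup>2 \<partial>M) \<le> B" (is ?le)
proof -
  note [measurable] = H_pair_measurable H_sample_measurable
  obtain \<omega>0 where "\<omega>0 \<in> space M" using not_empty by blast
  then have B0: "0 \<le> B"
    using H_second_moment[OF y(2)] by (meson integral_nonneg order_trans zero_le_power2 Bochner_Integration.integral_nonneg)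
  have "(\<integral>\<^sup>+\<omega>. ennreal ((norm (H (y \<omega>) (X i \<omega>)))\<^sup>2) \<partial>M)
      = (\<integral>\<^sup>+\<omega>. \<integral>\<^sup>+q. ennreal ((norm (H (y \<omega>) q))\<^sup>2) \<partial>Q \<partial>M)"
    using expectation_independent_pair(1)[OF past_subalgebra[OF J(1)] X_measurable[OF J(2)] past_indep[OF J],
        of "\<lambda>(\<omega>, q). (norm (H (y \<omega>) q))\<^sup>2"] by (simp add: law[OF J(2)] case_prod_beta')
  also have "\<dots> \<le> (\<integral>\<^sup>+\<omega>. ennreal B \<partial>M)"
  proof (rule nn_integral_mono)
    fix \<omega> assume "\<omega> \<in> space M"
    then show "(\<integral>\<^sup>+q. ennreal ((norm (H (y \<omega>) q))\<^sup>2) \<partial>Q) \<le> ennreal B"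
      using H_second_moment[OF y(2)]
      by (subst nn_integral_eq_integral[OF H_square_integrable[OF y(2)]]) (auto intro: ennreal_leI)
  qed
  also have "\<dots> = ennreal B" by (simp add: emeasure_space_1)
  finally have le: "(\<integral>\<^sup>+\<omega>. ennreal ((norm (H (y \<omega>) (X i \<omega>)))\<^sup>2) \<partial>M) \<le> ennreal B" .
  show ?int
    using le by (intro integrableI_bounded) (auto simp: less_top[symmetric] top_unique)
  show ?le
    by (subst integral_eq_nn_integral) (use le B0 in \<open>auto intro: enn2real_leI\<close>)
qed

text \<open>
  Integrate out the sample first: it is independent of the past, on which both \<open>u\<close> and the query point
  depend, and for a fixed query point the error has mean 0.
\<close>

lemma sample_orthogonal:
  assumes u: "u \<in> borel_measurable (past J)" "integrable M (\<lambda>\<omega>. (norm (u \<omega>))\<^sup>2)"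
  shows "integrable M (\<lambda>\<omega>. u \<omega> \<bullet> H (y \<omega>) (X i \<omega>))" (is ?int)
    and "(\<integral>\<omega>. u \<omega> \<bullet> H (y \<omega>) (X i \<omega>) \<partial>M) = 0" (is ?eq)
proof -
  note [measurable] = H_pair_measurable H_sample_measurable u(1)
    measurable_from_subalg[OF past_subalgebra[OF J(1)] u(1)]
  show int: ?int
  proof (rule Bochner_Integration.integrable_bound)
    show "integrable M (\<lambda>\<omega>. norm (u \<omega>) * norm (H (y \<omega>) (X i \<omega>)))"
      by (rule integrable_mult_if_square_integrable[OF _ _ u(2) sample_second_moment(1)]) measurable
    show "AE \<omega> in M. norm (u \<omega> \<bullet> H (y \<omega>) (X i \<omega>)) \<le> norm (norm (u \<omega>) * norm (H (y \<omega>) (X i \<omega>)))"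
      by (simp add: Cauchy_Schwarz_ineq2)
  qed measurable
  have "(\<integral>\<omega>. u \<omega> \<bullet> H (y \<omega>) (X i \<omega>) \<partial>M) = (\<integral>\<omega>. \<integral>q. u \<omega> \<bullet> H (y \<omega>) q \<partial>Q \<partial>M)"
    using expectation_independent_pair(2)[OF past_subalgebra[OF J(1)] X_measurable[OF J(2)] past_indep[OF J],
        of "\<lambda>(\<omega>, q). u \<omega> \<bullet> H (y \<omega>) q"] int by (simp add: law[OF J(2)] case_prod_beta')
  also have "\<dots> = (\<integral>\<omega>. 0 \<partial>M)"
    by (intro Bochner_Integration.integral_cong refl)
       (simp add: integral_inner_right[OF H_integrable[OF y(2)]] H_mean[OF y(2)])
  finally show ?eq by simp
qed

end

context
  fixes J y and idx :: "nat \<Rightarrow> 'k" and n :: nat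
  assumes J: "J \<subseteq> I" and idx: "\<And>t. t < n \<Longrightarrow> idx t \<in> I - J" "inj_on idx {..<n}"
    and y: "y \<in> borel_measurable (past J)" "\<And>\<omega>. \<omega> \<in> space M \<Longrightarrow> y \<omega> \<in> K"
begin

lemma batch_orthogonal:
  assumes u: "u \<in> borel_measurable (past J)" "integrable M (\<lambda>\<omega>. (norm (u \<omega>))\<^sup>2)"
  shows "(\<integral>\<omega>. u \<omega> \<bullet> (\<Sum>t<n. H (y \<omega>) (X (idx t) \<omega>)) \<partial>M) = 0"
proof -
  have "integrable M (\<lambda>\<omega>. u \<omega> \<bullet> H (y \<omega>) (X (idx t) \<omega>))" "(\<integral>\<omega>. u \<omega> \<bullet> H (y \<omega>) (X (idx t) \<omega>) \<partial>M) = 0"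
    if "t < n" for t
    using sample_orthogonal[OF J _ _ y u, of "idx t"] idx(1)[OF that] by auto
  then show ?thesis by (simp add: inner_sum_right)
qed

text \<open>
  Each sample is independent of the past enlarged by the earlier samples of the same batch; therefore the
  errors are orthogonal and their second moments add up.
\<close>

lemma batch_second_moment:
  assumes "m \<le> n"
  shows "integrable M (\<lambda>\<omega>. (norm (\<Sum>t<m. H (y \<omega>) (X (idx t) \<omega>)))\<^sup>2) \<and>
         (\<integral>\<omega>. (norm (\<Sum>t<m. H (y \<omega>) (X (idx t) \<omega>)))\<^sup>2 \<partial>M) \<le> real m * B"
  using assms
proof (induction m)
  case 0 then show ?case by simp
next
  case (Suc m)
  (* The past of the m-th sample of the batch. *)
  define J' where "J' = J \<union> idx ` {..<m}"
  define u where "u \<omega> = (\<Sum>t<m. H (y \<omega>) (X (idx t) \<omega>))" for \<omega>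
  have J': "J' \<subseteq> I" "idx m \<in> I" "idx m \<notin> J'"
    using J idx Suc.prems unfolding J'_def by (auto simp: inj_on_def Suc_le_eq) (metis lessThan_iff less_irrefl order.strict_trans)
  have yJ': "y \<in> borel_measurable (past J')"
    using measurable_from_subalg[OF past_mono y(1)] unfolding J'_def by simp
  have uJ': "u \<in> borel_measurable (past J')"
    unfolding u_def
  proof (rule borel_measurable_sum)
    fix t assume "t \<in> {..<m}"
    then have "X (idx t) \<in> borel_measurable (past J')" by (intro X_measurable_past) (auto simp: J'_def)
    then have "(\<lambda>\<omega>. (y \<omega>, X (idx t) \<omega>)) \<in> measurable (past J') (borel \<Otimes>\<^sub>M borel)" using yJ' by measurable
    from measurable_compose[OF this H_measurable]
    show "(\<lambda>\<omega>. H (y \<omega>) (X (idx t) \<omega>)) \<in> borel_measurable (past J')" by simp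
  qed
  have IH: "integrable M (\<lambda>\<omega>. (norm (u \<omega>))\<^sup>2)" "(\<integral>\<omega>. (norm (u \<omega>))\<^sup>2 \<partial>M) \<le> real m * B"
    using Suc unfolding u_def by auto
  note sm = sample_second_moment[OF J' yJ' y(2)]
  note so = sample_orthogonal[OF J' yJ' y(2) uJ' IH(1)]
  have eq: "(norm (\<Sum>t<Suc m. H (y \<omega>) (X (idx t) \<omega>)))\<^sup>2
     = (norm (u \<omega>))\<^sup>2 + 2 * (u \<omega> \<bullet> H (y \<omega>) (X (idx m) \<omega>)) + (norm (H (y \<omega>) (X (idx m) \<omega>)))\<^sup>2" for \<omega>
    by (simp add: u_def power2_norm_eq_inner inner_add_left inner_add_right inner_commute)
  have "(\<integral>\<omega>. (norm (u \<omega>))\<^sup>2 + 2 * (u \<omega> \<bullet> H (y \<omega>) (X (idx m) \<omega>)) + (norm (H (y \<omega>) (X (idx m) \<omega>)))\<^sup>2 \<partial>M)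
     = (\<integral>\<omega>. (norm (u \<omega>))\<^sup>2 \<partial>M) + 2 * 0 + (\<integral>\<omega>. (norm (H (y \<omega>) (X (idx m) \<omega>)))\<^sup>2 \<partial>M)"
    using IH(1) so sm(1) by simp
  then show ?case unfolding eq using IH so(1) sm by (auto simp: algebra_simps)
qed

end

end

section \<open>Errors of minibatches of growing size\<close>

lemma borel_measurable_vecI:
  fixes h :: "'w \<Rightarrow> 'v::euclidean_space ^ 'n"
  assumes "\<And>j. (\<lambda>\<omega>. h \<omega> $ j) \<in> borel_measurable N"
  shows "h \<in> borel_measurable N"
  unfolding borel_measurable_euclidean_space[of h]
proof
  fix b :: "'v ^ 'n" assume "b \<in> Basis"
  then obtain j c where "b = axis j c" by (auto simp: Basis_vec_def)
  then show "(\<lambda>\<omega>. h \<omega> \<bullet> b) \<in> borel_measurable N"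
    using assms[of j] by (simp add: inner_axis)
qed

locale minibatch_oracle = noisy_oracle M init "{(k, t). t \<in> {1..S k}}" "\<lambda>(k, t). X k t" Q H K B
  for M :: "'w measure" and init :: "'w \<Rightarrow> 'a::topological_space" and S :: "nat \<Rightarrow> nat"
    and X :: "nat \<Rightarrow> nat \<Rightarrow> 'w \<Rightarrow> 's::topological_space" and Q :: "'s measure"
    and H :: "'y::topological_space \<Rightarrow> 's \<Rightarrow> 'v::euclidean_space" and K B +
  assumes S_pos: "1 \<le> S k" and S_summable: "summable (\<lambda>k. 1 / real (S k))"
begin

definition hist :: "nat \<Rightarrow> 'w measure" where
  "hist k = past {(l, t). l < k \<and> t \<in> {1..S l}}"

definition batch_error :: "nat \<Rightarrow> ('w \<Rightarrow> 'y) \<Rightarrow> 'w \<Rightarrow> 'v" where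
  "batch_error k y \<omega> = (1 / real (S k)) *\<^sub>R (\<Sum>t=1..S k. H (y \<omega>) (X k t \<omega>))"

lemma space_hist [simp]: "space (hist k) = space M" by (simp add: hist_def)

lemma hist_subalgebra: "subalgebra M (hist k)"
  unfolding hist_def by (rule past_subalgebra) auto

lemma hist_Suc: "subalgebra (hist (Suc k)) (hist k)"
  unfolding hist_def by (rule past_mono) auto

lemma init_measurable_hist: "init \<in> borel_measurable (hist k)"
  unfolding hist_def by (rule init_measurable_past)

lemma batch_error_measurable_hist:
  assumes "y \<in> borel_measurable (hist k)"
  shows "batch_error k y \<in> borel_measurable (hist (Suc k))"
proof -
  have y: "y \<in> borel_measurable (hist (Suc k))" using measurable_from_subalg[OF hist_Suc assms] .
  have "(\<lambda>\<omega>. H (y \<omega>) (X k t \<omega>)) \<in> borel_measurable (hist (Suc k))" if t: "t \<in> {1..S k}" for t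
  proof -
    have "X k t \<in> borel_measurable (hist (Suc k))"
      using X_measurable_past[of "(k, t)" "{(l, t). l < Suc k \<and> t \<in> {1..S l}}"] t unfolding hist_def by simp
    then have "(\<lambda>\<omega>. (y \<omega>, X k t \<omega>)) \<in> measurable (hist (Suc k)) (borel \<Otimes>\<^sub>M borel)" using y by measurable
    from measurable_compose[OF this H_measurable] show ?thesis by simp
  qed
  then show ?thesis unfolding batch_error_def
    by (intro borel_measurable_scaleR borel_measurable_const borel_measurable_sum) auto
qed

lemma batch_error_shift:
  "batch_error k y \<omega> = (1 / real (S k)) *\<^sub>R (\<Sum>t<S k. H (y \<omega>) ((\<lambda>(k, t). X k t) (k, Suc t) \<omega>))"
  unfolding batch_error_def
  by (simp add: sum.atLeast1_atMost_eq)

context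
  fixes k y
  assumes y: "y \<in> borel_measurable (hist k)" "\<And>\<omega>. \<omega> \<in> space M \<Longrightarrow> y \<omega> \<in> K"
begin

lemma batch_error_second_moment:
  "integrable M (\<lambda>\<omega>. (norm (batch_error k y \<omega>))\<^sup>2)" "(\<integral>\<omega>. (norm (batch_error k y \<omega>))\<^sup>2 \<partial>M) \<le> B / real (S k)"
proof -
  let ?J = "{(l, t). l < k \<and> t \<in> {1..S l}}"
  have m: "integrable M (\<lambda>\<omega>. (norm (\<Sum>t<S k. H (y \<omega>) ((\<lambda>(k, t). X k t) (k, Suc t) \<omega>)))\<^sup>2) \<and>
      (\<integral>\<omega>. (norm (\<Sum>t<S k. H (y \<omega>) ((\<lambda>(k, t). X k t) (k, Suc t) \<omega>)))\<^sup>2 \<partial>M) \<le> real (S k) * B"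
    by (rule batch_second_moment[where J = ?J and n = "S k"])
       (use y in \<open>auto simp: hist_def inj_on_def\<close>)
  have sq: "(norm (batch_error k y \<omega>))\<^sup>2 = (1 / real (S k))\<^sup>2 * (norm (\<Sum>t<S k. H (y \<omega>) ((\<lambda>(k, t). X k t) (k, Suc t) \<omega>)))\<^sup>2" for \<omega>
    unfolding batch_error_shift norm_scaleR power_mult_distrib by simp
  show "integrable M (\<lambda>\<omega>. (norm (batch_error k y \<omega>))\<^sup>2)" unfolding sq using m by (intro integrable_mult_right) auto
  have "(\<integral>\<omega>. (norm (batch_error k y \<omega>))\<^sup>2 \<partial>M) \<le> (1 / real (S k))\<^sup>2 * (real (S k) * B)"
    unfolding sq using m by (simp only: integral_mult_right_zero) (intro mult_left_mono, auto)
  also have "\<dots> = B / real (S k)" by (simp add: power2_eq_square)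
  finally show "(\<integral>\<omega>. (norm (batch_error k y \<omega>))\<^sup>2 \<partial>M) \<le> B / real (S k)" .
qed

lemma batch_error_orthogonal:
  assumes u: "u \<in> borel_measurable (hist k)" "integrable M (\<lambda>\<omega>. (norm (u \<omega>))\<^sup>2)"
  shows "(\<integral>\<omega>. u \<omega> \<bullet> batch_error k y \<omega> \<partial>M) = 0"
proof -
  let ?J = "{(l, t). l < k \<and> t \<in> {1..S l}}"
  have "(\<integral>\<omega>. u \<omega> \<bullet> (\<Sum>t<S k. H (y \<omega>) ((\<lambda>(k, t). X k t) (k, Suc t) \<omega>)) \<partial>M) = 0"
    by (rule batch_orthogonal[where J = ?J and n = "S k"])
       (use y u in \<open>auto simp: hist_def inj_on_def\<close>)
  then show ?thesis unfolding batch_error_shift inner_scaleR_right by (simp only: integral_mult_right_zero mult_zero_right)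
qed

end

context
  fixes y :: "nat \<Rightarrow> 'w \<Rightarrow> 'y"
  assumes y: "\<And>k. y k \<in> borel_measurable (hist k)" "\<And>k \<omega>. \<omega> \<in> space M \<Longrightarrow> y k \<omega> \<in> K"
begin

lemma batch_error_square_summable: "AE \<omega> in M. summable (\<lambda>k. (norm (batch_error k (y k) \<omega>))\<^sup>2)"
proof (rule AE_summable_if_integrals_summable)
  show "summable (\<lambda>k. \<integral>\<omega>. (norm (batch_error k (y k) \<omega>))\<^sup>2 \<partial>M)"
  proof (rule summable_comparison_test')
    show "summable (\<lambda>k. B * (1 / real (S k)))" by (rule summable_mult[OF S_summable])
    show "norm (\<integral>\<omega>. (norm (batch_error k (y k) \<omega>))\<^sup>2 \<partial>M) \<le> B * (1 / real (S k))" if "0 \<le> k" for k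
      using batch_error_second_moment(2)[OF y, of k] by simp
  qed
qed (auto intro: batch_error_second_moment(1)[OF y])

text \<open>
  With a multiplier \<open>u\<close> that is bounded and determined by the past, the inner products are martingale
  differences whose second moments are at most \<open>R\<^sup>2 B / S\<^sub>k\<close>.
\<close>

lemma predictable_batch_error_summable:
  assumes u: "\<And>k. u k \<in> borel_measurable (hist k)" "\<And>k \<omega>. \<omega> \<in> space M \<Longrightarrow> norm (u k \<omega>) \<le> R"
  shows "AE \<omega> in M. summable (\<lambda>k. batch_error k (y k) \<omega> \<bullet> u k \<omega>)"
proof -
  note eH = batch_error_measurable_hist[OF y(1)]
  have eM [measurable]: "batch_error k (y k) \<in> borel_measurable M" for k
    using measurable_from_subalg[OF hist_subalgebra eH] .
  have uM [measurable]: "u k \<in> borel_measurable M" for k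
    using measurable_from_subalg[OF hist_subalgebra u(1)] .
  have le: "(batch_error k (y k) \<omega> \<bullet> u k \<omega>)\<^sup>2 \<le> R\<^sup>2 * (norm (batch_error k (y k) \<omega>))\<^sup>2" if "\<omega> \<in> space M" for k \<omega>
  proof -
    have "\<bar>batch_error k (y k) \<omega> \<bullet> u k \<omega>\<bar> \<le> norm (batch_error k (y k) \<omega>) * norm (u k \<omega>)" by (rule Cauchy_Schwarz_ineq2)
    also have "\<dots> \<le> norm (batch_error k (y k) \<omega>) * R" by (intro mult_left_mono u(2) that) simp
    finally have "\<bar>batch_error k (y k) \<omega> \<bullet> u k \<omega>\<bar>\<^sup>2 \<le> (norm (batch_error k (y k) \<omega>) * R)\<^sup>2" by (intro power_mono) auto
    then show ?thesis by (simp add: power_mult_distrib mult.commute)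
  qed
  have sq: "integrable M (\<lambda>\<omega>. (batch_error k (y k) \<omega> \<bullet> u k \<omega>)\<^sup>2)" for k
  proof (rule Bochner_Integration.integrable_bound)
    show "integrable M (\<lambda>\<omega>. R\<^sup>2 * (norm (batch_error k (y k) \<omega>))\<^sup>2)"
      by (intro integrable_mult_right batch_error_second_moment(1)[OF y])
    show "AE \<omega> in M. norm ((batch_error k (y k) \<omega> \<bullet> u k \<omega>)\<^sup>2) \<le> norm (R\<^sup>2 * (norm (batch_error k (y k) \<omega>))\<^sup>2)"
      using le by (intro AE_I2) auto
  qed measurable
  interpret mart: square_integrable_martingale_difference M hist "\<lambda>k \<omega>. batch_error k (y k) \<omega> \<bullet> u k \<omega>"
  proof
    fix k
    show "subalgebra M (hist k)" "subalgebra (hist (Suc k)) (hist k)" by (rule hist_subalgebra hist_Suc)+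
    show "(\<lambda>\<omega>. batch_error k (y k) \<omega> \<bullet> u k \<omega>) \<in> borel_measurable (hist (Suc k))"
      by (intro borel_measurable_inner eH measurable_from_subalg[OF hist_Suc u(1)])
    show "integrable M (\<lambda>\<omega>. (batch_error k (y k) \<omega> \<bullet> u k \<omega>)\<^sup>2)" by (rule sq)
    fix h :: "'w \<Rightarrow> real" assume h: "h \<in> borel_measurable (hist k)" "integrable M (\<lambda>\<omega>. (h \<omega>)\<^sup>2)"
    have [measurable]: "h \<in> borel_measurable M" using measurable_from_subalg[OF hist_subalgebra h(1)] .
    have "(\<integral>\<omega>. (h \<omega> *\<^sub>R u k \<omega>) \<bullet> batch_error k (y k) \<omega> \<partial>M) = 0"
    proof (rule batch_error_orthogonal[OF y])
      show "(\<lambda>\<omega>. h \<omega> *\<^sub>R u k \<omega>) \<in> borel_measurable (hist k)" using h(1) u(1)[of k] by measurable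
      show "integrable M (\<lambda>\<omega>. (norm (h \<omega> *\<^sub>R u k \<omega>))\<^sup>2)"
      proof (rule Bochner_Integration.integrable_bound)
        show "integrable M (\<lambda>\<omega>. R\<^sup>2 * (h \<omega>)\<^sup>2)" by (intro integrable_mult_right h(2))
        have "(norm (h \<omega> *\<^sub>R u k \<omega>))\<^sup>2 \<le> R\<^sup>2 * (h \<omega>)\<^sup>2" if "\<omega> \<in> space M" for \<omega>
          using u(2)[OF that, of k] by (simp add: power_mult_distrib mult.commute[of "R\<^sup>2"] mult_left_mono power_mono)
        then show "AE \<omega> in M. norm ((norm (h \<omega> *\<^sub>R u k \<omega>))\<^sup>2) \<le> norm (R\<^sup>2 * (h \<omega>)\<^sup>2)"
          by (intro AE_I2) auto
      qed measurable
    qed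
    then show "(\<integral>\<omega>. h \<omega> * (batch_error k (y k) \<omega> \<bullet> u k \<omega>) \<partial>M) = 0"
      by (simp add: inner_commute)
  qed
  show ?thesis
  proof (rule mart.AE_summable, rule summable_comparison_test')
    show "summable (\<lambda>k. R\<^sup>2 * (B * (1 / real (S k))))" by (intro summable_mult S_summable)
    fix k
    have "(\<integral>\<omega>. (batch_error k (y k) \<omega> \<bullet> u k \<omega>)\<^sup>2 \<partial>M) \<le> (\<integral>\<omega>. R\<^sup>2 * (norm (batch_error k (y k) \<omega>))\<^sup>2 \<partial>M)"
      by (intro integral_mono sq integrable_mult_right batch_error_second_moment(1)[OF y] le)
    also have "\<dots> \<le> R\<^sup>2 * (B * (1 / real (S k)))"
      using mult_left_mono[OF batch_error_second_moment(2)[OF y, of k], of "R\<^sup>2"] by simp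
    finally show "norm (\<integral>\<omega>. (batch_error k (y k) \<omega> \<bullet> u k \<omega>)\<^sup>2 \<partial>M) \<le> R\<^sup>2 * (B * (1 / real (S k)))"
      by simp
  qed
qed

end

end

section \<open>Sampled partial gradients\<close>

lemma replace_block_self [simp]: "replace_block own i y y = y"
  by (simp add: replace_block_def vec_eq_iff)

lemma GDERIV_difference_quotient:
  assumes "GDERIV h y :> D"
  shows "(\<lambda>n. real (Suc n) * (h (y + inverse (real (Suc n)) *\<^sub>R v) - h y)) \<longlonglongrightarrow> v \<bullet> D"
proof -
  have h: "(h has_derivative (\<lambda>d. d \<bullet> D)) (at (y + 0 *\<^sub>R v))" using assms by (simp add: gderiv_def)
  have "((\<lambda>t. y + t *\<^sub>R v) has_derivative (\<lambda>t. t *\<^sub>R v)) (at 0)"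
    by (auto intro!: derivative_eq_intros)
  then have "((\<lambda>t. h (y + t *\<^sub>R v)) has_derivative (\<lambda>t. t *\<^sub>R v \<bullet> D)) (at 0)"
    using has_derivative_compose h by fastforce
  then have "((\<lambda>t. h (y + t *\<^sub>R v)) has_real_derivative (v \<bullet> D)) (at 0)"
    by (simp add: has_field_derivative_def mult.commute[of "v \<bullet> D"] mult_commute_abs)
  then have "((\<lambda>t. (h (y + t *\<^sub>R v) - h y) / t) \<longlongrightarrow> v \<bullet> D) (at 0)"
    by (simp add: DERIV_def)
  moreover have "filterlim (\<lambda>n. inverse (real (Suc n))) (at 0) sequentially"
    unfolding filterlim_at using LIMSEQ_inverse_real_of_nat by simp
  ultimately have "(\<lambda>n. (h (y + inverse (real (Suc n)) *\<^sub>R v) - h y) / inverse (real (Suc n))) \<longlonglongrightarrow> v \<bullet> D"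
    by (rule filterlim_compose)
  then show ?thesis by (simp add: divide_inverse mult.commute)
qed

lemma partial_gradient_GDERIV:
  assumes "continuously_differentiable (\<lambda>u. \<phi> (replace_block own i y u))"
  shows "GDERIV (\<lambda>u. \<phi> (replace_block own i y u)) y :> partial_gradient own i \<phi> y"
proof -
  obtain D where D: "GDERIV (\<lambda>u. \<phi> (replace_block own i y u)) y :> D"
    using assms unfolding continuously_differentiable_def by blast
  moreover have "D' = D" if "GDERIV (\<lambda>u. \<phi> (replace_block own i y u)) y :> D'" for D'
  proof -
    have "(\<lambda>d. d \<bullet> D') = (\<lambda>d. d \<bullet> D)"
      using that D unfolding gderiv_def by (rule has_derivative_unique)
    then show ?thesis by (metis vector_eq_ldot)
  qed
  ultimately show ?thesis unfolding partial_gradient_def by (rule theI)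
qed

lemma partial_gradient_limit:
  assumes "continuously_differentiable (\<lambda>u. \<phi> (replace_block own i y u))"
  shows "(\<lambda>n. real (Suc n) * (\<phi> (replace_block own i y (y + inverse (real (Suc n)) *\<^sub>R axis j 1)) - \<phi> y))
     \<longlonglongrightarrow> partial_gradient own i \<phi> y $ j"
  using GDERIV_difference_quotient[OF partial_gradient_GDERIV[OF assms], of "axis j 1"]
  by (simp add: inner_axis')

lemma partial_gradient_other_block:
  assumes "continuously_differentiable (\<lambda>u. \<phi> (replace_block own i y u))" "own j \<noteq> i"
  shows "partial_gradient own i \<phi> y $ j = 0"
proof -
  have "replace_block own i y (y + t *\<^sub>R axis j 1) = y" for t
    using assms(2) by (auto simp: replace_block_def vec_eq_iff axis_def)
  then show ?thesis
    using partial_gradient_limit[OF assms(1), of j] by (simp add: LIMSEQ_const_iff)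
qed

lemma continuous_on_replace_block: "continuous_on UNIV (\<lambda>y. replace_block own i y (y + v))"
proof -
  have "continuous_on UNIV (\<lambda>y. if own j = i then (y + v) $ j else y $ j)" for j
    by (cases "own j = i") (auto intro!: continuous_intros)
  then show ?thesis unfolding replace_block_def by (rule continuous_on_vec_lambda)
qed

lemma borel_measurable_vec_nth: "(\<lambda>v :: 'v::topological_space ^ 'k. v $ k) \<in> borel_measurable borel"
  by (intro borel_measurable_continuous_onI continuous_intros)

text \<open>
  The gradient is defined by a description operator; its coordinates are limits of difference quotients,
  which are jointly measurable in the point and the sample.
\<close>

lemma partial_gradient_measurable:
  fixes f :: "real ^ 'n \<Rightarrow> real ^ 'd \<Rightarrow> real"
  assumes C1: "\<And>y s. continuously_differentiable (\<lambda>u. f (replace_block own i y u) s)"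
    and f: "(\<lambda>(y, s). f y s) \<in> borel_measurable (borel \<Otimes>\<^sub>M borel)"
  shows "(\<lambda>(y, s). partial_gradient own i (\<lambda>y. f y s) y) \<in> borel_measurable (borel \<Otimes>\<^sub>M borel)"
proof (rule borel_measurable_vecI)
  fix j
  let ?q = "\<lambda>n (y, s). real (Suc n) * (f (replace_block own i y (y + inverse (real (Suc n)) *\<^sub>R axis j 1)) s - f y s)"
  show "(\<lambda>p. (case p of (y, s) \<Rightarrow> partial_gradient own i (\<lambda>y. f y s) y) $ j) \<in> borel_measurable (borel \<Otimes>\<^sub>M borel)"
  proof (rule borel_measurable_LIMSEQ_real)
    show "(\<lambda>n. ?q n p) \<longlonglongrightarrow> (case p of (y, s) \<Rightarrow> partial_gradient own i (\<lambda>y. f y s) y) $ j"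
      if "p \<in> space (borel \<Otimes>\<^sub>M borel)" for p
      using partial_gradient_limit[where \<phi> = "\<lambda>y. f y (snd p)" and y = "fst p" and j = j, OF C1] by (simp add: case_prod_beta')
    show "?q n \<in> borel_measurable (borel \<Otimes>\<^sub>M borel)" for n
    proof -
      have r: "(\<lambda>y. replace_block own i y (y + inverse (real (Suc n)) *\<^sub>R axis j 1)) \<in> borel_measurable borel"
        by (intro borel_measurable_continuous_onI continuous_on_replace_block)
      have "(\<lambda>p. (replace_block own i (fst p) (fst p + inverse (real (Suc n)) *\<^sub>R axis j 1), snd p))
          \<in> measurable (borel \<Otimes>\<^sub>M borel) (borel \<Otimes>\<^sub>M (borel :: (real ^ 'd) measure))"
        by (intro measurable_Pair measurable_snd measurable_compose[OF measurable_fst r])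
      from measurable_compose[OF this f]
      have "(\<lambda>p. f (replace_block own i (fst p) (fst p + inverse (real (Suc n)) *\<^sub>R axis j 1)) (snd p))
          \<in> borel_measurable (borel \<Otimes>\<^sub>M borel)" by simp
      moreover have "(\<lambda>p. f (fst p) (snd p)) \<in> borel_measurable (borel \<Otimes>\<^sub>M borel)"
        using f by (simp add: case_prod_beta')
      ultimately show ?thesis by (simp add: case_prod_beta')
    qed
  qed
qed

context
  fixes own :: "'n::finite \<Rightarrow> 'i::finite" and f :: "'i \<Rightarrow> real ^ 'n \<Rightarrow> real ^ 'd \<Rightarrow> real"
  assumes C1: "\<And>i y s. continuously_differentiable (\<lambda>u. f i (replace_block own i y u) s)"
    and f_meas: "\<And>i. (\<lambda>(y, s). f i y s) \<in> borel_measurable (borel \<Otimes>\<^sub>M borel)"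
begin

lemma sample_pseudogradient_measurable:
  "(\<lambda>(y, s). sample_pseudogradient own f y s) \<in> borel_measurable (borel \<Otimes>\<^sub>M borel)"
proof (rule borel_measurable_vecI)
  fix j
  have "(\<lambda>p. (fst p, snd p $ own j)) \<in> measurable (borel \<Otimes>\<^sub>M borel) (borel \<Otimes>\<^sub>M borel :: ((real^'n) \<times> (real^'d)) measure)"
    by (intro measurable_Pair measurable_fst measurable_compose[OF measurable_snd borel_measurable_vec_nth]) 
  from measurable_compose[OF measurable_compose[OF this partial_gradient_measurable[OF C1 f_meas, of "own j"]] borel_measurable_vec_nth, of j]
  show "(\<lambda>p. (case p of (y, s) \<Rightarrow> sample_pseudogradient own f y s) $ j) \<in> borel_measurable (borel \<Otimes>\<^sub>M borel)"
    by (simp add: sample_pseudogradient_def col_def case_prod_beta')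
qed

lemma sample_pseudogradient_block:
  "partial_gradient own i (\<lambda>y. f i y (s $ i)) y = block own i (sample_pseudogradient own f y s)"
  using partial_gradient_other_block[OF C1]
  by (auto simp: block_def sample_pseudogradient_def col_def vec_eq_iff)

text \<open>
  The joint law of the samples of all agents enters only through its marginals, since the components
  of agent \<open>i\<close> involve the \<open>i\<close>-th sample alone.
\<close>

lemma sample_pseudogradient_mean:
  assumes marg: "\<And>i. distr Q borel (\<lambda>s. s $ i) = distr P borel \<xi>"
    and Q: "sets Q = sets borel" and xi: "\<xi> \<in> borel_measurable P"
    and int: "integrable Q (sample_pseudogradient own f y)"
  shows "(\<integral>s. sample_pseudogradient own f y s \<partial>Q) = pseudogradient own P \<xi> f y"
proof -
  have [measurable_cong]: "sets Q = sets borel" by fact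
  have "(\<integral>s. sample_pseudogradient own f y s \<partial>Q) $ j = pseudogradient own P \<xi> f y $ j" for j
  proof -
    let ?i = "own j"
    let ?p = "\<lambda>s. partial_gradient own ?i (\<lambda>y. f ?i y s) y"
    have bl: "bounded_linear (block own ?i)"
      by (intro linear_conv_bounded_linear[THEN iffD1] linearI) (auto simp: block_def vec_eq_iff)
    have nthl: "bounded_linear (\<lambda>v::real^'n. v $ j)" by (rule bounded_linear_vec_nth)
    have p: "?p \<in> borel_measurable borel"
      using measurable_compose[OF measurable_Pair1' partial_gradient_measurable[OF C1 f_meas, of ?i], of y] by simp
    have "(\<integral>s. sample_pseudogradient own f y s \<partial>Q) $ j = (block own ?i (\<integral>s. sample_pseudogradient own f y s \<partial>Q)) $ j"
      by (simp add: block_def)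
    also have "\<dots> = (\<integral>s. block own ?i (sample_pseudogradient own f y s) \<partial>Q) $ j"
      by (simp add: integral_bounded_linear[OF bl int])
    also have "(\<integral>s. block own ?i (sample_pseudogradient own f y s) \<partial>Q) = (\<integral>s. ?p (s $ ?i) \<partial>Q)"
      by (simp add: sample_pseudogradient_block)
    also have "\<dots> = (\<integral>s. ?p s \<partial>distr Q borel (\<lambda>s. s $ ?i))"
      by (rule integral_distr[symmetric, OF _ p]) (simp add: measurable_cong_sets[OF Q refl] borel_measurable_vec_nth)
    also have "\<dots> = (\<integral>w. ?p (\<xi> w) \<partial>P)"
      unfolding marg by (rule integral_distr[OF xi p])
    also have "\<dots> $ j = pseudogradient own P \<xi> f y $ j" by (simp add: pseudogradient_def col_def)
    finally show ?thesis .
  qed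
  then show ?thesis by (simp add: vec_eq_iff)
qed

end

section \<open>Almost sure convergence\<close>

text \<open>
  Obtained from \<open>t\<^sup>2 \<le> 1 + t\<^sup>p\<close>; the additive constant is harmless, since only the boundedness of the second
  moment matters.
\<close>

lemma second_moment_le_of_Lp_bound:
  fixes h :: "'s \<Rightarrow> 'v::euclidean_space"
  assumes Q: "prob_space Q" and h: "h \<in> borel_measurable Q" and p: "2 \<le> p"
    and int: "integrable Q (\<lambda>s. norm (h s) powr p)"
    and le: "(\<integral>s. norm (h s) powr p \<partial>Q) powr (1 / p) \<le> c"
  shows "integrable Q h" "integrable Q (\<lambda>s. (norm (h s))\<^sup>2)" "(\<integral>s. (norm (h s))\<^sup>2 \<partial>Q) \<le> 1 + c powr p"
proof -
  interpret prob_space Q by fact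
  note [measurable] = h
  have le2: "t\<^sup>2 \<le> 1 + t powr p" if t: "0 \<le> t" for t :: real
  proof (cases "t \<le> 1")
    case True
    then have "t\<^sup>2 \<le> 1" using t by (simp add: power_le_one)
    then show ?thesis by (smt (verit) powr_ge_zero)
  next
    case False
    then have "t powr 2 \<le> t powr p" using p by (intro powr_mono) auto
    then show ?thesis using False by simp
  qed
  have int1: "integrable Q (\<lambda>s. 1 + norm (h s) powr p)" using int by simp
  show sq: "integrable Q (\<lambda>s. (norm (h s))\<^sup>2)"
    by (rule Bochner_Integration.integrable_bound[OF int1]) (auto simp: le2)
  show "integrable Q h"
  proof (rule Bochner_Integration.integrable_bound)
    show "integrable Q (\<lambda>s. 1 + (norm (h s))\<^sup>2)" using sq by simp
    have "t \<le> 1 + t\<^sup>2" if "0 \<le> t" for t :: real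
      using sum_squares_ge_zero[of "t - 1" "t"] that by (simp add: power2_eq_square algebra_simps) 
    then show "AE s in Q. norm (h s) \<le> norm (1 + (norm (h s))\<^sup>2)" by simp
  qed measurable
  have "(\<integral>s. (norm (h s))\<^sup>2 \<partial>Q) \<le> (\<integral>s. 1 + norm (h s) powr p \<partial>Q)"
    by (intro integral_mono sq int1 le2) simp
  also have "\<dots> = 1 + (\<integral>s. norm (h s) powr p \<partial>Q)" using int by (simp add: prob_space)
  also have "(\<integral>s. norm (h s) powr p \<partial>Q) = ((\<integral>s. norm (h s) powr p \<partial>Q) powr (1 / p)) powr p"
    using p by (simp add: powr_powr Bochner_Integration.integral_nonneg)
  also have "\<dots> \<le> c powr p" using p le by (intro powr_mono2) auto
  finally show "(\<integral>s. (norm (h s))\<^sup>2 \<partial>Q) \<le> 1 + c powr p" by simp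
qed

lemma summable_inverse_batch_size:
  fixes S :: "nat \<Rightarrow> nat"
  assumes "0 < c" "0 < k0" "0 < a" "\<And>k. 1 \<le> k \<Longrightarrow> c * (real k + k0) powr (a + 1) \<le> real (S k)"
  shows "summable (\<lambda>k. 1 / real (S k))"
proof (rule summable_comparison_test')
  show "summable (\<lambda>k. inverse c * real k powr (- (a + 1)))"
    using assms by (intro summable_mult) (simp add: summable_real_powr_iff)
  fix k :: nat assume k: "1 \<le> k"
  have "real k powr (a + 1) \<le> (real k + k0) powr (a + 1)" using assms k by (intro powr_mono2) auto
  then have "c * real k powr (a + 1) \<le> real (S k)"
    using assms(4)[OF k] assms(1) by (meson less_imp_le mult_left_mono order_trans)
  moreover have "0 < c * real k powr (a + 1)" using assms k by simp
  ultimately have "1 / real (S k) \<le> 1 / (c * real k powr (a + 1))" by (intro divide_left_mono) auto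
  also have "\<dots> = inverse c * real k powr (- (a + 1))" by (simp add: powr_minus[of "real k" "a + 1"] divide_inverse del: minus_add_distrib)
  finally show "norm (1 / real (S k)) \<le> inverse c * real k powr (- (a + 1))" by simp
qed

theorem theorem1:
  fixes own :: "'n::finite \<Rightarrow> 'i::finite"
    and P :: "'p measure" and \<xi> :: "'p \<Rightarrow> real ^ 'd"
    and f :: "'i \<Rightarrow> real ^ 'n \<Rightarrow> real ^ 'd \<Rightarrow> real"
    and g :: "'i \<Rightarrow> real ^ 'n \<Rightarrow> ereal"
    and \<Omega> :: "'i \<Rightarrow> (real ^ 'n) set"
    and A :: "real ^ 'n ^ 'm" and b :: "real ^ 'm" and bs :: "'i \<Rightarrow> real ^ 'm"
    and W :: "real ^ 'i ^ 'i"
    and \<alpha> \<nu> \<sigma> :: "'i \<Rightarrow> real"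
    and \<beta> \<gamma> \<theta> c k0 a p \<sigma>\<^sub>1 :: real
    and \<sigma>\<^sub>0 :: "real ^ 'n \<Rightarrow> real"
    and M :: "'w measure"
    and S :: "nat \<Rightarrow> nat"
    and X :: "nat \<Rightarrow> nat \<Rightarrow> 'w \<Rightarrow> real ^ 'd ^ 'i"
    and Q :: "(real ^ 'd ^ 'i) measure"
    and x :: "nat \<Rightarrow> 'w \<Rightarrow> real ^ 'n"
    and z l :: "nat \<Rightarrow> 'w \<Rightarrow> real ^ 'm ^ 'i"
  defines "F \<equiv> pseudogradient own P \<xi> f"
    and "SOL \<equiv> v_SGNE own P \<xi> f g \<Omega> A b"
    and "A\<^sub>i \<equiv> block_columns own A"
    and "init \<equiv> (\<lambda>\<omega>. (x 0 \<omega>, z 0 \<omega>, l 0 \<omega>))"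
    and "I \<equiv> {(k, t). t \<in> {1..S k}}"
    and "F\<^sub>h \<equiv> (\<lambda>k \<omega>. batch_gradient own f (S k) (\<lambda>t. X k t \<omega>) (x k \<omega>))"
  assumes dims: "surj own"
    and xi: "prob_space P" "\<xi> \<in> borel_measurable P"
    and f_meas: "\<And>i. (\<lambda>(y, s). f i y s) \<in> borel_measurable (borel \<Otimes>\<^sub>M borel)"
    and f_int: "\<And>i y. integrable P (\<lambda>w. f i y (\<xi> w))"
    and b_split: "b = (\<Sum>i\<in>UNIV. bs i)"
    and g_proper: "\<And>i u. u \<in> block_space own i \<Longrightarrow> g i u \<noteq> - \<infinity>"
    and g_lsc: "\<And>i. lsc_on (block_space own i) (g i)"
    and g_convex: "\<And>i. ereal_convex_on (block_space own i) (g i)"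
    and g_dom: "\<And>i. {u \<in> block_space own i. g i u < \<infinity>} = \<Omega> i"
    and Omega: "\<And>i. \<Omega> i \<noteq> {}" "\<And>i. compact (\<Omega> i)" "\<And>i. convex (\<Omega> i)"
    and Ef_convex:
      "\<And>i y. convex_on UNIV (\<lambda>u. \<integral>w. f i (replace_block own i y u) (\<xi> w) \<partial>P)"
    and Ef_C1:
      "\<And>i y. continuously_differentiable (\<lambda>u. \<integral>w. f i (replace_block own i y u) (\<xi> w) \<partial>P)"
    and slater: "slater own \<Omega> A b"
    and f_convex: "\<And>i y s. convex_on UNIV (\<lambda>u. f i (replace_block own i y u) s)"
    and f_C1: "\<And>i y s. continuously_differentiable (\<lambda>u. f i (replace_block own i y u) s)"
    and f_meas_sample: "\<And>i y. f i y \<in> borel_measurable borel"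
    and f_lipschitz:
      "\<And>i y. \<exists>Lip :: real ^ 'd \<Rightarrow> real. integrable P (\<lambda>w. Lip (\<xi> w)) \<and>
          (\<forall>s. lipschitz_on (Lip s) UNIV (\<lambda>u. f i (replace_block own i y u) s))"
    and F_lipschitz: "\<exists>Lip. lipschitz_on Lip UNIV F"
    and graph: "weighted_connected_graph W"
    and M: "prob_space M"
    and batch_pos: "\<And>k. 1 \<le> S k"
    and samples_indep: "prob_space.indep_vars M (\<lambda>_. borel) (\<lambda>(k, t). X k t) I"
    and init_meas: "init \<in> borel_measurable M"
    and samples_init_indep:
      "prob_space.indep_set M
         (sets (vimage_algebra (space M) init borel))
         (sets (vimage_algebra (space M) (\<lambda>\<omega>. \<lambda>(k, t)\<in>I. X k t \<omega>) (Pi\<^sub>M I (\<lambda>_. borel))))"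
    and samples_law: "\<And>k t. (k, t) \<in> I \<Longrightarrow> distr M borel (X k t) = Q"
    and samples_marginal: "\<And>i. distr Q borel (\<lambda>s. s $ i) = distr P borel \<xi>"
    and error_unbiased:
      "\<And>k j. AE \<omega> in M. real_cond_exp M (history M init S X k)
          (\<lambda>\<omega>. (col own (F\<^sub>h k \<omega>) - F (x k \<omega>)) $ j) \<omega> = 0"
    and cocoercive:
      "0 < \<beta>"
      "\<And>y ys. ys \<in> SOL \<Longrightarrow> (F y - F ys) \<bullet> (y - ys) \<ge> \<beta> * (norm (F y - F ys))\<^sup>2"
    and step_sizes:
      "0 < \<gamma>"
      "\<And>i. 0 < \<alpha> i \<and>
          \<alpha> i \<le> inverse (\<gamma> + (MAX j\<in>{j. own j = i}. \<Sum>r\<in>UNIV. \<bar>transpose (A\<^sub>i i) $ j $ r\<bar>))"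
      "\<And>i. 0 < \<nu> i \<and> \<nu> i \<le> inverse (\<gamma> + 2 * wdegree W i)"
      "\<And>i. 0 < \<sigma> i \<and>
          \<sigma> i \<le> inverse (\<gamma> + 2 * wdegree W i
            + (MAX r\<in>UNIV. \<Sum>j | own j = i. \<bar>A\<^sub>i i $ r $ j\<bar>))"
      "0 < \<theta>"
      "ereal \<theta> \<le> min (1 / ereal (2 * max_wdegree W)) (ereal \<beta>)"
      "matrix_norm (matrix_inv (preconditioner own A W \<alpha> \<nu> \<sigma>)) < 2 * \<theta>"
    and batch_size:
      "0 < c" "0 < k0" "0 < a"
      "\<And>k. 1 \<le> k \<Longrightarrow> c * (real k + k0) powr (a + 1) \<le> real (S k)"
    and variance:
      "2 \<le> p" "0 \<le> \<sigma>\<^sub>1"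
      "\<sigma>\<^sub>0 \<in> borel_measurable (restrict_space borel SOL)"
      "locally_bounded_on SOL \<sigma>\<^sub>0"
      "\<And>y ys. ys \<in> SOL \<Longrightarrow>
          integrable Q (\<lambda>s. norm (sample_pseudogradient own f y s - F y) powr p) \<and>
          (\<integral>s. norm (sample_pseudogradient own f y s - F y) powr p \<partial>Q) powr (1 / p)
            \<le> \<sigma>\<^sub>0 ys + \<sigma>\<^sub>1 * norm (y - ys)"
    and initial:
      "\<And>\<omega> i. \<omega> \<in> space M \<Longrightarrow> block own i (x 0 \<omega>) \<in> \<Omega> i"
      "\<And>\<omega> i. \<omega> \<in> space M \<Longrightarrow> 0 \<le> l 0 \<omega> $ i"
    and x_update:
      "\<And>\<omega> k i. \<omega> \<in> space M \<Longrightarrow>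
          block own i (x (Suc k) \<omega>) =
            prox (block_space own i) (\<lambda>u. ereal (\<alpha> i) * g i u)
              (block own i (x k \<omega>)
                - \<alpha> i *\<^sub>R (F\<^sub>h k \<omega> i + transpose (A\<^sub>i i) *v (l k \<omega> $ i)))"
    and z_update:
      "\<And>\<omega> k i. \<omega> \<in> space M \<Longrightarrow>
          z (Suc k) \<omega> $ i =
            z k \<omega> $ i - \<nu> i *\<^sub>R (\<Sum>j\<in>UNIV. W $ i $ j *\<^sub>R (l k \<omega> $ i - l k \<omega> $ j))"
    and l_update:
      "\<And>\<omega> k i. \<omega> \<in> space M \<Longrightarrow>
          l (Suc k) \<omega> $ i =
            closest_point {u. 0 \<le> u}
              (l k \<omega> $ i
                + \<sigma> i *\<^sub>R (A\<^sub>i i *v (2 *\<^sub>R block own i (x (Suc k) \<omega>) - block own i (x k \<omega>)) - bs i)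
                + \<sigma> i *\<^sub>R (\<Sum>j\<in>UNIV. W $ i $ j *\<^sub>R
                    (2 *\<^sub>R (z (Suc k) \<omega> $ i - z (Suc k) \<omega> $ j) - (z k \<omega> $ i - z k \<omega> $ j)))
                - \<sigma> i *\<^sub>R (\<Sum>j\<in>UNIV. W $ i $ j *\<^sub>R (l k \<omega> $ i - l k \<omega> $ j)))"
  shows "AE \<omega> in M. \<exists>xs\<in>SOL. (\<lambda>k. x k \<omega>) \<longlonglongrightarrow> xs"
proof -
  interpret M: prob_space M by fact
  let ?Y = "strategy_set own \<Omega>"
  (* The costs are finite on the strategy sets, so there they can be treated as real functions. *)
  define hr where "hr i u = real_of_ereal (g i u)" for i u
  define total_cost where "total_cost y = (\<Sum>i\<in>UNIV. hr i (block own i y))" for y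

  have Om_sub: "\<Omega> i \<subseteq> block_space own i" for i using g_dom[of i] by auto
  have g_hr: "g i u = ereal (hr i u)" if "u \<in> \<Omega> i" for i u
  proof -
    have "u \<in> block_space own i" "g i u < \<infinity>" using that g_dom[of i] by auto
    then show ?thesis using g_proper[of u i] by (cases "g i u") (auto simp: hr_def)
  qed
  have g_inf: "g i u = \<infinity>" if "u \<in> block_space own i - \<Omega> i" for i u
    using that g_dom[of i] by auto
  have hr_lsc: "real_lsc_on (\<Omega> i) (hr i)" for i
    using real_lsc_on_of_ereal[OF g_lsc Om_sub g_hr] .
  have hr_convex: "convex_on (\<Omega> i) (hr i)" for i
    using convex_on_real_of_ereal[OF g_convex Om_sub Omega(3) g_hr] .
  have prox: "is_prox (\<Omega> i) (\<lambda>u. \<alpha> i * hr i u) v (prox (block_space own i) (\<lambda>u. ereal (\<alpha> i) * g i u) v)" for i v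
  proof (rule prox_is_prox[OF Omega(2,1,3) _ _ Om_sub])
    show "real_lsc_on (\<Omega> i) (\<lambda>u. \<alpha> i * hr i u)" using step_sizes(2)[of i] by (intro real_lsc_on_cmult hr_lsc) auto
    show "convex_on (\<Omega> i) (\<lambda>u. \<alpha> i * hr i u)" using step_sizes(2)[of i] by (intro convex_on_cmul hr_convex) auto
  qed (use step_sizes(2)[of i] in \<open>auto simp: g_hr g_inf\<close>)

  have F_cont: "continuous_on UNIV F" using F_lipschitz lipschitz_on_continuous_on by blast
  have SOL_eq: "SOL = real_vi_solutions (feasible_set own \<Omega> A b) F total_cost"
  proof -
    have tot: "total_nonsmooth_cost own g y = ereal (total_cost y)" if "y \<in> ?Y" for y
      using that by (simp add: total_nonsmooth_cost_def total_cost_def g_hr strategy_set_def)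
    have "(0 \<le> ereal (F xs \<bullet> (y - xs)) + total_nonsmooth_cost own g y - total_nonsmooth_cost own g xs)
        \<longleftrightarrow> 0 \<le> F xs \<bullet> (y - xs) + total_cost y - total_cost xs"
      if "y \<in> feasible_set own \<Omega> A b" "xs \<in> feasible_set own \<Omega> A b" for y xs
    proof -
      have "y \<in> ?Y" "xs \<in> ?Y" using that by (auto simp: feasible_set_def)
      then show ?thesis by (simp add: tot)
    qed
    then show ?thesis
      unfolding SOL_def v_SGNE_def vi_solutions_def real_vi_solutions_def F_def[symmetric] by blast
  qed
  obtain ys where ys: "ys \<in> SOL"
    using real_vi_solutions_nonempty[OF Omega(2) hr_lsc hr_convex slater F_cont]
    unfolding SOL_eq total_cost_def[abs_def] by blast
  have Ycomp: "compact ?Y" by (rule compact_strategy_set[OF Omega(2)])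
  obtain R where R: "\<And>y. y \<in> ?Y \<Longrightarrow> norm y \<le> R" using compact_imp_bounded[OF Ycomp] by (auto simp: bounded_iff)

  define H where "H y s = sample_pseudogradient own f y s - F y" for y s
  (* One equilibrium ys suffices for a variance bound on the whole compact strategy set. *)
  define c where "c = \<sigma>\<^sub>0 ys + \<sigma>\<^sub>1 * (R + norm ys)"
  have I01: "(0, 1) \<in> I" using batch_pos[of 0] by (simp add: I_def)
  have XM: "X k t \<in> borel_measurable M" if "(k, t) \<in> I" for k t
    using samples_indep that unfolding M.indep_vars_def by force
  have Q_prob: "prob_space Q" and Q_sets: "sets Q = sets borel"
    using samples_law[OF I01] M.prob_space_distr[OF XM[OF I01]] by auto
  interpret Q: prob_space Q by (rule Q_prob)
  note sample_meas = sample_pseudogradient_measurable[OF f_C1 f_meas]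
  have F_meas: "F \<in> borel_measurable borel" by (rule borel_measurable_continuous_onI[OF F_cont])
  have H_meas: "(\<lambda>(y, s). H y s) \<in> borel_measurable (borel \<Otimes>\<^sub>M borel)"
  proof -
    have "(\<lambda>p. F (fst p)) \<in> borel_measurable (borel \<Otimes>\<^sub>M (borel :: (real ^ 'd ^ 'i) measure))"
      using measurable_compose[OF measurable_fst F_meas] .
    then show ?thesis using sample_meas unfolding H_def by (simp add: case_prod_beta' borel_measurable_diff)
  qed
  have Hy_meas: "H y \<in> borel_measurable Q" for y
    using measurable_compose[OF measurable_Pair1' H_meas, of y] by (simp add: measurable_cong_sets[OF Q_sets refl])
  have H_props: "integrable Q (H y)" "integrable Q (\<lambda>s. (norm (H y s))\<^sup>2)"
      "(\<integral>s. (norm (H y s))\<^sup>2 \<partial>Q) \<le> 1 + c powr p" if y: "y \<in> ?Y" for y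
  proof -
    have "norm (y - ys) \<le> R + norm ys" using R[OF y] norm_triangle_ineq4[of y ys] by linarith
    then have "\<sigma>\<^sub>0 ys + \<sigma>\<^sub>1 * norm (y - ys) \<le> c"
      using variance(2) by (simp add: c_def mult_left_mono)
    then have "(\<integral>s. norm (H y s) powr p \<partial>Q) powr (1 / p) \<le> c"
      using variance(5)[OF ys, of y] unfolding H_def by linarith
    moreover have "integrable Q (\<lambda>s. norm (H y s) powr p)" using variance(5)[OF ys, of y] unfolding H_def by blast
    ultimately show "integrable Q (H y)" "integrable Q (\<lambda>s. (norm (H y s))\<^sup>2)"
      "(\<integral>s. (norm (H y s))\<^sup>2 \<partial>Q) \<le> 1 + c powr p"
      using second_moment_le_of_Lp_bound[OF Q_prob Hy_meas variance(1)] by blast+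
  qed
  have H_mean: "(\<integral>s. H y s \<partial>Q) = 0" if y: "y \<in> ?Y" for y
  proof -
    have int: "integrable Q (sample_pseudogradient own f y)"
    proof -
      have "integrable Q (\<lambda>s. H y s + F y)" using H_props(1)[OF y] by simp
      then show ?thesis by (simp add: H_def)
    qed
    have "(\<integral>s. sample_pseudogradient own f y s \<partial>Q) = F y"
      unfolding F_def by (rule sample_pseudogradient_mean[OF f_C1 f_meas samples_marginal Q_sets xi(2) int])
    then show ?thesis using int by (simp add: H_def Q.prob_space)
  qed

  interpret mb: minibatch_oracle M init S X Q H ?Y "1 + c powr p"
  proof (unfold_locales, unfold I_def[symmetric])
    show "init \<in> borel_measurable M" by (rule init_meas)
    show "M.indep_vars (\<lambda>_. borel) (\<lambda>(k, t). X k t) I" by (rule samples_indep)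
    have "(\<lambda>\<omega>. \<lambda>(k, t)\<in>I. X k t \<omega>) = (\<lambda>\<omega>. \<lambda>i\<in>I. (case i of (k, t) \<Rightarrow> X k t) \<omega>)"
      by (auto simp: fun_eq_iff restrict_def)
    then show "M.indep_set (sets (vimage_algebra (space M) init borel))
         (sets (vimage_algebra (space M) (\<lambda>\<omega>. \<lambda>i\<in>I. (case i of (k, t) \<Rightarrow> X k t) \<omega>) (Pi\<^sub>M I (\<lambda>_. borel))))"
      using samples_init_indep by simp
    show "distr M borel (case i of (k, t) \<Rightarrow> X k t) = Q" if "i \<in> I" for i
      using that samples_law by (cases i) auto
    show "summable (\<lambda>k. 1 / real (S k))" by (rule summable_inverse_batch_size[OF batch_size])
  qed (fact H_meas H_props H_mean batch_pos)+

  define e where "e k = mb.batch_error k (x k)" for k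
  have F_h_block: "F\<^sub>h k \<omega> i = block own i (F (x k \<omega>) + e k \<omega>)" for k \<omega> i
  proof -
    have "e k \<omega> = (1 / real (S k)) *\<^sub>R (\<Sum>t=1..S k. sample_pseudogradient own f (x k \<omega>) (X k t \<omega>)) - F (x k \<omega>)"
      using batch_pos[of k]
      by (simp add: e_def mb.batch_error_def H_def sum_subtractf scaleR_diff_right sum_constant_scaleR del: sum_constant)
    then show ?thesis
      by (simp add: F\<^sub>h_def batch_gradient_def sample_pseudogradient_block[OF f_C1 f_meas] block_scaleR
          linear_sum[OF linear_block])
  qed

  define T where "T i v = prox (block_space own i) (\<lambda>u. ereal (\<alpha> i) * g i u) v" for i v
  have T_cont: "continuous_on UNIV (T i)" for i
    unfolding T_def using is_prox_nonexpansive[OF prox prox]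
    by (intro lipschitz_on_continuous_on[of 1] lipschitz_onI) (auto simp: dist_norm)
  have T_meas: "T i \<in> borel_measurable borel" for i by (rule borel_measurable_continuous_onI[OF T_cont])
  have T_in: "T i v \<in> \<Omega> i" for i v using prox[of i v] by (simp add: T_def is_prox_def)
  (* The primal step from y with gradient G and multipliers \<mu>. *)
  define N where "N G y \<mu> = (\<Sum>i\<in>UNIV. T i (block own i y - \<alpha> i *\<^sub>R (block own i G + transpose (A\<^sub>i i) *v (\<mu> $ i))))"
    for G y :: "real ^ 'n" and \<mu> :: "real ^ 'm ^ 'i"
  have N_block: "block own i (N G y \<mu>) = T i (block own i y - \<alpha> i *\<^sub>R (block own i G + transpose (A\<^sub>i i) *v (\<mu> $ i)))" for i G y \<mu>
  proof -
    have "block own i u = (if i = j then u else 0)" if "u \<in> \<Omega> j" for u j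
      using Om_sub[of j] that by (auto simp: block_def block_space_def vec_eq_iff)
    then have "block own i (T j v) = (if i = j then T j v else 0)" for j v using T_in by blast
    then show ?thesis by (simp add: N_def linear_sum[OF linear_block])
  qed
  have N_Y: "N G y \<mu> \<in> ?Y" for G y \<mu> by (simp add: strategy_set_def N_block T_in)
  have N_meas: "(\<lambda>\<omega>. N (G \<omega>) (y \<omega>) (\<mu> \<omega>)) \<in> borel_measurable K"
    if "G \<in> borel_measurable K" "y \<in> borel_measurable K" "\<mu> \<in> borel_measurable K" for G y \<mu> and K :: "'w measure"
  proof -
    have bl: "(\<lambda>\<omega>. block own i (v \<omega>)) \<in> borel_measurable K" if "v \<in> borel_measurable K" for i v
      using measurable_compose[OF that borel_measurable_continuous_onI[OF continuous_on_block]] .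
    have mu: "(\<lambda>\<omega>. transpose (A\<^sub>i i) *v (\<mu> \<omega> $ i)) \<in> borel_measurable K" for i
      using measurable_compose[OF measurable_compose[OF that(3) borel_measurable_vec_nth]
          borel_measurable_continuous_onI[OF linear_continuous_on[OF matrix_vector_mul_bounded_linear]]] .
    show ?thesis unfolding N_def
      by (intro borel_measurable_sum measurable_compose[OF _ T_meas] borel_measurable_diff borel_measurable_scaleR
          borel_measurable_const borel_measurable_add bl mu that)
  qed
  have x_Suc: "x (Suc k) \<omega> = N (F (x k \<omega>) + e k \<omega>) (x k \<omega>) (l k \<omega>)" if "\<omega> \<in> space M" for k \<omega>
  proof -
    have "x (Suc k) \<omega> = (\<Sum>i\<in>UNIV. block own i (x (Suc k) \<omega>))" by (rule sum_block[symmetric])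
    also have "\<dots> = N (F (x k \<omega>) + e k \<omega>) (x k \<omega>) (l k \<omega>)"
      unfolding N_def by (intro sum.cong refl) (simp add: x_update[OF that] F_h_block T_def)
    finally show ?thesis .
  qed
  have x_Y: "x k \<omega> \<in> ?Y" if "\<omega> \<in> space M" for k \<omega>
    using initial(1)[OF that] x_Suc[OF that] N_Y by (cases k) (auto simp: strategy_set_def)

  have adapted: "x k \<in> borel_measurable (mb.hist k) \<and> z k \<in> borel_measurable (mb.hist k) \<and> l k \<in> borel_measurable (mb.hist k)" for k
  proof (induction k)
    case 0
    have "(\<lambda>\<omega>. fst (init \<omega>)) \<in> borel_measurable (mb.hist 0)" "(\<lambda>\<omega>. fst (snd (init \<omega>))) \<in> borel_measurable (mb.hist 0)"
      "(\<lambda>\<omega>. snd (snd (init \<omega>))) \<in> borel_measurable (mb.hist 0)"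
      by (rule measurable_compose[OF mb.init_measurable_hist borel_measurable_continuous_onI], intro continuous_intros)+
    then show ?case by (simp add: init_def)
  next
    case (Suc k)
    let ?K = "mb.hist (Suc k)"
    note up = measurable_from_subalg[OF mb.hist_Suc[of k]]
    have x0: "x k \<in> borel_measurable ?K" and z0: "z k \<in> borel_measurable ?K" and l0: "l k \<in> borel_measurable ?K"
      using Suc up by blast+
    have e0: "e k \<in> borel_measurable ?K" unfolding e_def using mb.batch_error_measurable_hist Suc by blast
    have "(\<lambda>\<omega>. N (F (x k \<omega>) + e k \<omega>) (x k \<omega>) (l k \<omega>)) \<in> borel_measurable ?K"
      by (intro N_meas borel_measurable_add measurable_compose[OF x0 F_meas] e0 x0 l0)
    then have x1: "x (Suc k) \<in> borel_measurable ?K"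
      by (subst measurable_cong[where g = "\<lambda>\<omega>. N (F (x k \<omega>) + e k \<omega>) (x k \<omega>) (l k \<omega>)"]) (auto simp: x_Suc)
    note nth = measurable_compose[OF _ borel_measurable_vec_nth]
    have z1: "z (Suc k) \<in> borel_measurable ?K"
    proof (rule borel_measurable_vecI)
      fix i
      have "(\<lambda>\<omega>. z k \<omega> $ i - \<nu> i *\<^sub>R (\<Sum>j\<in>UNIV. W $ i $ j *\<^sub>R (l k \<omega> $ i - l k \<omega> $ j))) \<in> borel_measurable ?K"
        by (intro borel_measurable_diff borel_measurable_scaleR borel_measurable_const borel_measurable_sum nth[OF z0] nth[OF l0])
      then show "(\<lambda>\<omega>. z (Suc k) \<omega> $ i) \<in> borel_measurable ?K"
        by (subst measurable_cong[where g = "\<lambda>\<omega>. z k \<omega> $ i - \<nu> i *\<^sub>R (\<Sum>j\<in>UNIV. W $ i $ j *\<^sub>R (l k \<omega> $ i - l k \<omega> $ j))"])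
           (auto simp: z_update)
    qed
    have l1: "l (Suc k) \<in> borel_measurable ?K"
    proof (rule borel_measurable_vecI)
      fix i
      let ?S = "{u :: real ^ 'm. 0 \<le> u}"
      have ne: "?S \<noteq> {}" by auto
      have cp: "closest_point ?S \<in> borel_measurable borel"
        by (intro borel_measurable_continuous_onI continuous_on_closest_point convex_nonneg_orthant closed_nonneg_orthant ne)
      have bl: "(\<lambda>\<omega>. block own i (v \<omega>)) \<in> borel_measurable ?K" if "v \<in> borel_measurable ?K" for v
        using measurable_compose[OF that borel_measurable_continuous_onI[OF continuous_on_block]] .
      have Ai: "(\<lambda>\<omega>. A\<^sub>i i *v v \<omega>) \<in> borel_measurable ?K" if "v \<in> borel_measurable ?K" for v
        using measurable_compose[OF that borel_measurable_continuous_onI[OF linear_continuous_on[OF matrix_vector_mul_bounded_linear]]] .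
      let ?g = "\<lambda>\<omega>. closest_point ?S
              (l k \<omega> $ i
                + \<sigma> i *\<^sub>R (A\<^sub>i i *v (2 *\<^sub>R block own i (x (Suc k) \<omega>) - block own i (x k \<omega>)) - bs i)
                + \<sigma> i *\<^sub>R (\<Sum>j\<in>UNIV. W $ i $ j *\<^sub>R
                    (2 *\<^sub>R (z (Suc k) \<omega> $ i - z (Suc k) \<omega> $ j) - (z k \<omega> $ i - z k \<omega> $ j)))
                - \<sigma> i *\<^sub>R (\<Sum>j\<in>UNIV. W $ i $ j *\<^sub>R (l k \<omega> $ i - l k \<omega> $ j)))"
      have "?g \<in> borel_measurable ?K"
        by (intro measurable_compose[OF _ cp] borel_measurable_diff borel_measurable_add borel_measurable_scaleR
            borel_measurable_const borel_measurable_sum Ai bl nth[OF z0] nth[OF z1] nth[OF l0] x0 x1)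
      then show "(\<lambda>\<omega>. l (Suc k) \<omega> $ i) \<in> borel_measurable ?K"
        by (subst measurable_cong[where g = ?g]) (auto simp: l_update)
    qed
    show ?case using x1 z1 l1 by blast
  qed
  have x_hist: "x k \<in> borel_measurable (mb.hist k)" and l_hist: "l k \<in> borel_measurable (mb.hist k)" for k
    using adapted by blast+

  (* The step with the exact gradient is determined by the past, unlike x (Suc k). *)
  define xt where "xt k \<omega> = N (F (x k \<omega>)) (x k \<omega>) (l k \<omega>)" for k \<omega>
  have xt_hist: "xt k \<in> borel_measurable (mb.hist k)" for k
    unfolding xt_def by (intro N_meas measurable_compose[OF x_hist F_meas] x_hist l_hist)
  have near: "norm (x (Suc k) \<omega> - xt k \<omega>) \<le> (\<Sum>i\<in>UNIV. \<alpha> i) * norm (e k \<omega>)" if "\<omega> \<in> space M" for k \<omega>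
  proof -
    have T_le: "norm (T i u - T i v) \<le> norm (u - v)" for i u v
      unfolding T_def by (rule is_prox_nonexpansive[OF prox prox])
    have block_le: "norm (block own i u) \<le> norm u" for i u
      by (rule norm_le_componentwise_cart) (simp add: block_def)
    let ?v = "\<lambda>G i. block own i (x k \<omega>) - \<alpha> i *\<^sub>R (block own i G + transpose (A\<^sub>i i) *v (l k \<omega> $ i))"
    have "x (Suc k) \<omega> - xt k \<omega> = (\<Sum>i\<in>UNIV. T i (?v (F (x k \<omega>) + e k \<omega>) i) - T i (?v (F (x k \<omega>)) i))"
      unfolding x_Suc[OF that] xt_def N_def by (simp add: sum_subtractf)
    also have "norm \<dots> \<le> (\<Sum>i\<in>UNIV. \<alpha> i * norm (e k \<omega>))"
    proof (rule sum_norm_le)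
      fix i
      have "?v (F (x k \<omega>) + e k \<omega>) i - ?v (F (x k \<omega>)) i = - (\<alpha> i *\<^sub>R block own i (e k \<omega>))"
        by (simp add: block_add algebra_simps)
      then have "norm (T i (?v (F (x k \<omega>) + e k \<omega>) i) - T i (?v (F (x k \<omega>)) i)) \<le> norm (- (\<alpha> i *\<^sub>R block own i (e k \<omega>)))"
        using T_le by metis
      also have "\<dots> \<le> \<alpha> i * norm (e k \<omega>)"
        using step_sizes(2)[of i] block_le[of i "e k \<omega>"] by (simp add: mult_left_mono)
      finally show "norm (T i (?v (F (x k \<omega>) + e k \<omega>) i) - T i (?v (F (x k \<omega>)) i)) \<le> \<alpha> i * norm (e k \<omega>)" .
    qed
    finally show ?thesis by (simp add: sum_distrib_right)
  qed

  have ae1: "AE \<omega> in M. summable (\<lambda>k. (norm (e k \<omega>))\<^sup>2)"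
    unfolding e_def by (rule mb.batch_error_square_summable[OF x_hist x_Y])
  have ae2: "AE \<omega> in M. summable (\<lambda>k. e k \<omega> \<bullet> xt k \<omega>)"
    unfolding e_def by (rule mb.predictable_batch_error_summable[OF x_hist x_Y xt_hist, where R = R]) (auto simp: xt_def R N_Y)
  (* A constant multiplier gives the coordinates of the error itself. *)
  have "AE \<omega> in M. summable (\<lambda>k. e k \<omega> \<bullet> axis j 1)" for j
    unfolding e_def by (rule mb.predictable_batch_error_summable[OF x_hist x_Y, where R = 1]) (auto simp: norm_axis_1)
  then have ae3: "AE \<omega> in M. \<forall>j. summable (\<lambda>k. e k \<omega> $ j)"
    by (subst AE_all_countable) (simp add: inner_axis)

  have \<theta>: "\<theta> \<le> \<beta>" "2 * max_wdegree W * \<theta> \<le> 1"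
  proof -
    show "\<theta> \<le> \<beta>" using step_sizes(6) by simp
    have le: "ereal \<theta> \<le> 1 / ereal (2 * max_wdegree W)" using step_sizes(6) by simp
    (* With a single agent and no loop the degree is 0, and the bound on \<theta> is infinite. *)
    show "2 * max_wdegree W * \<theta> \<le> 1"
    proof (cases "max_wdegree W \<le> 0")
      case True
      then have "max_wdegree W * \<theta> \<le> 0" using step_sizes(5) by (intro mult_nonpos_nonneg) auto
      then show ?thesis by linarith
    next
      case False
      then have "\<theta> \<le> 1 / (2 * max_wdegree W)" using le by (simp add: one_ereal_def)
      then show ?thesis using False by (simp add: field_simps)
    qed
  qed

  have "AE \<omega> in M. \<omega> \<in> space M" by simp
  with ae1 ae2 ae3 show ?thesis
  proof eventually_elim
    case (elim \<omega>)
    show ?case unfolding SOL_eq total_cost_def[abs_def]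
    proof (rule forward_backward_path_converges[where G = "\<lambda>k. F (x k \<omega>) + e k \<omega>" and xt = "\<lambda>k. xt k \<omega>" and bs = bs
          and h = hr and C = "\<Sum>i\<in>UNIV. \<alpha> i" and z = "\<lambda>k. z k \<omega>" and l = "\<lambda>k. l k \<omega>"])
      show "is_prox (\<Omega> i) (\<lambda>u. \<alpha> i * hr i u)
        (block own i (x k \<omega>) - \<alpha> i *\<^sub>R (block own i (F (x k \<omega>) + e k \<omega>) + transpose (block_columns own A i) *v (l k \<omega> $ i)))
        (block own i (x (Suc k) \<omega>))" for k i
        using prox by (simp add: x_update[OF elim(4)] F_h_block A\<^sub>i_def)
      show "(F y - F ys) \<bullet> (y - ys) \<ge> \<beta> * (norm (F y - F ys))\<^sup>2"
        if "ys \<in> real_vi_solutions (feasible_set own \<Omega> A b) F (\<lambda>y. \<Sum>i\<in>UNIV. hr i (block own i y))" for y ys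
        using cocoercive(2) that unfolding SOL_eq total_cost_def[abs_def] by blast
      show "z (Suc k) \<omega> $ i = z k \<omega> $ i - \<nu> i *\<^sub>R (\<Sum>j\<in>UNIV. W $ i $ j *\<^sub>R (l k \<omega> $ i - l k \<omega> $ j))" for k i
        by (rule z_update[OF elim(4)])
      show "0 < \<alpha> i \<and> \<alpha> i \<le> inverse (\<gamma> + (MAX j\<in>{j. own j = i}.
          \<Sum>r\<in>UNIV. \<bar>transpose (block_columns own A i) $ j $ r\<bar>))" for i
        using step_sizes(2)[of i] unfolding A\<^sub>i_def .
      show "0 < \<nu> i \<and> \<nu> i \<le> inverse (\<gamma> + 2 * wdegree W i)" for i by (rule step_sizes(3))
      show "0 < \<sigma> i \<and> \<sigma> i \<le> inverse (\<gamma> + 2 * wdegree W i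
            + (MAX r\<in>UNIV. \<Sum>j | own j = i. \<bar>block_columns own A i $ r $ j\<bar>))" for i
        using step_sizes(4)[of i] unfolding A\<^sub>i_def .
    qed (use elim near[OF elim(4)] l_update[OF elim(4)] graph dims Omega hr_lsc hr_convex b_split slater F_cont \<theta> step_sizes(1,5,7)
         in \<open>simp_all add: A\<^sub>i_def\<close>)
  qed
qed

end
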